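(* There exist absolute constants $c_1,c_2>0$ such that if $K$ is an unconditional isotropic convex body in $\mathbb{R}^n$, then $$c_1\sqrt{qn}\leq I_1(K,Z_q^\circ(K))\leq c_2\sqrt{qn}\,\log n$$ for all $2\leq q\leq n$.
   Context: A convex body $K$ in $\mathbb{R}^n$ (compact, convex, nonempty interior) is isotropic if it has volume $1$, its center of mass is at the origin, and there is $L_K>0$ with $\int_K\langle x,\theta\rangle^2dx=L_K^2$ for every $\theta\in S^{n-1}$. $K$ is unconditional if it is symmetric with respect to all coordinate hyperplanes for some orthonormal basis of $\mathbb{R}^n$. For $q\geq1$, $Z_q(K)$ is the symmetric convex body with support function $h_{Z_q(K)}(y)=\left(\int_K|\langle x,y\rangle|^qdx\right)^{1/q}$, $Z_q^\circ(K)$ is its polar body, and $I_1(K,Z_q^\circ(K))=\int_Kh_{Z_q(K)}(x)\,dx$. Absolute constants do not depend on $n$, $K$, $q$. *)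

theory Defs
  imports "HOL-Analysis.Analysis"
begin

text \<open>
  The constants of the theorem are uniform in the dimension \<open>n\<close>, so \<open>n\<close> has to be quantified
  inside the formula and cannot be a type.  Points of \<open>n\<close>-space are therefore the extensional
  functions on \<open>{..<n}\<close>: exactly the space of the product measure and of the product topology used
  below.
\<close>

abbreviation Rn :: "nat \<Rightarrow> (nat \<Rightarrow> real) set" where
  "Rn n \<equiv> ({..<n} \<rightarrow>\<^sub>E (UNIV :: real set))"

abbreviation Rn_top :: "nat \<Rightarrow> (nat \<Rightarrow> real) topology" where
  "Rn_top n \<equiv> product_topology (\<lambda>_. euclideanreal) {..<n}"

abbreviation Rn_leb :: "nat \<Rightarrow> (nat \<Rightarrow> real) measure" where
  "Rn_leb n \<equiv> Pi\<^sub>M {..<n} (\<lambda>_. lborel)"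

lemma Rn_carriers: "topspace (Rn_top n) = Rn n" "space (Rn_leb n) = Rn n"
  by (simp_all add: space_PiM)

definition dot :: "nat \<Rightarrow> (nat \<Rightarrow> real) \<Rightarrow> (nat \<Rightarrow> real) \<Rightarrow> real" where
  "dot n x y = (\<Sum>i<n. x i * y i)"

definition convex_Rn :: "nat \<Rightarrow> (nat \<Rightarrow> real) set \<Rightarrow> bool" where
  "convex_Rn n K \<longleftrightarrow>
     K \<subseteq> Rn n \<and>
     (\<forall>x\<in>K. \<forall>y\<in>K. \<forall>t\<in>{0..1}. (\<lambda>i\<in>{..<n}. (1 - t) * x i + t * y i) \<in> K)"

definition convex_body :: "nat \<Rightarrow> (nat \<Rightarrow> real) set \<Rightarrow> bool" where
  "convex_body n K \<longleftrightarrow>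
     compactin (Rn_top n) K \<and> convex_Rn n K \<and> Rn_top n interior_of K \<noteq> {}"

definition isotropic :: "nat \<Rightarrow> (nat \<Rightarrow> real) set \<Rightarrow> bool" where
  "isotropic n K \<longleftrightarrow>
     measure (Rn_leb n) K = 1 \<and>
     (\<forall>i<n. (LINT x:K|Rn_leb n. x i) = 0) \<and>
     (\<exists>L>0. \<forall>\<theta>\<in>Rn n. dot n \<theta> \<theta> = 1 \<longrightarrow> (LINT x:K|Rn_leb n. (dot n x \<theta>)\<^sup>2) = L\<^sup>2)"

text \<open>\<open>n\<close> orthonormal vectors of \<open>n\<close>-space automatically form a basis.\<close>

definition orthonormal_basis :: "nat \<Rightarrow> (nat \<Rightarrow> nat \<Rightarrow> real) \<Rightarrow> bool" where
  "orthonormal_basis n u \<longleftrightarrow>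
     (\<forall>j<n. u j \<in> Rn n) \<and>
     (\<forall>j<n. \<forall>k<n. dot n (u j) (u k) = (if j = k then 1 else 0))"

text \<open>For a unit vector \<open>u\<close>, the reflection in the hyperplane orthogonal to \<open>u\<close>.\<close>

definition reflect :: "nat \<Rightarrow> (nat \<Rightarrow> real) \<Rightarrow> (nat \<Rightarrow> real) \<Rightarrow> (nat \<Rightarrow> real)" where
  "reflect n u x = (\<lambda>i\<in>{..<n}. x i - 2 * dot n x u * u i)"

definition unconditional :: "nat \<Rightarrow> (nat \<Rightarrow> real) set \<Rightarrow> bool" where
  "unconditional n K \<longleftrightarrow>
     (\<exists>u. orthonormal_basis n u \<and> (\<forall>j<n. reflect n (u j) ` K = K))"

definition support_fun :: "nat \<Rightarrow> (nat \<Rightarrow> real) set \<Rightarrow> (nat \<Rightarrow> real) \<Rightarrow> real" where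
  "support_fun n C y = (SUP x\<in>C. dot n x y)"

text \<open>
  \<open>Z_q(K)\<close>: the closed convex set whose support function is a given sublinear \<open>h\<close> is the
  intersection of the half-spaces \<open>\<langle>z, y\<rangle> \<le> h y\<close>.
\<close>

definition Z_body :: "nat \<Rightarrow> real \<Rightarrow> (nat \<Rightarrow> real) set \<Rightarrow> (nat \<Rightarrow> real) set" where
  "Z_body n q K =
     {z \<in> Rn n. \<forall>y\<in>Rn n.
        dot n z y \<le> (LINT x:K|Rn_leb n. \<bar>dot n x y\<bar> powr q) powr (1 / q)}"

text \<open>
  \<open>I_1(K, Z_q\<degree>(K))\<close>; the norm whose unit ball is the polar body \<open>Z_q\<degree>(K)\<close> is the support
  function of \<open>Z_q(K)\<close>.
\<close>

definition I1_Z_polar :: "nat \<Rightarrow> real \<Rightarrow> (nat \<Rightarrow> real) set \<Rightarrow> real" where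
  "I1_Z_polar n q K = (LINT x:K|Rn_leb n. support_fun n (Z_body n q K) x)"

end

(*
  In the coordinates of the reflecting basis, K is invariant under sign changes, and the
  Prekopa-Leindler inequality shows that u(a) = P(|x_i| >= a_i for all i) is logarithmically concave;
  so u(a) <= exp (- sum k_i a_i), where k_i bounds the density of |x_i| at 0 from below.  As K contains
  the box spanned by any of its points, prod 2|x_i| <= 1 on K, which bounds the isotropic constant
  and makes the k_i absolute (this is the argument of Bobkov and Nazarov).  Comparing K in this
  way with independent exponential variables gives E exp <t, x> <= exp (C |t|^2) for |t_i| <= c,
  hence h_{Z_q(K)}(y) <= C sqrt(qn) max |y_i|, and E max |y_i| <= C log n.

  For the lower bound, h_{Z_q(K)} is tested against a product weight prod (1 + d sgn y_i sgn x_i) with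
  d^2 = q/n, which gives h_{Z_q(K)}(y) >= c d sum |y_i| E|x_i|; and sum E|x_i| >= c n because K has
  volume 1.
*)

theory Submission
  imports Defs
begin

section \<open>The Prekopa-Leindler inequality\<close>

text \<open>Midpoints suffice: comparing a with 0 gives u(a) <= u(a/2)^2, hence u(a) <= u(a/N)^N for
  N = 2^k. Inclusion-exclusion near 0 gives u(a/N) <= 1 - S/N + D/N^2 with S = sum k_i a_i; the
  constant D depends on n and on the size of K, but its contribution vanishes in the limit. The
  resulting bound is used twice. With a rate on a single coordinate it turns the mass of a thin slab
  into an upper bound for L, so that the mass of a slab of half-width r is O(r/L) and E
  (2|x_i|)^(-1/2) is O(L^(-1/2)); together with the box bound this yields L <= 9. Chebyshev's
  inequality at 2L and contraction of one coordinate then make 1/24 a rate for all coordinates at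
  once. The condition q <= n enters through the tilt sqrt(q/n): in the upper bound it has to stay in
  the range of the moment bound, in the lower bound it has to keep the weight nonnegative. Two
  further facts are required because of the definitions: Lebesgue measure is invariant under a
  change to the arbitrary reflecting basis, and the support function of \<open>Z_body\<close>, which
  is an intersection of half-spaces, really is the L_q norm.\<close>

lemma nn_integral_layer_cake:
  assumes "sigma_finite_measure M" and f[measurable]: "f \<in> borel_measurable M"
  shows "(\<integral>\<^sup>+x. f x \<partial>M) =
    (\<integral>\<^sup>+t. emeasure M {x \<in> space M. ennreal t < f x} * indicator {0..} t \<partial>lborel)"
proof -
  interpret sigma_finite_measure M by fact
  interpret pair_sigma_finite lborel M ..
  have *: "(\<integral>\<^sup>+t. indicator {t. 0 \<le> t \<and> ennreal t < y} t \<partial>lborel) = y" for y :: ennreal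
  proof (cases y)
    case (real r)
    then have "{t. 0 \<le> t \<and> ennreal t < y} = {0..<r}" by (auto simp: ennreal_less_iff)
    then show ?thesis using real by simp
  next
    case top
    then have "{t. 0 \<le> t \<and> ennreal t < y} = {0::real..}" by auto
    moreover have "emeasure lborel {0::real..} = \<infinity>"
    proof (rule ccontr)
      assume "\<not> ?thesis"
      then obtain r where r: "emeasure lborel {0::real..} = ennreal r" "r \<ge> 0"
        by (metis ennreal_cases infinity_ennreal_def)
      have "ennreal (r+1) = emeasure lborel {0..r+1}" using r by simp
      also have "\<dots> \<le> emeasure lborel {0::real..}" by (rule emeasure_mono) auto
      finally show False using r by (simp add: ennreal_le_iff)
    qed
    ultimately show ?thesis using top by simp
  qed
  have "(\<integral>\<^sup>+x. f x \<partial>M) = (\<integral>\<^sup>+x. (\<integral>\<^sup>+t. indicator {t. 0 \<le> t \<and> ennreal t < f x} t \<partial>lborel) \<partial>M)"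
    by (simp only: *)
  also have "\<dots> = (\<integral>\<^sup>+t. (\<integral>\<^sup>+x. indicator {t. 0 \<le> t \<and> ennreal t < f x} t \<partial>M) \<partial>lborel)"
    by (rule Fubini') (simp add: case_prod_beta indicator_def)
  also have "\<dots> = (\<integral>\<^sup>+t. emeasure M {x \<in> space M. ennreal t < f x} * indicator {0..} t \<partial>lborel)"
  proof (rule nn_integral_cong)
    fix t :: real
    have "(\<integral>\<^sup>+x. indicator {t. 0 \<le> t \<and> ennreal t < f x} t \<partial>M) =
      (\<integral>\<^sup>+x. indicator {x \<in> space M. ennreal t < f x} x * indicator {0..} t \<partial>M)"
      by (rule nn_integral_cong) (auto simp: indicator_def)
    also have "\<dots> = emeasure M {x \<in> space M. ennreal t < f x} * indicator {0..} t"
      by (subst nn_integral_multc) auto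
    finally show "(\<integral>\<^sup>+x. indicator {t. 0 \<le> t \<and> ennreal t < f x} t \<partial>M) = \<dots>" .
  qed
  finally show ?thesis .
qed

text \<open>Averaging the part of \<open>A\<close> left of \<open>a\<close> with \<open>b\<close>
  lands in \<open>C\<close> left of \<open>m\<close>, averaging the part of \<open>B\<close> right
  of \<open>b\<close> with \<open>a\<close> lands right of \<open>m\<close>. These two pieces of
  \<open>C\<close> are disjoint, and averaging with a fixed point halves lengths.\<close>

lemma brunn_minkowski_real_aux:
  fixes A B C :: "real set"
  assumes [measurable]: "A \<in> sets borel" "B \<in> sets borel" "C \<in> sets borel"
    and "a \<in> A" "b \<in> B" and C: "\<And>x y. x \<in> A \<Longrightarrow> y \<in> B \<Longrightarrow> (x + y) / 2 \<in> C"
  shows "emeasure lborel (A \<inter> {..a}) + emeasure lborel (B \<inter> {b<..}) \<le> 2 * emeasure lborel C"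
proof -
  define m where "m = (a + b) / 2"
  have half: "2 * (\<integral>\<^sup>+x. f x \<partial>lborel) = (\<integral>\<^sup>+x. f (t + x/2) \<partial>lborel)"
    if [measurable]: "f \<in> borel_measurable borel" for f and t :: real
  proof -
    have "2 * (\<integral>\<^sup>+x. f x \<partial>lborel) = ennreal 2 * (ennreal (1/2) * (\<integral>\<^sup>+x. f (t + x/2) \<partial>lborel))"
      using nn_integral_real_affine[of f "1/2" t] by (simp)
    then show ?thesis by (simp only: mult.assoc[symmetric] ennreal_mult[symmetric]) simp
  qed
  have 1: "emeasure lborel (A \<inter> {..a}) \<le> 2 * emeasure lborel (C \<inter> {..m})"
  proof -
    have "emeasure lborel (A \<inter> {..a}) = (\<integral>\<^sup>+x. indicator (A \<inter> {..a}) x \<partial>lborel)" by simp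
    also have "\<dots> \<le> (\<integral>\<^sup>+x. indicator (C \<inter> {..m}) (b/2 + x/2) \<partial>lborel)"
      using C \<open>b \<in> B\<close> by (intro nn_integral_mono) (auto simp: indicator_def m_def add_divide_distrib add.commute)
    also have "\<dots> = 2 * emeasure lborel (C \<inter> {..m})" by (subst half[symmetric]) auto
    finally show ?thesis .
  qed
  have 2: "emeasure lborel (B \<inter> {b<..}) \<le> 2 * emeasure lborel (C \<inter> {m<..})"
  proof -
    have "emeasure lborel (B \<inter> {b<..}) = (\<integral>\<^sup>+x. indicator (B \<inter> {b<..}) x \<partial>lborel)" by simp
    also have "\<dots> \<le> (\<integral>\<^sup>+x. indicator (C \<inter> {m<..}) (a/2 + x/2) \<partial>lborel)"
      using C \<open>a \<in> A\<close> by (intro nn_integral_mono) (force simp: indicator_def m_def add_divide_distrib add.commute)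
    also have "\<dots> = 2 * emeasure lborel (C \<inter> {m<..})" by (subst half[symmetric]) auto
    finally show ?thesis .
  qed
  have "emeasure lborel (C \<inter> {..m}) + emeasure lborel (C \<inter> {m<..}) =
      emeasure lborel ((C \<inter> {..m}) \<union> (C \<inter> {m<..}))"
    by (rule plus_emeasure) auto
  also have "(C \<inter> {..m}) \<union> (C \<inter> {m<..}) = C" by auto
  finally show ?thesis using add_mono[OF 1 2] by (simp add: distrib_left[symmetric])
qed

text \<open>With \<open>a\<close> within \<open>e/2\<close> of the supremum of \<open>A\<close> and
  \<open>b\<close> within \<open>e/2\<close> of the infimum of \<open>B\<close>, the cuts of the
  auxiliary lemma discard length at most \<open>e\<close>. Passing through a given \<open>C\<close>
  avoids any question of measurability of the sumset.\<close>

lemma brunn_minkowski_real: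
  fixes A B C :: "real set"
  assumes [measurable]: "A \<in> sets borel" "B \<in> sets borel" "C \<in> sets borel"
    and "A \<noteq> {}" "B \<noteq> {}" and bounded: "A \<subseteq> {-k..k}" "B \<subseteq> {-k..k}"
    and C: "\<And>x y. x \<in> A \<Longrightarrow> y \<in> B \<Longrightarrow> (x + y) / 2 \<in> C"
  shows "emeasure lborel A + emeasure lborel B \<le> 2 * emeasure lborel C"
proof (rule ennreal_le_epsilon)
  fix e :: real assume "e > 0"
  have bdd: "bdd_above A" "bdd_below B"
    using bounded by (meson bdd_above_Icc bdd_below_Icc bdd_above_mono bdd_below_mono)+
  obtain a where a: "a \<in> A" "Sup A - e/2 < a"
    using less_cSupE[of "Sup A - e/2" A] \<open>A \<noteq> {}\<close> \<open>e > 0\<close> by auto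
  obtain b where b: "b \<in> B" "b < Inf B + e/2"
    using cInf_lessD[of B "Inf B + e/2"] \<open>B \<noteq> {}\<close> \<open>e > 0\<close> by auto
  have "emeasure lborel A \<le> emeasure lborel (A \<inter> {..a} \<union> {Sup A - e/2..Sup A})"
    using a cSup_upper[OF _ bdd(1)] by (intro emeasure_mono) auto
  also have "\<dots> \<le> emeasure lborel (A \<inter> {..a}) + ennreal (e/2)"
    using \<open>e > 0\<close> by (intro order.trans[OF emeasure_subadditive]) auto
  finally have 1: "emeasure lborel A \<le> \<dots>" .
  have "emeasure lborel B \<le> emeasure lborel (B \<inter> {b<..} \<union> {Inf B..Inf B + e/2})"
    using b cInf_lower[OF _ bdd(2)] by (intro emeasure_mono) auto
  also have "\<dots> \<le> emeasure lborel (B \<inter> {b<..}) + ennreal (e/2)"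
    using \<open>e > 0\<close> by (intro order.trans[OF emeasure_subadditive]) auto
  finally have 2: "emeasure lborel B \<le> \<dots>" .
  have "emeasure lborel A + emeasure lborel B \<le>
     (emeasure lborel (A \<inter> {..a}) + emeasure lborel (B \<inter> {b<..})) + (ennreal (e/2) + ennreal (e/2))"
    using add_mono[OF 1 2] by (simp add: ac_simps)
  also have "ennreal (e/2) + ennreal (e/2) = ennreal e"
    using \<open>e > 0\<close> by (subst ennreal_plus[symmetric]) auto
  also have "emeasure lborel (A \<inter> {..a}) + emeasure lborel (B \<inter> {b<..}) \<le> 2 * emeasure lborel C"
    using a b C by (intro brunn_minkowski_real_aux) auto
  finally show "emeasure lborel A + emeasure lborel B \<le> 2 * emeasure lborel C + ennreal e"
    by (simp add: add_right_mono)
qed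

text \<open>Layer cake reduces this to level sets: \<open>f x > t\<close> and \<open>g y > t\<close>
  force \<open>h > t\<close> at the midpoint. As both suprema are 1, the level sets of
  \<open>f\<close> and \<open>g\<close> are nonempty for every \<open>t < 1\<close> and both empty
  from 1 on, which is why even the additive form holds.\<close>

lemma prekopa_leindler_normalized:
  fixes f g h :: "real \<Rightarrow> ennreal"
  assumes [measurable]: "f \<in> borel_measurable borel" "g \<in> borel_measurable borel" "h \<in> borel_measurable borel"
    and sup: "(SUP x. f x) = 1" "(SUP x. g x) = 1"
    and supp: "\<And>x. x \<notin> {-k..k} \<Longrightarrow> f x = 0" "\<And>x. x \<notin> {-k..k} \<Longrightarrow> g x = 0"
    and h: "\<And>x y. f x * g y \<le> (h ((x + y) / 2))\<^sup>2"
  shows "(\<integral>\<^sup>+x. f x \<partial>lborel) + (\<integral>\<^sup>+x. g x \<partial>lborel) \<le> 2 * (\<integral>\<^sup>+x. h x \<partial>lborel)"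
proof -
  have sf: "sigma_finite_measure (lborel :: real measure)" ..
  have le1: "f x \<le> 1" "g x \<le> 1" for x
    using sup SUP_upper[of x UNIV f] SUP_upper[of x UNIV g] by auto
  have [measurable]: "(\<lambda>t. emeasure lborel {x. ennreal t < u x}) \<in> borel_measurable borel"
    if [measurable]: "u \<in> borel_measurable borel" for u :: "real \<Rightarrow> ennreal"
  proof -
    have "(\<lambda>t. emeasure lborel (Pair t -` {p \<in> space (borel \<Otimes>\<^sub>M lborel). ennreal (fst p) < u (snd p)})) \<in> borel_measurable borel"
      by (rule lborel.measurable_emeasure_Pair) measurable
    then show ?thesis by (simp add: space_pair_measure vimage_def)
  qed
  have lc: "(\<integral>\<^sup>+x. u x \<partial>lborel) = (\<integral>\<^sup>+t. emeasure lborel {x. ennreal t < u x} * indicator {0..} t \<partial>lborel)"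
    if "u \<in> borel_measurable borel" for u :: "real \<Rightarrow> ennreal"
    using nn_integral_layer_cake[OF sf, of u] that by simp
  have "(\<integral>\<^sup>+x. f x \<partial>lborel) + (\<integral>\<^sup>+x. g x \<partial>lborel) =
    (\<integral>\<^sup>+t. emeasure lborel {x. ennreal t < f x} * indicator {0..} t +
            emeasure lborel {x. ennreal t < g x} * indicator {0..} t \<partial>lborel)"
    unfolding lc[OF assms(1)] lc[OF assms(2)]
    by (subst nn_integral_add) auto
  also have "\<dots> \<le> (\<integral>\<^sup>+t. 2 * (emeasure lborel {x. ennreal t < h x} * indicator {0..} t) \<partial>lborel)"
  proof (rule nn_integral_mono)
    fix t :: real
    show "emeasure lborel {x. ennreal t < f x} * indicator {0..} t +
            emeasure lborel {x. ennreal t < g x} * indicator {0..} t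
          \<le> 2 * (emeasure lborel {x. ennreal t < h x} * indicator {0..} t)"
    proof (cases "0 \<le> t \<and> t < 1")
      case True
      have "emeasure lborel {x. ennreal t < f x} + emeasure lborel {x. ennreal t < g x}
         \<le> 2 * emeasure lborel {x. ennreal t < h x}"
      proof (rule brunn_minkowski_real[where k = k])
        have t1: "ennreal t < 1" using True by (metis ennreal_1 ennreal_lessI zero_less_one)
        have "\<exists>x. ennreal t < f x" "\<exists>x. ennreal t < g x"
          using t1 sup by (metis less_SUP_iff)+
        then show "{x. ennreal t < f x} \<noteq> {}" "{x. ennreal t < g x} \<noteq> {}" by auto
        show "{x. ennreal t < f x} \<subseteq> {-k..k}" "{x. ennreal t < g x} \<subseteq> {-k..k}"
          using supp by (metis (mono_tags, lifting) mem_Collect_eq not_less_zero subsetI)+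
        fix x y assume xy: "x \<in> {x. ennreal t < f x}" "y \<in> {x. ennreal t < g x}"
        obtain u v where uv: "f x = ennreal u" "u \<ge> 0" "g y = ennreal v" "v \<ge> 0"
          using le1(1)[of x] le1(2)[of y] by (cases "f x"; cases "g y") (auto simp: top_unique)
        with xy True have "t * t < u * v"
          by (intro mult_strict_mono) (auto simp: ennreal_less_iff)
        then have "ennreal t * ennreal t < f x * g y"
          using uv True by (simp add: ennreal_mult[symmetric] ennreal_less_iff)
        also have "\<dots> \<le> (h ((x + y) / 2))\<^sup>2" by (rule h)
        finally have "ennreal t < h ((x + y) / 2)"
          unfolding power2_eq_square using mult_mono[of "h ((x + y) / 2)" "ennreal t" "h ((x + y) / 2)" "ennreal t"]
          by (meson not_le zero_le)
        then show "(x + y) / 2 \<in> {x. ennreal t < h x}" by simp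
      qed measurable
      then show ?thesis using True by simp
    next
      case False
      show ?thesis
      proof (cases "t < 0")
        case False
        with \<open>\<not> (0 \<le> t \<and> t < 1)\<close> have "1 \<le> ennreal t" by (metis ennreal_1 ennreal_leI not_less)
        then have "f x \<le> ennreal t" "g x \<le> ennreal t" for x
          using le1 order.trans by blast+
        then have "{x. ennreal t < f x} = {}" "{x. ennreal t < g x} = {}"
          by (auto simp: not_less)
        then show ?thesis by simp
      qed simp
    qed
  qed
  also have "\<dots> = 2 * (\<integral>\<^sup>+x. h x \<partial>lborel)"
    by (subst nn_integral_cmult) (auto simp flip: lc)
  finally show ?thesis .
qed

lemma ennreal_am_gm_power2:
  fixes a b c :: ennreal
  assumes "a + b \<le> 2 * c" shows "a * b \<le> c\<^sup>2"
proof (cases "c = \<infinity>")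
  case True then show ?thesis by (simp add: power2_eq_square)
next
  case False
  then obtain r where r: "c = ennreal r" "r \<ge> 0" by (metis ennreal_cases infinity_ennreal_def)
  have "a + b < \<infinity>" using assms r
    by (metis ennreal_less_top ennreal_mult_less_top ennreal_numeral infinity_ennreal_def le_less_trans)
  then obtain x y where xy: "a = ennreal x" "x \<ge> 0" "b = ennreal y" "y \<ge> 0"
    by (cases a; cases b) auto
  have "ennreal (x + y) \<le> ennreal (2 * r)"
    using assms xy r by (simp add: ennreal_mult ennreal_plus)
  then have le: "x + y \<le> 2 * r" using r by simp
  have "4 * (x * y) \<le> (x + y)\<^sup>2" using sum_squares_bound[of x y] by (simp add: power2_sum)
  also have "\<dots> \<le> (2 * r)\<^sup>2" using le xy by (intro power_mono) auto
  finally have "x * y \<le> r\<^sup>2" by (simp add: power_mult_distrib)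
  then show ?thesis using xy r by (simp add: ennreal_mult[symmetric] ennreal_power)
qed

text \<open>Dividing \<open>f\<close> and \<open>g\<close> by their suprema forces division of
  \<open>h\<close> by the geometric mean \<open>S\<close> of the two; the inequality of arithmetic
  and geometric means then turns the sum into a product.\<close>

lemma prekopa_leindler_bounded:
  fixes f g h :: "real \<Rightarrow> ennreal"
  assumes [measurable]: "f \<in> borel_measurable borel" "g \<in> borel_measurable borel" "h \<in> borel_measurable borel"
    and bdd: "\<And>x. f x \<le> ennreal k" "\<And>x. g x \<le> ennreal k"
    and supp: "\<And>x. x \<notin> {-k..k} \<Longrightarrow> f x = 0" "\<And>x. x \<notin> {-k..k} \<Longrightarrow> g x = 0"
    and h: "\<And>x y. f x * g y \<le> (h ((x + y) / 2))\<^sup>2"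
  shows "(\<integral>\<^sup>+x. f x \<partial>lborel) * (\<integral>\<^sup>+x. g x \<partial>lborel) \<le> (\<integral>\<^sup>+x. h x \<partial>lborel)\<^sup>2"
proof (cases "(SUP x. f x) = 0 \<or> (SUP x. g x) = 0")
  case True
  then have "(\<forall>x. f x = 0) \<or> (\<forall>x. g x = 0)"
    by (metis SUP_upper UNIV_I le_zero_eq)
  then show ?thesis by auto
next
  case False
  have "(SUP x. f x) \<le> ennreal k" "(SUP x. g x) \<le> ennreal k"
    using bdd by (auto intro!: SUP_least)
  then have fin: "(SUP x. f x) \<noteq> \<infinity>" "(SUP x. g x) \<noteq> \<infinity>"
    by (metis ennreal_neq_top infinity_ennreal_def top.extremum_unique)+
  obtain F G where F: "(SUP x. f x) = ennreal F" "F > 0" and G: "(SUP x. g x) = ennreal G" "G > 0"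
    using False fin
    by (metis ennreal_cases ennreal_0 infinity_ennreal_def less_eq_real_def)
  define S where "S = sqrt (F * G)"
  have S: "S > 0" "S\<^sup>2 = F * G" using F G by (auto simp: S_def)
  have "(\<integral>\<^sup>+x. ennreal (1 / F) * f x \<partial>lborel) + (\<integral>\<^sup>+x. ennreal (1 / G) * g x \<partial>lborel)
      \<le> 2 * (\<integral>\<^sup>+x. ennreal (1 / S) * h x \<partial>lborel)"
  proof (rule prekopa_leindler_normalized[where k = k])
    show "(SUP x. ennreal (1 / F) * f x) = 1" "(SUP x. ennreal (1 / G) * g x) = 1"
      using F G by (simp_all add: SUP_mult_left_ennreal[symmetric] ennreal_mult[symmetric])
    fix x y
    have "ennreal (1 / F) * f x * (ennreal (1 / G) * g y) = ennreal (1 / F * (1 / G)) * (f x * g y)"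
      using F G by (subst ennreal_mult) (auto simp: ac_simps)
    also have "1 / F * (1 / G) = 1 / S * (1 / S)"
      using S F G by (simp add: power2_eq_square)
    also have "ennreal (1 / S * (1 / S)) * (f x * g y) \<le> ennreal (1 / S * (1 / S)) * (h ((x + y) / 2))\<^sup>2"
      by (intro mult_left_mono h) auto
    also have "\<dots> = (ennreal (1 / S) * h ((x + y) / 2))\<^sup>2"
      using S by (subst ennreal_mult) (auto simp: power2_eq_square ac_simps)
    finally show "ennreal (1 / F) * f x * (ennreal (1 / G) * g y) \<le> (ennreal (1 / S) * h ((x + y) / 2))\<^sup>2" .
  qed (use supp in auto)
  then have "(\<integral>\<^sup>+x. ennreal (1 / F) * f x \<partial>lborel) * (\<integral>\<^sup>+x. ennreal (1 / G) * g x \<partial>lborel)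
      \<le> (\<integral>\<^sup>+x. ennreal (1 / S) * h x \<partial>lborel)\<^sup>2"
    by (rule ennreal_am_gm_power2)
  then have *: "ennreal (1 / F) * (\<integral>\<^sup>+x. f x \<partial>lborel) * (ennreal (1 / G) * (\<integral>\<^sup>+x. g x \<partial>lborel))
      \<le> (ennreal (1 / S) * (\<integral>\<^sup>+x. h x \<partial>lborel))\<^sup>2"
    by (simp add: nn_integral_cmult)
  have "(\<integral>\<^sup>+x. f x \<partial>lborel) * (\<integral>\<^sup>+x. g x \<partial>lborel) =
    ennreal (F * G) * (ennreal (1 / F) * (\<integral>\<^sup>+x. f x \<partial>lborel) * (ennreal (1 / G) * (\<integral>\<^sup>+x. g x \<partial>lborel)))"
  proof -
    have "ennreal (F * G) * (ennreal (1 / F) * a * (ennreal (1 / G) * b)) = ennreal (F * G * (1 / F) * (1 / G)) * (a * b)" for a b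
      using F G by (simp only: ennreal_mult' mult_nonneg_nonneg less_imp_le zero_le_divide_1_iff ac_simps)
    then show ?thesis using F G by simp
  qed
  also have "\<dots> \<le> ennreal (F * G) * (ennreal (1 / S) * (\<integral>\<^sup>+x. h x \<partial>lborel))\<^sup>2"
    by (rule mult_left_mono[OF *]) simp
  also have "\<dots> = (\<integral>\<^sup>+x. h x \<partial>lborel)\<^sup>2"
  proof -
    let ?c = "ennreal (1 / S)" and ?a = "\<integral>\<^sup>+x. h x \<partial>lborel"
    have "ennreal S * ?c = 1" using \<open>S > 0\<close> by (simp add: ennreal_mult[symmetric])
    moreover have "ennreal (F * G) = ennreal S * ennreal S"
      using S by (simp add: power2_eq_square ennreal_mult[symmetric])
    moreover have "ennreal S * ennreal S * (?c * ?a)\<^sup>2 = (ennreal S * ?c) * (ennreal S * ?c) * ?a\<^sup>2"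
      by (simp only: power2_eq_square ac_simps)
    ultimately show ?thesis by simp
  qed
  finally show ?thesis .
qed

lemma prekopa_leindler_real:
  fixes f g h :: "real \<Rightarrow> ennreal"
  assumes [measurable]: "f \<in> borel_measurable borel" "g \<in> borel_measurable borel" "h \<in> borel_measurable borel"
    and h: "\<And>x y. f x * g y \<le> (h ((x + y) / 2))\<^sup>2"
  shows "(\<integral>\<^sup>+x. f x \<partial>lborel) * (\<integral>\<^sup>+x. g x \<partial>lborel) \<le> (\<integral>\<^sup>+x. h x \<partial>lborel)\<^sup>2"
proof -
  \<comment> \<open>Truncation in height and in support produces the bounded case and increases to
    \<open>u\<close>.\<close>
  define T where "T u k x = min (u x) (ennreal (real k)) * indicator {- real k..real k} x"
    for u :: "real \<Rightarrow> ennreal" and k x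
  have [measurable]: "T u k \<in> borel_measurable borel" if [measurable]: "u \<in> borel_measurable borel" for u k
    unfolding T_def by measurable
  have inc: "incseq (T u)" for u
    unfolding T_def
    by (auto simp: incseq_def le_fun_def indicator_def min_def ennreal_leI intro: order.trans)
  have sup: "(SUP k. T u k x) = u x" for u x
  proof (rule antisym)
    show "(SUP k. T u k x) \<le> u x" by (rule SUP_least) (auto simp: T_def indicator_def)
    show "u x \<le> (SUP k. T u k x)"
    proof (rule dense_le)
      fix y assume y: "y < u x"
      then obtain r where r: "y = ennreal r" "r \<ge> 0" by (cases y) auto
      obtain k :: nat where k: "max r \<bar>x\<bar> \<le> real k" using real_arch_simple by blast
      have "y \<le> T u k x" using k y r by (auto simp: T_def indicator_def min_def ennreal_leI)
      then show "y \<le> (SUP k. T u k x)" by (meson SUP_upper UNIV_I order.trans)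
    qed
  qed
  have lim: "(\<integral>\<^sup>+x. u x \<partial>lborel) = (SUP k. (\<integral>\<^sup>+x. T u k x \<partial>lborel))"
    if [measurable]: "u \<in> borel_measurable borel" for u
    by (subst nn_integral_monotone_convergence_SUP[symmetric]) (auto simp: sup inc)
  have mono: "(\<integral>\<^sup>+x. T u k x \<partial>lborel) \<le> (\<integral>\<^sup>+x. T u l x \<partial>lborel)" if "k \<le> l" for u k l
    using inc[of u] that by (intro nn_integral_mono) (auto simp: incseq_def le_fun_def)
  have diag: "(\<integral>\<^sup>+x. T f k x \<partial>lborel) * (\<integral>\<^sup>+x. T g k x \<partial>lborel) \<le> (\<integral>\<^sup>+x. h x \<partial>lborel)\<^sup>2" for k
  proof (rule prekopa_leindler_bounded[where k = "real k"])
    have le: "T u k x \<le> u x" for u x by (auto simp: T_def indicator_def)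
    fix x y
    have "T f k x * T g k y \<le> f x * g y" by (intro mult_mono le) auto
    also note h
    finally show "T f k x * T g k y \<le> (h ((x + y) / 2))\<^sup>2" .
  qed (auto simp: T_def indicator_def)
  \<comment> \<open>The product of two suprema carries two independent indices; monotonicity reduces
    it to the diagonal bound.\<close>
  have "(\<integral>\<^sup>+x. T f k x \<partial>lborel) * (\<integral>\<^sup>+x. T g l x \<partial>lborel) \<le> (\<integral>\<^sup>+x. h x \<partial>lborel)\<^sup>2" for k l
    by (rule order.trans[OF mult_mono[OF mono[of k "max k l"] mono[of l "max k l"]] diag]) auto
  then show ?thesis
    unfolding lim[OF assms(1)] lim[OF assms(2)] SUP_mult_right_ennreal
    unfolding SUP_mult_left_ennreal by (intro SUP_least)
qed

text \<open>Induction on the coordinates: the integrals over the other coordinates, as functions of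
  coordinate \<open>i\<close>, satisfy the one-dimensional hypothesis, by the induction hypothesis
  for the slices at \<open>s\<close>, \<open>t\<close> and \<open>(s + t) / 2\<close>.\<close>

lemma prekopa_leindler:
  assumes "finite I"
    and "f \<in> borel_measurable (\<Pi>\<^sub>M i\<in>I. lborel :: real measure)"
    and "g \<in> borel_measurable (\<Pi>\<^sub>M i\<in>I. lborel)"
    and "h \<in> borel_measurable (\<Pi>\<^sub>M i\<in>I. lborel)"
    and "\<And>x y. x \<in> (I \<rightarrow>\<^sub>E UNIV) \<Longrightarrow> y \<in> (I \<rightarrow>\<^sub>E UNIV) \<Longrightarrow>
            f x * g y \<le> (h (\<lambda>i\<in>I. (x i + y i) / 2))\<^sup>2"
  shows "(\<integral>\<^sup>+x. f x \<partial>(\<Pi>\<^sub>M i\<in>I. lborel)) * (\<integral>\<^sup>+x. g x \<partial>(\<Pi>\<^sub>M i\<in>I. lborel))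
      \<le> (\<integral>\<^sup>+x. h x \<partial>(\<Pi>\<^sub>M i\<in>I. lborel))\<^sup>2"
  using assms
proof (induction I arbitrary: f g h rule: finite_induct)
  case empty
  interpret product_sigma_finite "\<lambda>_. lborel :: real measure" ..
  have "(\<lambda>i\<in>{}. ((undefined :: real) + undefined) / 2) = (\<lambda>_. undefined)" by auto
  then show ?case
    using empty.prems(4)[of "\<lambda>_. undefined" "\<lambda>_. undefined"]
    by (simp add: nn_integral_empty restrict_def)
next
  case (insert i I)
  interpret product_sigma_finite "\<lambda>_. lborel :: real measure" ..
  note [measurable] = insert.prems(1-3)
  have sf: "sigma_finite_measure (\<Pi>\<^sub>M i\<in>I. lborel :: real measure)"
    using insert.hyps by (intro sigma_finite)
  interpret I: sigma_finite_measure "\<Pi>\<^sub>M i\<in>I. lborel :: real measure" by (rule sf)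
  have upd: "x(i := s) \<in> insert i I \<rightarrow>\<^sub>E UNIV" if "x \<in> I \<rightarrow>\<^sub>E UNIV" for x :: "'a \<Rightarrow> real" and s
    using that by (auto simp: PiE_def extensional_def)
  show ?case
    unfolding product_nn_integral_insert_rev[OF insert.hyps insert.prems(1)]
      product_nn_integral_insert_rev[OF insert.hyps insert.prems(2)]
      product_nn_integral_insert_rev[OF insert.hyps insert.prems(3)]
  proof (rule prekopa_leindler_real)
    fix s t
    show "(\<integral>\<^sup>+x. f (x(i := s)) \<partial>(\<Pi>\<^sub>M i\<in>I. lborel)) * (\<integral>\<^sup>+x. g (x(i := t)) \<partial>(\<Pi>\<^sub>M i\<in>I. lborel))
       \<le> (\<integral>\<^sup>+x. h (x(i := (s + t) / 2)) \<partial>(\<Pi>\<^sub>M i\<in>I. lborel))\<^sup>2"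
    proof (rule insert.IH)
      fix x y :: "'a \<Rightarrow> real" assume xy: "x \<in> I \<rightarrow>\<^sub>E UNIV" "y \<in> I \<rightarrow>\<^sub>E UNIV"
      have "f (x(i := s)) * g (y(i := t)) \<le>
         (h (\<lambda>j\<in>insert i I. ((x(i := s)) j + (y(i := t)) j) / 2))\<^sup>2"
        by (intro insert.prems upd xy)
      also have "(\<lambda>j\<in>insert i I. ((x(i := s)) j + (y(i := t)) j) / 2) =
          (\<lambda>j\<in>I. (x j + y j) / 2)(i := (s + t) / 2)"
        using insert.hyps by (auto simp: fun_eq_iff)
      finally show "f (x(i := s)) * g (y(i := t)) \<le> (h ((\<lambda>j\<in>I. (x j + y j) / 2)(i := (s + t) / 2)))\<^sup>2" .
    qed measurable
  qed measurable
qed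

section \<open>Lebesgue measure on \<open>n\<close>-space\<close>

interpretation lborel_prod: product_sigma_finite "\<lambda>_. lborel :: real measure" ..

lemma sigma_finite_Rn_leb: "sigma_finite_measure (Rn_leb n)"
  by (rule lborel_prod.sigma_finite) simp

lemma measurable_coord [measurable]: "i < n \<Longrightarrow> (\<lambda>x. x i) \<in> borel_measurable (Rn_leb n)"
  using measurable_component_singleton[of i "{..<n}" "\<lambda>_. lborel :: real measure"] by simp

lemma measurable_dot [measurable]:
  assumes [measurable]: "\<And>i. i < n \<Longrightarrow> (\<lambda>x. f x i) \<in> borel_measurable M" "\<And>i. i < n \<Longrightarrow> (\<lambda>x. g x i) \<in> borel_measurable M"
  shows "(\<lambda>x. dot n (f x) (g x)) \<in> borel_measurable M"
  unfolding dot_def by (intro borel_measurable_sum borel_measurable_times) (auto simp: assms)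

lemma measurable_into_Rn_leb:
  assumes "\<And>i. i < n \<Longrightarrow> (\<lambda>x. f x i) \<in> borel_measurable M"
  shows "(\<lambda>x. \<lambda>i\<in>{..<n}. f x i) \<in> measurable M (Rn_leb n)"
  using assms by (intro measurable_restrict) auto

section \<open>Translations and additive maps of n-space\<close>

definition vplus :: "nat \<Rightarrow> (nat \<Rightarrow> real) \<Rightarrow> (nat \<Rightarrow> real) \<Rightarrow> nat \<Rightarrow> real" where
  "vplus n x y = (\<lambda>i\<in>{..<n}. x i + y i)"

definition vminus :: "nat \<Rightarrow> (nat \<Rightarrow> real) \<Rightarrow> (nat \<Rightarrow> real) \<Rightarrow> nat \<Rightarrow> real" where
  "vminus n x y = (\<lambda>i\<in>{..<n}. x i - y i)"

lemma vplus_vminus_in_Rn [simp]: "vplus n x y \<in> Rn n" "vminus n x y \<in> Rn n"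
  by (auto simp: vplus_def vminus_def)

lemma measurable_vplus [measurable]:
  assumes [measurable]: "f \<in> measurable M (Rn_leb n)" "g \<in> measurable M (Rn_leb n)"
  shows "(\<lambda>x. vplus n (f x) (g x)) \<in> measurable M (Rn_leb n)"
  unfolding vplus_def by (rule measurable_into_Rn_leb) (auto intro!: borel_measurable_add measurable_compose[OF assms(1)] measurable_compose[OF assms(2)])

lemma measurable_vminus [measurable]:
  assumes [measurable]: "f \<in> measurable M (Rn_leb n)" "g \<in> measurable M (Rn_leb n)"
  shows "(\<lambda>x. vminus n (f x) (g x)) \<in> measurable M (Rn_leb n)"
  unfolding vminus_def by (rule measurable_into_Rn_leb) (auto intro!: borel_measurable_diff measurable_compose[OF assms(1)] measurable_compose[OF assms(2)])

lemma distr_vplus_Rn_leb: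
  assumes a: "a \<in> Rn n"
  shows "distr (Rn_leb n) (Rn_leb n) (\<lambda>x. vplus n x a) = Rn_leb n"
proof (rule lborel_prod.PiM_eqI)
  fix A :: "nat \<Rightarrow> real set" assume A: "\<And>i. i \<in> {..<n} \<Longrightarrow> A i \<in> sets lborel"
  have [measurable]: "(\<lambda>x. vplus n x a) \<in> measurable (Rn_leb n) (Rn_leb n)"
    using a by (intro measurable_vplus measurable_const) (auto simp: space_PiM)
  have eq: "(\<lambda>x. vplus n x a) -` Pi\<^sub>E {..<n} A \<inter> space (Rn_leb n) = (\<Pi>\<^sub>E i\<in>{..<n}. (\<lambda>x. x + a i) -` A i)"
    by (auto simp: space_PiM vplus_def PiE_iff)
  have "emeasure lborel ((\<lambda>x. x + a i) -` A i) = emeasure lborel (A i)" if "i < n" for i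
  proof -
    have "emeasure lborel (A i) = emeasure (distr lborel borel ((+) (a i))) (A i)"
      by (simp add: lborel_distr_plus)
    also have "\<dots> = emeasure lborel ((\<lambda>x. x + a i) -` A i)"
      using A that by (subst emeasure_distr) (auto simp: add.commute vimage_def)
    finally show ?thesis ..
  qed
  moreover have "(\<lambda>x. x + a i) -` A i \<in> sets lborel" if "i < n" for i
    using measurable_sets[of "\<lambda>x. x + a i" borel borel "A i"] A that by auto
  ultimately show "emeasure (distr (Rn_leb n) (Rn_leb n) (\<lambda>x. vplus n x a)) (Pi\<^sub>E {..<n} A) = (\<Prod>i\<in>{..<n}. emeasure lborel (A i))"
    using A by (simp add: emeasure_distr eq sets_PiM_I_finite)
      (subst lborel_prod.emeasure_PiM; simp)
qed auto

lemma nn_integral_vplus: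
  assumes "f \<in> borel_measurable (Rn_leb n)" "a \<in> Rn n"
  shows "(\<integral>\<^sup>+x. f (vplus n x a) \<partial>Rn_leb n) = (\<integral>\<^sup>+x. f x \<partial>Rn_leb n)"
proof -
  have "(\<integral>\<^sup>+x. f x \<partial>Rn_leb n) = (\<integral>\<^sup>+x. f x \<partial>distr (Rn_leb n) (Rn_leb n) (\<lambda>x. vplus n x a))"
    by (simp add: distr_vplus_Rn_leb assms)
  also have "\<dots> = (\<integral>\<^sup>+x. f (vplus n x a) \<partial>Rn_leb n)"
    using assms by (intro nn_integral_distr measurable_vplus measurable_const) (auto simp: space_PiM)
  finally show ?thesis ..
qed

text \<open>
  The uniqueness argument for Haar measure: integrating \<open>1\<^sub>A(x + U y) 1\<^sub>B(U y)\<close> in both orders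
  compares the measure of \<open>A\<close> with that of its preimage, up to the same factor for every \<open>A\<close>; a
  symmetric set \<open>B\<close> preserved by \<open>U\<close> shows that the factor is \<open>1\<close>.
\<close>

lemma emeasure_additive_vimage:
  assumes U[measurable]: "U \<in> measurable (Rn_leb n) (Rn_leb n)"
    and add: "\<And>x y. x \<in> Rn n \<Longrightarrow> y \<in> Rn n \<Longrightarrow> U (vplus n x y) = vplus n (U x) (U y)"
    and surj: "\<And>z. z \<in> Rn n \<Longrightarrow> V z \<in> Rn n \<and> U (V z) = z"
    and B[measurable]: "B \<in> sets (Rn_leb n)"
    and sym: "\<And>x y. x \<in> Rn n \<Longrightarrow> y \<in> Rn n \<Longrightarrow> vminus n x y \<in> B \<longleftrightarrow> vminus n y x \<in> B"
    and pres: "U -` B \<inter> Rn n = B"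
    and pos: "0 < emeasure (Rn_leb n) B" "emeasure (Rn_leb n) B < \<infinity>"
    and A[measurable]: "A \<in> sets (Rn_leb n)"
  shows "emeasure (Rn_leb n) (U -` A \<inter> Rn n) = emeasure (Rn_leb n) A"
proof -
  let ?M = "Rn_leb n"
  interpret sigma_finite_measure ?M by (rule sigma_finite_Rn_leb)
  interpret pair_sigma_finite ?M ?M ..
  have URn: "U x \<in> Rn n" if "x \<in> Rn n" for x
    using measurable_space[OF U, of x] that by (simp add: space_PiM)
  \<comment> \<open>First order of integration: for fixed \<open>y\<close> the translation by
    \<open>U y\<close> does not change the measure of \<open>A\<close>, and \<open>U\<close>
    preserves \<open>B\<close>, so the value is |A| |B|.\<close>
  have "(\<integral>\<^sup>+y. (\<integral>\<^sup>+x. indicator A (vplus n x (U y)) * indicator B (U y) \<partial>?M) \<partial>?M)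
      = (\<integral>\<^sup>+y. emeasure ?M A * indicator (U -` B \<inter> Rn n) y \<partial>?M)"
  proof (rule nn_integral_cong)
    fix y assume y: "y \<in> space ?M"
    have [measurable]: "(\<lambda>x. vplus n x (U y)) \<in> measurable ?M ?M"
      using y URn by (intro measurable_vplus measurable_const) (auto simp: space_PiM)
    have "(\<integral>\<^sup>+x. indicator A (vplus n x (U y)) * indicator B (U y) \<partial>?M) =
       (\<integral>\<^sup>+x. indicator A (vplus n x (U y)) \<partial>?M) * indicator B (U y)"
      by (rule nn_integral_multc) measurable
    also have "(\<integral>\<^sup>+x. indicator A (vplus n x (U y)) \<partial>?M) = emeasure ?M A"
      using y URn by (subst nn_integral_vplus) (auto simp: space_PiM)
    finally show "(\<integral>\<^sup>+x. indicator A (vplus n x (U y)) * indicator B (U y) \<partial>?M)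
        = emeasure ?M A * indicator (U -` B \<inter> Rn n) y"
      using y by (simp add: indicator_def space_PiM)
  qed
  also have "\<dots> = emeasure ?M A * emeasure ?M B"
    by (simp add: pres nn_integral_cmult)
  finally have 1: "(\<integral>\<^sup>+y. (\<integral>\<^sup>+x. indicator A (vplus n x (U y)) * indicator B (U y) \<partial>?M) \<partial>?M) = \<dots>" .
  have "(\<integral>\<^sup>+y. (\<integral>\<^sup>+x. indicator A (vplus n x (U y)) * indicator B (U y) \<partial>?M) \<partial>?M) =
     (\<integral>\<^sup>+x. (\<integral>\<^sup>+y. indicator A (vplus n x (U y)) * indicator B (U y) \<partial>?M) \<partial>?M)"
    by (rule Fubini'[symmetric]) measurable
  also have "\<dots> = (\<integral>\<^sup>+x. (\<integral>\<^sup>+y. indicator A (U y) * indicator B (vminus n (U y) x) \<partial>?M) \<partial>?M)"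
  proof (rule nn_integral_cong)
    fix x assume "x \<in> space ?M"
    then have x: "x \<in> Rn n" by (simp add: space_PiM)
    \<comment> \<open>Since \<open>U b\<close> is -x, translating \<open>y\<close> by
      \<open>b\<close> moves the shift by \<open>x\<close> from the argument of \<open>A\<close> to
      that of \<open>B\<close>.\<close>
    define b where "b = V (vminus n (\<lambda>i\<in>{..<n}. 0) x)"
    have b: "b \<in> Rn n" "U b = vminus n (\<lambda>i\<in>{..<n}. 0) x" using surj by (auto simp: b_def)
    have *: "(\<lambda>y. vplus n x (U y)) \<in> measurable ?M ?M"
      using x U by (intro measurable_vplus measurable_const) (auto simp: space_PiM)
    have "(\<integral>\<^sup>+y. indicator A (vplus n x (U y)) * indicator B (U y) \<partial>?M) =
       (\<integral>\<^sup>+y. indicator A (vplus n x (U (vplus n y b))) * indicator B (U (vplus n y b)) \<partial>?M)"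
    proof (rule nn_integral_vplus[of "\<lambda>y. indicator A (vplus n x (U y)) * indicator B (U y)", symmetric, OF _ b(1)])
      have "(\<lambda>y. indicator A (vplus n x (U y)) :: ennreal) \<in> borel_measurable ?M"
        by (rule measurable_compose[OF * borel_measurable_indicator[OF A]])
      moreover have "(\<lambda>y. indicator B (U y) :: ennreal) \<in> borel_measurable ?M"
        by (rule measurable_compose[OF U borel_measurable_indicator[OF B]])
      ultimately show "(\<lambda>y. indicator A (vplus n x (U y)) * indicator B (U y) :: ennreal) \<in> borel_measurable ?M"
        by (rule borel_measurable_times_ennreal)
    qed
    also have "\<dots> = (\<integral>\<^sup>+y. indicator A (U y) * indicator B (vminus n (U y) x) \<partial>?M)"
    proof (rule nn_integral_cong)
      fix y assume "y \<in> space ?M"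
      then have y: "y \<in> Rn n" by (simp add: space_PiM)
      have 1: "U (vplus n y b) = vminus n (U y) x"
        unfolding add[OF y b(1)] b(2) by (auto simp: vplus_def vminus_def)
      have 2: "vplus n x (vminus n (U y) x) = U y"
        using PiE_arb[OF URn[OF y]] by (simp add: vplus_def vminus_def fun_eq_iff)
      show "indicator A (vplus n x (U (vplus n y b))) * indicator B (U (vplus n y b)) =
         (indicator A (U y) * indicator B (vminus n (U y) x) :: ennreal)" by (simp add: 1 2)
    qed
    finally show "(\<integral>\<^sup>+y. indicator A (vplus n x (U y)) * indicator B (U y) \<partial>?M) = \<dots>" .
  qed
  also have "\<dots> = (\<integral>\<^sup>+y. (\<integral>\<^sup>+x. indicator A (U y) * indicator B (vminus n (U y) x) \<partial>?M) \<partial>?M)"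
    by (rule Fubini'[symmetric]) measurable
  also have "\<dots> = (\<integral>\<^sup>+y. indicator (U -` A \<inter> Rn n) y * emeasure ?M B \<partial>?M)"
  proof (rule nn_integral_cong)
    fix y assume "y \<in> space ?M"
    then have y: "y \<in> Rn n" by (simp add: space_PiM)
    \<comment> \<open>By symmetry of \<open>B\<close>, \<open>U y - x\<close> may be replaced by
      \<open>x - U y\<close>, which is a translate of the integration variable.\<close>
    define c where "c = vminus n (\<lambda>i\<in>{..<n}. 0) (U y)"
    have "(\<integral>\<^sup>+x. indicator A (U y) * indicator B (vminus n (U y) x) \<partial>?M) =
      (\<integral>\<^sup>+x. indicator A (U y) * indicator B (vplus n x c) \<partial>?M)"
    proof (rule nn_integral_cong)
      fix x assume "x \<in> space ?M"
      then have x: "x \<in> Rn n" by (simp add: space_PiM)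
      have "vminus n x (U y) = vplus n x c" by (auto simp: c_def vplus_def vminus_def)
      then show "indicator A (U y) * indicator B (vminus n (U y) x) =
          (indicator A (U y) * indicator B (vplus n x c) :: ennreal)"
        using sym[OF URn[OF y] x] by (simp add: indicator_def)
    qed
    also have "\<dots> = (\<integral>\<^sup>+x. indicator A (U y) * indicator B x \<partial>?M)"
      by (rule nn_integral_vplus[of "\<lambda>x. indicator A (U y) * indicator B x"]) (auto simp: c_def)
    also have "\<dots> = indicator A (U y) * emeasure ?M B" by (simp add: nn_integral_cmult)
    finally show "(\<integral>\<^sup>+x. indicator A (U y) * indicator B (vminus n (U y) x) \<partial>?M) =
       indicator (U -` A \<inter> Rn n) y * emeasure ?M B" using y by (simp add: indicator_def)
  qed
  also have "\<dots> = emeasure ?M (U -` A \<inter> Rn n) * emeasure ?M B"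
    using measurable_sets[OF U A] by (subst nn_integral_multc) (auto simp: space_PiM)
  finally have "emeasure ?M (U -` A \<inter> Rn n) * emeasure ?M B = emeasure ?M A * emeasure ?M B"
    using 1 by simp
  then show ?thesis
    using pos by (auto simp: mult.commute[of _ "emeasure ?M B"] ennreal_mult_cancel_left)
qed

subsection \<open>Orthonormal coordinates\<close>

definition coords :: "nat \<Rightarrow> (nat \<Rightarrow> nat \<Rightarrow> real) \<Rightarrow> (nat \<Rightarrow> real) \<Rightarrow> nat \<Rightarrow> real" where
  "coords n u x = (\<lambda>j\<in>{..<n}. dot n x (u j))"

definition comb :: "nat \<Rightarrow> (nat \<Rightarrow> nat \<Rightarrow> real) \<Rightarrow> (nat \<Rightarrow> real) \<Rightarrow> nat \<Rightarrow> real" where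
  "comb n u z = (\<lambda>i\<in>{..<n}. \<Sum>j<n. z j * u j i)"

lemma coords_comb_in_Rn [simp]: "coords n u x \<in> Rn n" "comb n u z \<in> Rn n"
  by (auto simp: coords_def comb_def)

lemma measurable_coords_comb [measurable]:
  "coords n u \<in> measurable (Rn_leb n) (Rn_leb n)" "comb n u \<in> measurable (Rn_leb n) (Rn_leb n)"
  unfolding coords_def comb_def by (intro measurable_into_Rn_leb; measurable)+

lemma dot_comb: "dot n (comb n u z) y = (\<Sum>j<n. z j * dot n y (u j))"
proof -
  have "dot n (comb n u z) y = (\<Sum>i<n. \<Sum>j<n. z j * (y i * u j i))"
    by (simp add: dot_def comb_def sum_distrib_left sum_distrib_right ac_simps)
  also have "\<dots> = (\<Sum>j<n. \<Sum>i<n. z j * (y i * u j i))" by (rule sum.swap)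
  finally show ?thesis by (simp add: dot_def sum_distrib_left)
qed

lemma coords_comb:
  assumes "orthonormal_basis n u" "z \<in> Rn n" shows "coords n u (comb n u z) = z"
proof
  fix k
  show "coords n u (comb n u z) k = z k"
  proof (cases "k < n")
    case True
    then have "coords n u (comb n u z) k = (\<Sum>j<n. z j * dot n (u k) (u j))"
      by (simp add: coords_def dot_comb)
    also have "\<dots> = (\<Sum>j<n. if j = k then z j else 0)"
      using assms(1) True by (intro sum.cong) (auto simp: orthonormal_basis_def)
    finally show ?thesis using True by simp
  next
    case False then show ?thesis using assms(2) by (auto simp: coords_def PiE_iff extensional_def)
  qed
qed

text \<open>
  Bessel's inequality for the \<open>i\<close>-th unit vector says that \<open>\<Sum>\<^sub>j (u\<^sub>j)\<^sub>i\<^sup>2 \<le> 1\<close>, and these \<open>n\<close>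
  sums add up to \<open>n\<close>; so every one of them is an equality.
\<close>

lemma orthonormal_basis_dual:
  assumes u: "orthonormal_basis n u" and "i < n" "k < n"
  shows "(\<Sum>j<n. u j i * u j k) = (if i = k then 1 else 0)"
proof -
  define s where "s i k = (\<Sum>j<n. u j i * u j k)" for i k
  \<comment> \<open>The matrix \<open>s\<close> represents the orthogonal projection onto the span
    of the \<open>u j\<close>; this is the diagonal of s s = s, with \<open>s\<close>
    symmetric.\<close>
  have idem: "(\<Sum>k<n. s i k * s i k) = s i i" if "i < n" for i
  proof -
    have "(\<Sum>k<n. s i k * s i k) = (\<Sum>k<n. \<Sum>j<n. \<Sum>l<n. (u j i * u l i) * (u j k * u l k))"
      by (simp add: s_def sum_product ac_simps)
    also have "\<dots> = (\<Sum>j<n. \<Sum>k<n. \<Sum>l<n. (u j i * u l i) * (u j k * u l k))" by (rule sum.swap)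
    also have "\<dots> = (\<Sum>j<n. \<Sum>l<n. \<Sum>k<n. (u j i * u l i) * (u j k * u l k))"
      by (intro sum.cong refl sum.swap)
    also have "\<dots> = (\<Sum>j<n. \<Sum>l<n. (u j i * u l i) * dot n (u j) (u l))"
      by (simp add: dot_def sum_distrib_left)
    also have "\<dots> = (\<Sum>j<n. \<Sum>l<n. if l = j then u j i * u l i else 0)"
      using u by (intro sum.cong refl) (auto simp: orthonormal_basis_def)
    also have "\<dots> = s i i" by (simp add: s_def)
    finally show ?thesis .
  qed
  \<comment> \<open>The squared distance of the \<open>i\<close>-th unit vector from its projection:
    nonnegativity is Bessel's inequality, vanishing makes row \<open>i\<close> of \<open>s\<close>
    that of the identity.\<close>
  have dist: "(\<Sum>k<n. ((if k = i then 1 else 0) - s i k)\<^sup>2) = 1 - s i i" if "i < n" for i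
  proof -
    have "(\<Sum>k<n. ((if k = i then 1 else 0) - s i k)\<^sup>2) =
       (\<Sum>k<n. (if k = i then 1 else 0) - 2 * (if k = i then s i k else 0) + s i k * s i k)"
      by (intro sum.cong refl) (auto simp: power2_eq_square algebra_simps)
    also have "\<dots> = 1 - 2 * s i i + s i i"
      using that by (simp add: sum.distrib sum_subtractf idem flip: sum_distrib_left)
    finally show ?thesis by simp
  qed
  have "(\<Sum>i<n. s i i) = (\<Sum>j<n. \<Sum>i<n. u j i * u j i)"
    unfolding s_def by (rule sum.swap)
  also have "\<dots> = (\<Sum>j<n. 1)"
    using u by (intro sum.cong refl) (auto simp: orthonormal_basis_def dot_def)
  finally have "(\<Sum>i<n. 1 - s i i) = 0" by (simp add: sum_subtractf)
  moreover have "0 \<le> 1 - s i i" if "i < n" for i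
    unfolding dist[OF that, symmetric] by (intro sum_nonneg) auto
  ultimately have "1 - s i i = 0" if "i < n" for i
    using that sum_nonneg_eq_0_iff[of "{..<n}" "\<lambda>i. 1 - s i i"] by auto
  then have "(\<Sum>k<n. ((if k = i then 1 else 0) - s i k)\<^sup>2) = 0"
    using dist \<open>i < n\<close> by simp
  then have "(if k = i then 1 else 0) - s i k = 0"
    using \<open>k < n\<close> by (subst (asm) sum_nonneg_eq_0_iff) auto
  then show ?thesis by (auto simp: s_def)
qed

lemma dot_coords:
  assumes u: "orthonormal_basis n u"
  shows "dot n (coords n u x) (coords n u y) = dot n x y"
proof -
  have "dot n (coords n u x) (coords n u y) = (\<Sum>j<n. \<Sum>i<n. \<Sum>k<n. (x i * y k) * (u j i * u j k))"
    by (simp add: dot_def coords_def sum_product ac_simps)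
  also have "\<dots> = (\<Sum>i<n. \<Sum>j<n. \<Sum>k<n. (x i * y k) * (u j i * u j k))" by (rule sum.swap)
  also have "\<dots> = (\<Sum>i<n. \<Sum>k<n. \<Sum>j<n. (x i * y k) * (u j i * u j k))"
    by (intro sum.cong refl sum.swap)
  also have "\<dots> = (\<Sum>i<n. \<Sum>k<n. (x i * y k) * (if i = k then 1 else 0))"
    by (intro sum.cong refl) (simp add: orthonormal_basis_dual[OF u] flip: sum_distrib_left)
  also have "\<dots> = dot n x y"
    by (simp add: dot_def if_distrib cong: if_cong)
  finally show ?thesis .
qed

text \<open>The composite in \<open>coords_comb\<close> rests on orthonormality alone; this one
  expresses completeness and so goes through \<open>orthonormal_basis_dual\<close>.\<close>

lemma comb_coords:
  assumes u: "orthonormal_basis n u" and x: "x \<in> Rn n"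
  shows "comb n u (coords n u x) = x"
proof
  fix i
  show "comb n u (coords n u x) i = x i"
  proof (cases "i < n")
    case True
    have "comb n u (coords n u x) i = (\<Sum>j<n. \<Sum>k<n. x k * (u j i * u j k))"
      using True by (simp add: comb_def coords_def dot_def sum_distrib_left sum_distrib_right ac_simps)
    also have "\<dots> = (\<Sum>k<n. \<Sum>j<n. x k * (u j i * u j k))" by (rule sum.swap)
    also have "\<dots> = (\<Sum>k<n. x k * (if i = k then 1 else 0))"
      using True by (intro sum.cong refl) (simp add: orthonormal_basis_dual[OF u] flip: sum_distrib_left)
    finally show ?thesis using True by (simp add: if_distrib cong: if_cong)
  next
    case False then show ?thesis using x by (auto simp: comb_def PiE_iff extensional_def)
  qed
qed

lemma coords_vplus:
  "coords n u (vplus n x y) = vplus n (coords n u x) (coords n u y)"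
  by (auto simp: coords_def vplus_def dot_def sum.distrib algebra_simps)

lemma emeasure_cube:
  assumes "0 \<le> r"
  shows "emeasure (Rn_leb n) (\<Pi>\<^sub>E i\<in>{..<n}. {-r..r}) = ennreal ((2 * r) ^ n)"
  using assms by (subst lborel_prod.emeasure_PiM) (auto simp: ennreal_power prod_constant)

text \<open>The Euclidean unit ball serves as the reference set \<open>B\<close> of
  \<open>emeasure_additive_vimage\<close>: it is symmetric, is preserved because
  \<open>coords\<close> preserves \<open>dot\<close>, and lies between two cubes.\<close>

lemma emeasure_vimage_coords:
  assumes u: "orthonormal_basis n u" and A: "A \<in> sets (Rn_leb n)"
  shows "emeasure (Rn_leb n) (coords n u -` A \<inter> Rn n) = emeasure (Rn_leb n) A"
proof -
  define B where "B = {x \<in> space (Rn_leb n). dot n x x \<le> 1}"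
  have B: "B \<in> sets (Rn_leb n)" unfolding B_def by measurable
  show ?thesis
  proof (rule emeasure_additive_vimage[where V = "comb n u" and B = B])
    show "coords n u \<in> measurable (Rn_leb n) (Rn_leb n)" by measurable
    show "coords n u (vplus n x y) = vplus n (coords n u x) (coords n u y)" for x y
      by (rule coords_vplus)
    show "comb n u z \<in> Rn n \<and> coords n u (comb n u z) = z" if "z \<in> Rn n" for z
      using coords_comb[OF u that] by simp
    show "vminus n x y \<in> B \<longleftrightarrow> vminus n y x \<in> B" for x y
    proof -
      have "dot n (vminus n x y) (vminus n x y) = dot n (vminus n y x) (vminus n y x)"
        by (simp add: dot_def vminus_def algebra_simps)
      then show ?thesis by (simp add: B_def space_PiM)
    qed
    show "coords n u -` B \<inter> Rn n = B"
      using dot_coords[OF u] by (auto simp: B_def space_PiM)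
    have small: "\<bar>x i\<bar> \<le> 1" if "dot n x x \<le> 1" "i < n" for x :: "nat \<Rightarrow> real" and i
    proof -
      have "x i * x i \<le> dot n x x" unfolding dot_def
        using that by (intro member_le_sum) auto
      then have "\<bar>x i\<bar>\<^sup>2 \<le> 1\<^sup>2" using that by (simp add: power2_eq_square)
      then show ?thesis by (rule power2_le_imp_le) simp
    qed
    have "emeasure (Rn_leb n) B \<le> emeasure (Rn_leb n) (\<Pi>\<^sub>E i\<in>{..<n}. {-1..1})"
    proof (rule emeasure_mono)
      have "-1 \<le> x i" "x i \<le> 1" if "dot n x x \<le> 1" "i < n" for x :: "nat \<Rightarrow> real" and i
        using small[OF that] by (auto simp: abs_le_iff)
      then show "B \<subseteq> (\<Pi>\<^sub>E i\<in>{..<n}. {-1..1})" by (auto simp: B_def space_PiM PiE_def)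
    qed (auto intro!: sets_PiM_I_finite)
    also have "\<dots> < \<infinity>" by (subst emeasure_cube) auto
    finally show "emeasure (Rn_leb n) B < \<infinity>" .
    \<comment> \<open>A point of this cube has squared norm at most n/(n+1); the added 1 also covers
      \<open>n = 0\<close>.\<close>
    have "0 < ennreal ((2 * (1 / (real n + 1))) ^ n)" by (simp add: add_pos_nonneg)
    also have "\<dots> = emeasure (Rn_leb n) (\<Pi>\<^sub>E i\<in>{..<n}. {-(1 / (real n + 1))..1 / (real n + 1)})"
      by (subst emeasure_cube) auto
    also have "\<dots> \<le> emeasure (Rn_leb n) B"
    proof (rule emeasure_mono)
      show "(\<Pi>\<^sub>E i\<in>{..<n}. {-(1 / (real n + 1))..1 / (real n + 1)}) \<subseteq> B"
      proof
        fix x :: "nat \<Rightarrow> real" assume x: "x \<in> (\<Pi>\<^sub>E i\<in>{..<n}. {-(1 / (real n + 1))..1 / (real n + 1)})"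
        have le: "\<bar>x i\<bar> \<le> 1 / (real n + 1)" if "i < n" for i
          using x that by (auto simp: PiE_iff abs_le_iff minus_le_iff)
        have "dot n x x \<le> (\<Sum>i<n. 1 / (real n + 1))"
          unfolding dot_def
        proof (rule sum_mono)
          fix i assume "i \<in> {..<n}"
          then have i: "\<bar>x i\<bar> \<le> 1 / (real n + 1)" using le by simp
          have "x i * x i = \<bar>x i\<bar> * \<bar>x i\<bar>" by simp
          also have "\<dots> \<le> 1 / (real n + 1) * 1" by (intro mult_mono i order.trans[OF i]) auto
          finally show "x i * x i \<le> 1 / (real n + 1)" by simp
        qed
        also have "\<dots> \<le> 1" by (simp add: field_simps)
        finally show "x \<in> B" using x by (auto simp: B_def space_PiM PiE_iff)
      qed
    qed (rule B)
    finally show "0 < emeasure (Rn_leb n) B" .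
  qed (use A B in auto)
qed

text \<open>Used with \<open>c = -1\<close> for reflections and with \<open>0 < c \<le> 1\<close>
  for contractions of one coordinate. Tonelli's theorem splits that coordinate off, leaving the
  affine substitution on the line.\<close>

lemma nn_integral_scale_coord:
  assumes "i < n" "c \<noteq> 0" and f[measurable]: "f \<in> borel_measurable (Rn_leb n)"
  shows "(\<integral>\<^sup>+x. f x \<partial>Rn_leb n) = ennreal \<bar>c\<bar> * (\<integral>\<^sup>+x. f (x(i := c * x i)) \<partial>Rn_leb n)"
proof -
  let ?J = "{..<n} - {i}"
  have J: "insert i ?J = {..<n}" "finite ?J" "i \<notin> ?J" using assms by auto
  have m: "f \<in> borel_measurable (Pi\<^sub>M (insert i ?J) (\<lambda>_. lborel))" unfolding J(1) by (rule f)
  have [measurable]: "(\<lambda>x. x(i := c * x i)) \<in> measurable (Rn_leb n) (Rn_leb n)"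
    using assms by (intro measurable_fun_upd[where J = "{..<n}"]) auto
  have m': "(\<lambda>x. f (x(i := c * x i))) \<in> borel_measurable (Pi\<^sub>M (insert i ?J) (\<lambda>_. lborel))"
    unfolding J(1) by measurable
  have m2: "(\<lambda>y. \<integral>\<^sup>+x. f (x(i := y)) \<partial>Pi\<^sub>M ?J (\<lambda>_. lborel)) \<in> borel_measurable borel"
  proof -
    interpret sigma_finite_measure "Pi\<^sub>M ?J (\<lambda>_. lborel :: real measure)" by (rule lborel_prod.sigma_finite) auto
    note m[measurable]
    show ?thesis by measurable
  qed
  have "(\<integral>\<^sup>+x. f x \<partial>Rn_leb n) = (\<integral>\<^sup>+y. (\<integral>\<^sup>+x. f (x(i := y)) \<partial>Pi\<^sub>M ?J (\<lambda>_. lborel)) \<partial>lborel)"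
    using lborel_prod.product_nn_integral_insert_rev[OF J(2,3) m] J by simp
  also have "\<dots> = ennreal \<bar>c\<bar> * (\<integral>\<^sup>+y. (\<integral>\<^sup>+x. f (x(i := 0 + c * y)) \<partial>Pi\<^sub>M ?J (\<lambda>_. lborel)) \<partial>lborel)"
    using m2 \<open>c \<noteq> 0\<close> by (rule nn_integral_real_affine)
  also have "(\<integral>\<^sup>+y. (\<integral>\<^sup>+x. f (x(i := 0 + c * y)) \<partial>Pi\<^sub>M ?J (\<lambda>_. lborel)) \<partial>lborel) =
    (\<integral>\<^sup>+x. f (x(i := c * x i)) \<partial>Rn_leb n)"
    using lborel_prod.product_nn_integral_insert_rev[OF J(2,3) m'] J by simp
  finally show ?thesis .
qed

section \<open>Unconditional bodies\<close>

lemma measurable_coord_update [measurable]: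
  assumes "i < n" and [measurable]: "g \<in> borel_measurable (Rn_leb n)"
  shows "(\<lambda>x. x(i := g x)) \<in> measurable (Rn_leb n) (Rn_leb n)"
  using assms by (intro measurable_fun_upd[where J = "{..<n}"]) auto

text \<open>The body in the coordinates of the reflecting basis. Compactness survives as
  measurability and the bound \<open>R\<close>, which secures integrability and finite error terms
  but reaches no final constant. Equality of the second moments is assumed lemma by lemma.\<close>

locale unconditional_body =
  fixes n :: nat and K :: "(nat \<Rightarrow> real) set" and R :: real
  assumes sets_K [measurable]: "K \<in> sets (Rn_leb n)"
    and convex_K: "convex_Rn n K"
    and flip_K: "\<And>x i. x \<in> K \<Longrightarrow> i < n \<Longrightarrow> x(i := - x i) \<in> K"
    and bounded_K: "\<And>x i. x \<in> K \<Longrightarrow> i < n \<Longrightarrow> \<bar>x i\<bar> \<le> R"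
    and R_ge: "1 \<le> R"
    and vol_K: "emeasure (Rn_leb n) K = 1"
begin

abbreviation "M \<equiv> Rn_leb n"

definition P :: "(nat \<Rightarrow> real) measure" where
  "P = density M (indicator K)"

lemma K_in_Rn: "x \<in> K \<Longrightarrow> x \<in> Rn n"
  using convex_K by (auto simp: convex_Rn_def)

lemma sets_P [measurable_cong, simp]: "sets P = sets M"
  by (simp add: P_def)

lemma space_P [simp]: "space P = Rn n"
  by (simp add: P_def space_PiM)

lemma measurable_P [simp]: "measurable P N = measurable M N"
  by (rule measurable_cong_sets) simp_all

lemma emeasure_P: "A \<in> sets M \<Longrightarrow> emeasure P A = emeasure M (K \<inter> A)"
  by (simp add: P_def emeasure_density indicator_inter_arith[symmetric])

lemma nn_integral_P:
  "f \<in> borel_measurable M \<Longrightarrow> (\<integral>\<^sup>+x. f x \<partial>P) = (\<integral>\<^sup>+x. indicator K x * f x \<partial>M)"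
  unfolding P_def by (subst nn_integral_density) auto

lemma emeasure_P_UNIV: "emeasure P (Rn n) = 1"
proof -
  have "Rn n \<in> sets M" using sets.top[of M] by (simp add: space_PiM)
  moreover have "K \<inter> Rn n = K" using K_in_Rn by auto
  ultimately show ?thesis using vol_K by (simp add: emeasure_P)
qed

sublocale finite_measure P
  by standard (simp add: emeasure_P_UNIV)

lemma measure_P_UNIV [simp]: "measure P (Rn n) = 1"
  by (simp add: measure_def emeasure_P_UNIV)

lemma AE_P: "AE x in P. x \<in> K"
proof -
  have "(AE x in P. x \<in> K) \<longleftrightarrow> (AE x in M. 0 < (indicator K x :: ennreal) \<longrightarrow> x \<in> K)"
    unfolding P_def by (rule AE_density) simp
  then show ?thesis by (simp add: indicator_def)
qed

lemma integrable_bounded: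
  fixes f :: "_ \<Rightarrow> real"
  assumes "f \<in> borel_measurable M" "\<And>x. x \<in> K \<Longrightarrow> \<bar>f x\<bar> \<le> B"
  shows "integrable P f"
proof (rule integrable_const_bound[where B = B])
  show "AE x in P. norm (f x) \<le> B" using AE_P by eventually_elim (auto simp: assms)
qed (use assms in simp)

lemma scale_K:
  assumes x: "x \<in> K" and "i < n" "\<bar>c\<bar> \<le> 1"
  shows "x(i := c * x i) \<in> K"
proof -
  \<comment> \<open>The weight of the reflected point: coordinate \<open>i\<close> becomes ((1 - t)
    - t) x_i = c x_i, all others stay.\<close>
  define t where "t = (1 - c) / 2"
  have t: "t \<in> {0..1}" using assms by (auto simp: t_def)
  have "(\<lambda>j\<in>{..<n}. (1 - t) * x j + t * (x(i := - x i)) j) \<in> K"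
    using convex_K x flip_K[OF x \<open>i < n\<close>] t unfolding convex_Rn_def by blast
  also have "(\<lambda>j\<in>{..<n}. (1 - t) * x j + t * (x(i := - x i)) j) = x(i := c * x i)"
    using PiE_arb[OF K_in_Rn[OF x]] \<open>i < n\<close> by (auto simp: fun_eq_iff t_def field_simps)
  finally show ?thesis .
qed

lemma midpoint_K:
  assumes "x \<in> K" "y \<in> K"
  shows "(\<lambda>i\<in>{..<n}. (x i + y i) / 2) \<in> K"
proof -
  have "(\<lambda>i\<in>{..<n}. (1 - 1/2) * x i + (1/2) * y i) \<in> K"
    using convex_K assms unfolding convex_Rn_def by (elim conjE ballE[where x = x] ballE[where x = y] ballE[where x = "1/2"]) auto
  also have "(\<lambda>i\<in>{..<n}. (1 - 1/2) * x i + (1/2) * y i) = (\<lambda>i\<in>{..<n}. (x i + y i) / 2)"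
    by (auto simp: fun_eq_iff)
  finally show ?thesis .
qed

text \<open>Coordinates are contracted one after the other by \<open>scale_K\<close>, the first
  \<open>k\<close> having already reached those of \<open>y\<close>.\<close>

lemma solid_K:
  assumes x: "x \<in> K" and y: "y \<in> Rn n" and le: "\<And>i. i < n \<Longrightarrow> \<bar>y i\<bar> \<le> \<bar>x i\<bar>"
  shows "y \<in> K"
proof -
  have "(\<lambda>i\<in>{..<n}. if i < k then y i else x i) \<in> K" if "k \<le> n" for k
    using that
  proof (induction k)
    case 0
    then show ?case using x PiE_restrict[OF K_in_Rn[OF x]] by (simp add: restrict_def)
  next
    case (Suc k)
    let ?z = "\<lambda>i\<in>{..<n}. if i < k then y i else x i"
    \<comment> \<open>If \<open>x k = 0\<close> then \<open>y k = 0\<close> by \<open>le\<close>,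
      and the value 0 of the quotient is a correct factor.\<close>
    have "?z(k := (y k / x k) * ?z k) \<in> K"
      using Suc.prems le[of k] by (intro scale_K Suc.IH) (auto simp: divide_le_eq_1)
    also have "?z(k := (y k / x k) * ?z k) = (\<lambda>i\<in>{..<n}. if i < Suc k then y i else x i)"
      using Suc.prems le[of k] by (auto simp: fun_eq_iff less_Suc_eq)
    finally show ?case .
  qed
  from this[of n] have "(\<lambda>i\<in>{..<n}. if i < n then y i else x i) \<in> K" by simp
  also have "(\<lambda>i\<in>{..<n}. if i < n then y i else x i) = y"
    using PiE_arb[OF y] by (auto simp: fun_eq_iff)
  finally show ?thesis .
qed

lemma prod_le_1_K:
  assumes x: "x \<in> K"
  shows "(\<Prod>i<n. 2 * \<bar>x i\<bar>) \<le> 1"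
proof -
  have "ennreal (\<Prod>i<n. 2 * \<bar>x i\<bar>) = (\<Prod>i<n. ennreal (2 * \<bar>x i\<bar>))"
    by (rule prod_ennreal[symmetric]) auto
  also have "\<dots> = emeasure M (\<Pi>\<^sub>E i\<in>{..<n}. {-\<bar>x i\<bar>..\<bar>x i\<bar>})"
    by (subst lborel_prod.emeasure_PiM) auto
  also have "\<dots> \<le> emeasure M K"
  proof (intro emeasure_mono subsetI)
    fix y assume "y \<in> (\<Pi>\<^sub>E i\<in>{..<n}. {-\<bar>x i\<bar>..\<bar>x i\<bar>})"
    then show "y \<in> K" by (intro solid_K[OF x]) (auto simp: PiE_iff abs_le_iff minus_le_iff)
  qed (rule sets_K)
  finally show ?thesis by (simp add: vol_K)
qed

lemma flip_K_iff:
  assumes "i < n" shows "x(i := - x i) \<in> K \<longleftrightarrow> x \<in> K"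
  using flip_K[OF _ assms, of x] flip_K[OF _ assms, of "x(i := - x i)"] by auto

lemma nn_integral_flip:
  assumes [simp]: "i < n" and [measurable]: "f \<in> borel_measurable M"
  shows "(\<integral>\<^sup>+x. f (x(i := - x i)) \<partial>P) = (\<integral>\<^sup>+x. f x \<partial>P)"
proof -
  have "(\<integral>\<^sup>+x. f x \<partial>P) = (\<integral>\<^sup>+x. indicator K x * f x \<partial>M)" by (rule nn_integral_P) simp
  also have "\<dots> = (\<integral>\<^sup>+x. indicator K (x(i := - x i)) * f (x(i := - x i)) \<partial>M)"
    using nn_integral_scale_coord[of i n "-1" "\<lambda>x. indicator K x * f x"] by simp
  also have "\<dots> = (\<integral>\<^sup>+x. indicator K x * f (x(i := - x i)) \<partial>M)"
    by (simp add: indicator_def flip_K_iff)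
  also have "\<dots> = (\<integral>\<^sup>+x. f (x(i := - x i)) \<partial>P)" by (rule nn_integral_P[symmetric]) measurable
  finally show ?thesis ..
qed

lemma integral_flip:
  fixes f :: "_ \<Rightarrow> real"
  assumes [simp]: "i < n" and [measurable]: "f \<in> borel_measurable M"
  shows "(\<integral>x. f (x(i := - x i)) \<partial>P) = (\<integral>x. f x \<partial>P)"
proof -
  have [measurable]: "(\<lambda>x. x(i := - x i)) \<in> measurable M M" by measurable
  have "distr P M (\<lambda>x. x(i := - x i)) = P"
  proof (rule measure_eqI)
    fix A assume "A \<in> sets (distr P M (\<lambda>x. x(i := - x i)))"
    then have A[measurable]: "A \<in> sets M" by simp
    have "emeasure (distr P M (\<lambda>x. x(i := - x i))) A = (\<integral>\<^sup>+x. indicator A x \<partial>distr P M (\<lambda>x. x(i := - x i)))"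
      by simp
    also have "\<dots> = (\<integral>\<^sup>+x. indicator A (x(i := - x i)) \<partial>P)"
      by (rule nn_integral_distr) auto
    also have "\<dots> = emeasure P A" by (subst nn_integral_flip) auto
    finally show "emeasure (distr P M (\<lambda>x. x(i := - x i))) A = emeasure P A" .
  qed simp
  then have "(\<integral>x. f x \<partial>P) = (\<integral>x. f x \<partial>distr P M (\<lambda>x. x(i := - x i)))" by simp
  also have "\<dots> = (\<integral>x. f (x(i := - x i)) \<partial>P)" by (rule integral_distr) auto
  finally show ?thesis ..
qed

subsection \<open>Tails of the coordinates\<close>

lemma null_hyperplane:
  assumes "i < n" shows "{x \<in> Rn n. x i = 0} \<in> null_sets M"
proof -
  have "(\<forall>j\<in>{..<n}. x j \<in> (if j = i then {0} else UNIV)) \<longleftrightarrow> x i = 0" for x :: "nat \<Rightarrow> real"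
    using assms by (metis UNIV_I lessThan_iff singleton_iff)
  then have "{x \<in> Rn n. x i = 0} = (\<Pi>\<^sub>E j\<in>{..<n}. if j = i then {0} else UNIV)"
    by (simp add: PiE_iff set_eq_iff conj_commute)
  moreover have "(\<Pi>\<^sub>E j\<in>{..<n}. if j = i then {0} else (UNIV :: real set)) \<in> sets M"
    by (rule sets_PiM_I_finite) auto
  moreover have "emeasure M (\<Pi>\<^sub>E j\<in>{..<n}. if j = i then {0} else UNIV) = 0"
    using assms by (subst lborel_prod.emeasure_PiM) (auto intro!: prod_zero)
  ultimately show ?thesis by (simp add: null_sets_def)
qed

text \<open>Bounds on absolute values do not cut out a convex set, bounds in a single orthant do;
  this passes to the convex set on which Prekopa-Leindler acts. Each coordinate contributes a factor
  2: a set and its mirror image, overlapping only in a null hyperplane.\<close>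

lemma emeasure_orthant:
  assumes "\<And>i. i < n \<Longrightarrow> 0 \<le> \<alpha> i"
  shows "emeasure M {x \<in> K. \<forall>i<n. \<alpha> i \<le> \<bar>x i\<bar>} = 2 ^ n * emeasure M {x \<in> K. \<forall>i<n. \<alpha> i \<le> x i}"
proof -
  \<comment> \<open>Coordinates below \<open>k\<close> are bounded with sign, the others still in
    absolute value.\<close>
  define A where "A k = {x \<in> K. \<forall>i<n. \<alpha> i \<le> (if i < k then x i else \<bar>x i\<bar>)}" for k
  have A_sets [measurable]: "A k \<in> sets M" for k
  proof -
    have "A k = K \<inter> {x \<in> space M. \<forall>i\<in>{..<n}. \<alpha> i \<le> (if i < k then x i else \<bar>x i\<bar>)}"
      using K_in_Rn by (auto simp: A_def space_PiM)
    also have "\<dots> \<in> sets M" by measurable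
    finally show ?thesis .
  qed
  have step: "emeasure M (A k) = 2 * emeasure M (A (Suc k))" if k: "k < n" for k
  proof -
    define B where "B = {x \<in> Rn n. x(k := - x k) \<in> A (Suc k)}"
    have B: "B \<in> sets M" "emeasure M B = emeasure M (A (Suc k))"
    proof -
      have m: "(\<lambda>x. x(k := - x k)) \<in> measurable M M" using k by measurable
      have eq: "B = (\<lambda>x. x(k := - x k)) -` A (Suc k) \<inter> space M" by (auto simp: B_def space_PiM)
      show "B \<in> sets M" unfolding eq using m by measurable
      have "emeasure M (A (Suc k)) = (\<integral>\<^sup>+x. indicator (A (Suc k)) (x(k := - x k)) \<partial>M)"
        using nn_integral_scale_coord[of k n "-1" "indicator (A (Suc k))"] k by simp
      also have "\<dots> = (\<integral>\<^sup>+x. indicator B x \<partial>M)"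
        by (intro nn_integral_cong) (auto simp: B_def indicator_def space_PiM)
      finally show "emeasure M B = emeasure M (A (Suc k))" using \<open>B \<in> sets M\<close> by simp
    qed
    have Un: "A k = A (Suc k) \<union> B"
    proof (rule set_eqI)
      fix x
      have "x \<in> A k \<longleftrightarrow> x \<in> K \<and> (\<forall>i<n. i \<noteq> k \<longrightarrow> \<alpha> i \<le> (if i < k then x i else \<bar>x i\<bar>)) \<and> \<alpha> k \<le> \<bar>x k\<bar>"
        using k by (auto simp: A_def)
      moreover have "x \<in> A (Suc k) \<longleftrightarrow> x \<in> K \<and> (\<forall>i<n. i \<noteq> k \<longrightarrow> \<alpha> i \<le> (if i < k then x i else \<bar>x i\<bar>)) \<and> \<alpha> k \<le> x k"
        using k by (auto simp: A_def less_Suc_eq)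
      moreover have "x \<in> B \<longleftrightarrow> x \<in> K \<and> (\<forall>i<n. i \<noteq> k \<longrightarrow> \<alpha> i \<le> (if i < k then x i else \<bar>x i\<bar>)) \<and> \<alpha> k \<le> - x k"
        using k K_in_Rn by (auto simp: A_def B_def flip_K_iff less_Suc_eq)
      ultimately show "x \<in> A k \<longleftrightarrow> x \<in> A (Suc k) \<union> B"
        using assms[OF k] by (auto simp: abs_real_def)
    qed
    have "A (Suc k) \<inter> B \<subseteq> {x \<in> Rn n. x k = 0}"
      using assms[OF k] k by (fastforce simp: A_def B_def dest: K_in_Rn)
    then have "A (Suc k) \<inter> B \<in> null_sets M"
      using B by (intro null_sets_subset[OF null_hyperplane[OF k]]) auto
    then have 0: "emeasure M (A (Suc k) \<inter> B) = 0" by auto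
    have "emeasure M (A k) = emeasure M (A (Suc k) \<union> B) + emeasure M (A (Suc k) \<inter> B)"
      by (simp add: Un 0)
    also have "\<dots> = emeasure M (A (Suc k)) + emeasure M B"
      using B by (intro emeasure_Un_Int[symmetric]) auto
    finally show ?thesis by (simp add: B mult_2)
  qed
  have "emeasure M (A 0) = 2 ^ k * emeasure M (A k)" if "k \<le> n" for k
    using that
  proof (induction k)
    case (Suc k)
    then show ?case using step[of k] by (simp add: ac_simps)
  qed simp
  from this[of n] show ?thesis by (simp add: A_def)
qed

definition tail :: "(nat \<Rightarrow> real) \<Rightarrow> real" where
  "tail \<alpha> = measure P {x \<in> Rn n. \<forall>i<n. \<alpha> i \<le> \<bar>x i\<bar>}"

lemma sets_tail [measurable]: "{x \<in> Rn n. \<forall>i<n. \<alpha> i \<le> \<bar>x i\<bar>} \<in> sets M"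
proof -
  have "{x \<in> space M. \<forall>i\<in>{..<n}. \<alpha> i \<le> \<bar>x i\<bar>} \<in> sets M" by measurable
  then show ?thesis by (simp add: space_PiM Ball_def)
qed

text \<open>
  The Prekopa-Leindler inequality makes \<open>\<alpha> \<mapsto> |K \<inter> {x \<ge> \<alpha>}|\<close> logarithmically concave.
\<close>

lemma tail_le_power2_half:
  assumes "\<And>i. i < n \<Longrightarrow> 0 \<le> \<alpha> i"
  shows "tail \<alpha> \<le> (tail (\<lambda>i. \<alpha> i / 2))\<^sup>2"
proof -
  define A where "A \<beta> = {x \<in> K. \<forall>i<n. \<beta> i \<le> x i}" for \<beta>
  have A_sets [measurable]: "A \<beta> \<in> sets M" for \<beta>
  proof -
    have "A \<beta> = K \<inter> {x \<in> space M. \<forall>i\<in>{..<n}. \<beta> i \<le> x i}"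
      using K_in_Rn by (auto simp: A_def space_PiM)
    also have "\<dots> \<in> sets M" by measurable
    finally show ?thesis .
  qed
  have tail_eq: "ennreal (tail \<beta>) = 2 ^ n * emeasure M (A \<beta>)" if "\<And>i. i < n \<Longrightarrow> 0 \<le> \<beta> i" for \<beta>
  proof -
    have "ennreal (tail \<beta>) = emeasure M (K \<inter> {x \<in> Rn n. \<forall>i<n. \<beta> i \<le> \<bar>x i\<bar>})"
      unfolding tail_def emeasure_eq_measure[symmetric] by (rule emeasure_P) (rule sets_tail)
    also have "K \<inter> {x \<in> Rn n. \<forall>i<n. \<beta> i \<le> \<bar>x i\<bar>} = {x \<in> K. \<forall>i<n. \<beta> i \<le> \<bar>x i\<bar>}"
      using K_in_Rn by auto
    finally show ?thesis using emeasure_orthant[of \<beta>] that by (simp add: A_def)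
  qed
  \<comment> \<open>The second point of comparison is 0, where the tail is 1: midpoints of the sets
    at \<open>\<alpha>\<close> and at 0 lie in the set at \<open>\<alpha> / 2\<close>.\<close>
  have "emeasure M (A \<alpha>) * emeasure M (A (\<lambda>_. 0)) \<le> (emeasure M (A (\<lambda>i. \<alpha> i / 2)))\<^sup>2"
  proof -
    have "(\<integral>\<^sup>+x. indicator (A \<alpha>) x \<partial>M) * (\<integral>\<^sup>+x. indicator (A (\<lambda>_. 0)) x \<partial>M)
       \<le> (\<integral>\<^sup>+x. indicator (A (\<lambda>i. \<alpha> i / 2)) x \<partial>M)\<^sup>2"
    proof (rule prekopa_leindler)
      fix x y :: "nat \<Rightarrow> real"
      have "(\<lambda>i\<in>{..<n}. (x i + y i) / 2) \<in> A (\<lambda>i. \<alpha> i / 2)" if "x \<in> A \<alpha>" "y \<in> A (\<lambda>_. 0)"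
        using that midpoint_K[of x y] by (auto simp: A_def add_increasing2 divide_right_mono)
      then show "indicator (A \<alpha>) x * indicator (A (\<lambda>_. 0)) y \<le>
         ((indicator (A (\<lambda>i. \<alpha> i / 2)) (\<lambda>i\<in>{..<n}. (x i + y i) / 2))\<^sup>2 :: ennreal)"
        by (auto simp: indicator_def)
    qed auto
    then show ?thesis by simp
  qed
  then have "(2 ^ n)\<^sup>2 * (emeasure M (A \<alpha>) * emeasure M (A (\<lambda>_. 0)))
     \<le> (2 ^ n)\<^sup>2 * (emeasure M (A (\<lambda>i. \<alpha> i / 2)))\<^sup>2"
    by (rule mult_left_mono) simp
  then have "(2 ^ n * emeasure M (A \<alpha>)) * (2 ^ n * emeasure M (A (\<lambda>_. 0)))
     \<le> (2 ^ n * emeasure M (A (\<lambda>i. \<alpha> i / 2)))\<^sup>2"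
    by (simp only: power2_eq_square ac_simps)
  then have "ennreal (tail \<alpha>) * ennreal (tail (\<lambda>_. 0)) \<le> (ennreal (tail (\<lambda>i. \<alpha> i / 2)))\<^sup>2"
    using assms by (simp add: tail_eq)
  moreover have "tail (\<lambda>_. 0) = 1" by (simp add: tail_def)
  ultimately show ?thesis
    by (simp add: tail_def ennreal_power)
qed

lemma tail_le_power_dyadic:
  assumes "\<And>i. i < n \<Longrightarrow> 0 \<le> \<alpha> i"
  shows "tail \<alpha> \<le> tail (\<lambda>i. \<alpha> i / 2 ^ k) ^ (2 ^ k)"
proof (induction k)
  case (Suc k)
  note Suc
  also have "tail (\<lambda>i. \<alpha> i / 2 ^ k) ^ 2 ^ k \<le> ((tail (\<lambda>i. (\<alpha> i / 2 ^ k) / 2))\<^sup>2) ^ 2 ^ k"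
    by (intro power_mono tail_le_power2_half) (auto simp: assms, simp add: tail_def)
  also have "\<dots> = tail (\<lambda>i. \<alpha> i / 2 ^ Suc k) ^ 2 ^ Suc k"
    by (simp add: power_mult[symmetric] mult.commute)
  finally show ?case .
qed simp

text \<open>A crude box bound suffices: only the order \<open>a * b\<close> matters, since this is
  the error term that disappears when the thresholds are divided by 2^k.\<close>

lemma measure_two_slabs:
  assumes "i < n" "j < n" "i \<noteq> j" "0 \<le> a" "0 \<le> b"
  shows "measure P {x \<in> Rn n. \<bar>x i\<bar> < a \<and> \<bar>x j\<bar> < b} \<le> 4 * (2 * R) ^ n * a * b"
proof -
  have [measurable]: "{x \<in> Rn n. \<bar>x i\<bar> < a \<and> \<bar>x j\<bar> < b} \<in> sets M"
  proof -
    have "{x \<in> space M. \<bar>x i\<bar> < a \<and> \<bar>x j\<bar> < b} \<in> sets M" using assms(1,2) by measurable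
    then show ?thesis by (simp add: space_PiM)
  qed
  define I where "I l = (if l = i then {-a..a} else if l = j then {-b..b} else {-R..R})" for l
  define r where "r l = (if l = i then 2 * a else if l = j then 2 * b else 2 * R)" for l
  have "emeasure P {x \<in> Rn n. \<bar>x i\<bar> < a \<and> \<bar>x j\<bar> < b} = emeasure M (K \<inter> {x \<in> Rn n. \<bar>x i\<bar> < a \<and> \<bar>x j\<bar> < b})"
    by (rule emeasure_P) measurable
  also have "\<dots> \<le> emeasure M (\<Pi>\<^sub>E l\<in>{..<n}. I l)"
  proof (rule emeasure_mono)
    show "K \<inter> {x \<in> Rn n. \<bar>x i\<bar> < a \<and> \<bar>x j\<bar> < b} \<subseteq> (\<Pi>\<^sub>E l\<in>{..<n}. I l)"
    proof
      fix x assume x: "x \<in> K \<inter> {x \<in> Rn n. \<bar>x i\<bar> < a \<and> \<bar>x j\<bar> < b}"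
      then have *: "x \<in> K" "\<bar>x i\<bar> < a" "\<bar>x j\<bar> < b" "x \<in> extensional {..<n}" by (simp_all add: PiE_def)
      have "x l \<in> I l" if "l < n" for l
        using bounded_K[OF *(1) that] *(2,3) unfolding I_def by (simp add: abs_le_iff abs_less_iff)
      with *(4) show "x \<in> (\<Pi>\<^sub>E l\<in>{..<n}. I l)" by (simp add: PiE_iff)
    qed
  qed (auto simp: I_def intro!: sets_PiM_I_finite)
  also have "\<dots> = (\<Prod>l<n. ennreal (r l))"
    using assms R_ge by (subst lborel_prod.emeasure_PiM) (auto simp: I_def r_def intro!: prod.cong)
  also have "\<dots> = ennreal (\<Prod>l<n. r l)"
    using assms R_ge by (intro prod_ennreal) (auto simp: r_def)
  finally have "measure P {x \<in> Rn n. \<bar>x i\<bar> < a \<and> \<bar>x j\<bar> < b} \<le> (\<Prod>l<n. r l)"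
    using assms R_ge by (subst (asm) emeasure_eq_measure, subst (asm) ennreal_le_iff) (auto simp: r_def intro!: prod_nonneg)
  also have "(\<Prod>l<n. r l) = r i * r j * (\<Prod>l\<in>{..<n} - {i} - {j}. r l)"
    using assms by (simp add: prod.remove[of "{..<n}" i] prod.remove[of "{..<n} - {i}" j])
  also have "\<dots> \<le> r i * r j * (2 * R) ^ n"
  proof (rule mult_left_mono)
    have "card ({..<n} - {i} - {j}) \<le> card {..<n}" by (rule card_mono) auto
    then have "(2 * R) ^ card ({..<n} - {i} - {j}) \<le> (2 * R) ^ n"
      using R_ge by (intro power_increasing) auto
    moreover have "(\<Prod>l\<in>{..<n} - {i} - {j}. r l) = (\<Prod>l\<in>{..<n} - {i} - {j}. 2 * R)"
      by (rule prod.cong) (auto simp: r_def)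
    ultimately show "(\<Prod>l\<in>{..<n} - {i} - {j}. r l) \<le> (2 * R) ^ n" by simp
  qed (use assms in \<open>simp add: r_def\<close>)
  also have "\<dots> = 4 * (2 * R) ^ n * a * b" using assms by (simp add: r_def)
  finally show ?thesis .
qed

end

subsection \<open>Exponential moments\<close>

lemma borel_measurable_sinh [measurable (raw)]:
  fixes f :: "'a \<Rightarrow> real"
  assumes "f \<in> borel_measurable M" shows "(\<lambda>x. sinh (f x)) \<in> borel_measurable M"
  unfolding sinh_field_def using assms by measurable

text \<open>For X exponential with rate \<open>\<kappa>\<close> the integral is E cosh
  (\<open>\<theta> \<kappa>\<close> X) - 1, that is
  \<open>\<theta>\<^sup>2 / (1 - \<theta>\<^sup>2)\<close> when \<open>\<kappa> > 0\<close>; for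
  \<open>|\<theta>| \<le> 1/2\<close> this is at most \<open>2 \<theta>\<^sup>2\<close>.\<close>

lemma nn_integral_sinh_exp_le:
  fixes \<kappa> \<theta> :: real
  assumes "0 \<le> \<kappa>" "\<bar>\<theta>\<bar> \<le> 1 / 2"
  shows "(\<integral>\<^sup>+t. ennreal (\<bar>\<theta> * \<kappa>\<bar> * sinh (\<bar>\<theta> * \<kappa>\<bar> * t) * exp (- \<kappa> * t)) * indicator {0..} t \<partial>lborel)
     \<le> ennreal (exp (2 * \<theta>\<^sup>2) - 1)"
proof (cases "\<kappa> = 0 \<or> \<theta> = 0")
  case True
  then show ?thesis by auto
next
  case False
  define a where "a = \<bar>\<theta> * \<kappa>\<bar>"
  have a: "0 < a" "a < \<kappa>" using False assms by (auto simp: a_def abs_mult)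
  \<comment> \<open>An antiderivative of the integrand that tends to 0 at infinity, because
    \<open>a < \<kappa>\<close>.\<close>
  define F where "F t = (a / 2) * (exp ((a - \<kappa>) * t) / (a - \<kappa>) - exp (- (a + \<kappa>) * t) / (- (a + \<kappa>)))" for t
  have "(\<integral>\<^sup>+t. ennreal (a * sinh (a * t) * exp (- \<kappa> * t)) * indicator {0..} t \<partial>lborel) = ennreal (0 - F 0)"
  proof (rule nn_integral_FTC_atLeast)
    fix t :: real
    have "(F has_real_derivative (a / 2) * (exp ((a - \<kappa>) * t) - exp (- (a + \<kappa>) * t))) (at t)"
    proof -
      have d: "((\<lambda>t. exp (c * t) / c) has_real_derivative exp (c * t)) (at t)" if "c \<noteq> 0" for c
        using that by (auto intro!: derivative_eq_intros)
      show ?thesis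
        unfolding F_def using a by (intro DERIV_cmult DERIV_diff d) auto
    qed
    moreover have "(a / 2) * (exp ((a - \<kappa>) * t) - exp (- (a + \<kappa>) * t)) = a * sinh (a * t) * exp (- \<kappa> * t)"
      by (simp add: sinh_def field_simps flip: exp_add)
    ultimately show "(F has_real_derivative a * sinh (a * t) * exp (- \<kappa> * t)) (at t)" by (simp only:)
  next
    have l: "((\<lambda>t. exp (- c * t)) \<longlongrightarrow> 0) at_top" if "c > 0" for c :: real
    proof (rule filterlim_compose[OF exp_at_bot])
      have "filterlim (\<lambda>t. c * t) at_top at_top"
        by (rule filterlim_tendsto_pos_mult_at_top[OF tendsto_const that filterlim_ident])
      then show "filterlim (\<lambda>t. - c * t) at_bot at_top" by (simp add: filterlim_uminus_at_bot)
    qed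
    have "(F \<longlongrightarrow> (a / 2) * (0 / (a - \<kappa>) - 0 / (- (a + \<kappa>)))) at_top"
      unfolding F_def using l[of "\<kappa> - a"] l[of "a + \<kappa>"] a by (intro tendsto_intros) auto
    then show "(F \<longlongrightarrow> 0) at_top" by simp
  qed (use a in \<open>auto intro!: mult_nonneg_nonneg\<close>)
  also have "0 - F 0 \<le> exp (2 * \<theta>\<^sup>2) - 1"
  proof -
    have "\<theta>\<^sup>2 \<le> 1 / 4"
      using power_mono[OF assms(2) abs_ge_zero, of 2] by (simp add: power2_eq_square)
    have aa: "a * a = \<theta>\<^sup>2 * \<kappa>\<^sup>2" by (simp add: a_def power_mult_distrib flip: power2_eq_square)
    have "0 - F 0 = a * a / (\<kappa>\<^sup>2 - a * a)"
      using a by (simp add: F_def field_simps power2_eq_square)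
    also have "\<dots> = \<theta>\<^sup>2 / (1 - \<theta>\<^sup>2)"
    proof -
      have "\<theta>\<^sup>2 * \<kappa>\<^sup>2 / (\<kappa>\<^sup>2 - \<theta>\<^sup>2 * \<kappa>\<^sup>2) = (\<kappa>\<^sup>2 * \<theta>\<^sup>2) / (\<kappa>\<^sup>2 * (1 - \<theta>\<^sup>2))" by (simp add: algebra_simps)
      then show ?thesis using a by (simp add: aa)
    qed
    also have "\<dots> \<le> 2 * \<theta>\<^sup>2"
    proof -
      have "\<theta>\<^sup>2 * 1 \<le> \<theta>\<^sup>2 * (2 * (1 - \<theta>\<^sup>2))" using \<open>\<theta>\<^sup>2 \<le> 1 / 4\<close> by (intro mult_left_mono) auto
      then show ?thesis using \<open>\<theta>\<^sup>2 \<le> 1 / 4\<close> by (simp add: divide_le_eq algebra_simps)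
    qed
    also have "\<dots> \<le> exp (2 * \<theta>\<^sup>2) - 1" using exp_ge_add_one_self[of "2 * \<theta>\<^sup>2"] by linarith
    finally show ?thesis .
  qed
  finally show ?thesis by (simp add: a_def ennreal_leI)
qed

text \<open>The fundamental theorem for cosh, with absolute values so that the integrand is
  nonnegative and Tonelli's theorem applies later.\<close>

lemma nn_integral_sinh:
  fixes a s :: real
  shows "ennreal (cosh (a * s)) = 1 + (\<integral>\<^sup>+t. ennreal (\<bar>a\<bar> * sinh (\<bar>a\<bar> * t)) * indicator {0..\<bar>s\<bar>} t \<partial>lborel)"
proof -
  have "(\<integral>\<^sup>+t. ennreal (\<bar>a\<bar> * sinh (\<bar>a\<bar> * t)) * indicator {0..\<bar>s\<bar>} t \<partial>lborel)
     = ennreal (cosh (\<bar>a\<bar> * \<bar>s\<bar>) - cosh (\<bar>a\<bar> * 0))"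
    by (rule nn_integral_FTC_Icc) (auto intro!: derivative_eq_intros mult_nonneg_nonneg
        simp: has_real_derivative_iff_has_vector_derivative[symmetric])
  also have "cosh (\<bar>a\<bar> * \<bar>s\<bar>) = cosh (a * s)" by (simp add: abs_mult[symmetric])
  finally show ?thesis
    using cosh_real_ge_1[of "a * s"] by (simp add: ennreal_plus[symmetric] del: ennreal_plus flip: ennreal_1)
qed

context unconditional_body
begin

lemma sets_slab [measurable]: "i < n \<Longrightarrow> {x \<in> Rn n. \<bar>x i\<bar> < s} \<in> sets M"
proof -
  assume [simp]: "i < n"
  have "{x \<in> space M. \<bar>x i\<bar> < s} \<in> sets M" by measurable
  then show ?thesis by (simp add: space_PiM)
qed

text \<open>If \<open>c\<close> counts the slabs containing \<open>x\<close>, then 1 - c plus the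
  number of ordered pairs of distinct such slabs is (1 - c)^2, which is nonnegative and equals 1
  outside all slabs. The pairs are estimated by \<open>measure_two_slabs\<close>.\<close>

lemma bonferroni_tail:
  assumes "\<And>i. i < n \<Longrightarrow> 0 \<le> \<beta> i"
  shows "tail \<beta> \<le> 1 - (\<Sum>i<n. measure P {x \<in> Rn n. \<bar>x i\<bar> < \<beta> i})
    + (\<Sum>i<n. \<Sum>j\<in>{..<n} - {i}. 4 * (2 * R) ^ n * \<beta> i * \<beta> j)"
proof -
  define E where "E i = {x \<in> Rn n. \<bar>x i\<bar> < \<beta> i}" for i
  define T where "T = {x \<in> Rn n. \<forall>i<n. \<beta> i \<le> \<bar>x i\<bar>}"
  have [measurable]: "i < n \<Longrightarrow> E i \<in> sets M" "T \<in> sets M" for i by (auto simp: E_def T_def)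
  have pw: "indicator T x \<le> 1 - (\<Sum>i<n. indicator (E i) x) + (\<Sum>i<n. \<Sum>j\<in>{..<n} - {i}. indicator (E i \<inter> E j) x :: real)" for x
  proof -
    define c where "c = (\<Sum>i<n. indicator (E i) x :: real)"
    have "c * c = (\<Sum>i<n. \<Sum>j<n. indicator (E i \<inter> E j) x)"
      by (simp add: c_def sum_product indicator_inter_arith)
    also have "\<dots> = (\<Sum>i<n. indicator (E i) x + (\<Sum>j\<in>{..<n} - {i}. indicator (E i \<inter> E j) x))"
      by (intro sum.cong refl) (simp add: sum.remove)
    also have "\<dots> = c + (\<Sum>i<n. \<Sum>j\<in>{..<n} - {i}. indicator (E i \<inter> E j) x)"
      by (simp add: sum.distrib c_def)
    finally have "1 - c + (\<Sum>i<n. \<Sum>j\<in>{..<n} - {i}. indicator (E i \<inter> E j) x) = (1 - c)\<^sup>2"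
      by (simp add: power2_eq_square algebra_simps)
    moreover have "indicator T x \<le> (1 - c)\<^sup>2"
    proof (cases "x \<in> T")
      case True
      then have "c = 0" by (auto simp: c_def T_def E_def indicator_def not_less intro!: sum.neutral)
      then show ?thesis using True by simp
    qed simp
    ultimately show ?thesis by (simp add: c_def)
  qed
  have int: "integrable P (indicator A :: _ \<Rightarrow> real)" if "A \<in> sets M" for A
    using that by (intro integrable_bounded[where B = 1]) (auto simp: indicator_def)
  have "tail \<beta> = (\<integral>x. indicator T x \<partial>P)"
    by (simp add: tail_def T_def Int_def conj_ac)
  also have "\<dots> \<le> (\<integral>x. 1 - (\<Sum>i<n. indicator (E i) x) + (\<Sum>i<n. \<Sum>j\<in>{..<n} - {i}. indicator (E i \<inter> E j) x) \<partial>P)"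
    by (intro integral_mono pw Bochner_Integration.integrable_add Bochner_Integration.integrable_diff Bochner_Integration.integrable_sum int) auto
  also have "\<dots> = 1 - (\<Sum>i<n. measure P (E i)) + (\<Sum>i<n. \<Sum>j\<in>{..<n} - {i}. measure P (E i \<inter> E j))"
  proof -
    have i1: "(\<integral>x. indicator (E i) x \<partial>P) = measure P (E i)" if "i < n" for i
      using Int_absorb2[of "E i" "Rn n"] by (simp add: E_def)
    have i2: "(\<integral>x. indicator (E i \<inter> E j) x \<partial>P) = measure P (E i \<inter> E j)" for i j
    proof -
      have "E i \<inter> E j \<inter> Rn n = E i \<inter> E j" by (auto simp: E_def)
      then show ?thesis by simp
    qed
    have "(\<integral>x. 1 - (\<Sum>i<n. indicator (E i) x) + (\<Sum>i<n. \<Sum>j\<in>{..<n} - {i}. indicator (E i \<inter> E j) x :: real) \<partial>P)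
      = (\<integral>x. 1 - (\<Sum>i<n. indicator (E i) x) \<partial>P) + (\<integral>x. (\<Sum>i<n. \<Sum>j\<in>{..<n} - {i}. indicator (E i \<inter> E j) x) \<partial>P)"
      by (intro Bochner_Integration.integral_add Bochner_Integration.integrable_diff Bochner_Integration.integrable_sum int) auto
    also have "(\<integral>x. 1 - (\<Sum>i<n. indicator (E i) x :: real) \<partial>P) = (\<integral>x. 1 \<partial>P) - (\<integral>x. (\<Sum>i<n. indicator (E i) x) \<partial>P)"
      by (intro Bochner_Integration.integral_diff Bochner_Integration.integrable_sum int) auto
    also have "(\<integral>x. (\<Sum>i<n. indicator (E i) x) \<partial>P) = (\<Sum>i<n. measure P (E i))"
      by (subst Bochner_Integration.integral_sum, force intro!: int) (intro sum.cong refl i1, simp)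
    also have "(\<integral>x. (\<Sum>i<n. \<Sum>j\<in>{..<n} - {i}. indicator (E i \<inter> E j) x) \<partial>P) = (\<Sum>i<n. \<Sum>j\<in>{..<n} - {i}. measure P (E i \<inter> E j))"
      by (subst Bochner_Integration.integral_sum, force intro!: Bochner_Integration.integrable_sum int)
         (intro sum.cong refl, subst Bochner_Integration.integral_sum, force intro!: int, intro sum.cong refl i2)
    finally show ?thesis by simp
  qed
  also have "\<dots> \<le> 1 - (\<Sum>i<n. measure P (E i)) + (\<Sum>i<n. \<Sum>j\<in>{..<n} - {i}. 4 * (2 * R) ^ n * \<beta> i * \<beta> j)"
  proof (intro add_left_mono sum_mono)
    fix i j assume "i \<in> {..<n}" "j \<in> {..<n} - {i}"
    then have "measure P {x \<in> Rn n. \<bar>x i\<bar> < \<beta> i \<and> \<bar>x j\<bar> < \<beta> j} \<le> 4 * (2 * R) ^ n * \<beta> i * \<beta> j"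
      using assms by (intro measure_two_slabs) auto
    moreover have "E i \<inter> E j = {x \<in> Rn n. \<bar>x i\<bar> < \<beta> i \<and> \<bar>x j\<bar> < \<beta> j}" unfolding E_def by blast
    ultimately show "measure P (E i \<inter> E j) \<le> 4 * (2 * R) ^ n * \<beta> i * \<beta> j" by simp
  qed
  finally show ?thesis by (simp add: E_def)
qed

text \<open>At \<open>\<alpha> / N\<close> with \<open>N = 2 ^ k\<close> the tail is at most 1 - S/N
  + D/N^2, hence at most exp (-S/N + D/N^2). Its N-th power exp (-S + D/N) bounds
  \<open>tail \<alpha>\<close> by \<open>tail_le_power_dyadic\<close>, and \<open>k\<close> tends to
  infinity.\<close>

lemma tail_le_exp:
  assumes \<alpha>: "\<And>i. i < n \<Longrightarrow> 0 \<le> \<alpha> i" and "0 < s0"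
    and slab: "\<And>i s. i < n \<Longrightarrow> 0 < s \<Longrightarrow> s \<le> s0 \<Longrightarrow> \<kappa> i * s \<le> measure P {x \<in> Rn n. \<bar>x i\<bar> < s}"
  shows "tail \<alpha> \<le> exp (- (\<Sum>i<n. \<kappa> i * \<alpha> i))"
proof -
  define S where "S = (\<Sum>i<n. \<kappa> i * \<alpha> i)"
  define D where "D = (\<Sum>i<n. \<Sum>j\<in>{..<n} - {i}. 4 * (2 * R) ^ n * \<alpha> i * \<alpha> j)"
  have main: "tail \<alpha> \<le> exp (- S + D / 2 ^ k)" if small: "\<And>i. i < n \<Longrightarrow> \<alpha> i / 2 ^ k \<le> s0" for k :: nat
  proof -
    define N :: real where "N = 2 ^ k"
    have N: "N > 0" by (simp add: N_def)
    have "(\<Sum>i<n. measure P {x \<in> Rn n. \<bar>x i\<bar> < \<alpha> i / N}) \<ge> (\<Sum>i<n. \<kappa> i * (\<alpha> i / N))"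
    proof (rule sum_mono)
      fix i assume "i \<in> {..<n}"
      then show "\<kappa> i * (\<alpha> i / N) \<le> measure P {x \<in> Rn n. \<bar>x i\<bar> < \<alpha> i / N}"
        using slab[of i "\<alpha> i / N"] small[of i] \<alpha>[of i] N
        by (cases "\<alpha> i = 0") (auto simp: N_def)
    qed
    moreover have "(\<Sum>i<n. \<kappa> i * (\<alpha> i / N)) = S / N" by (simp add: S_def sum_divide_distrib)
    moreover have "(\<Sum>i<n. \<Sum>j\<in>{..<n} - {i}. 4 * (2 * R) ^ n * (\<alpha> i / N) * (\<alpha> j / N)) = D / (N * N)"
      by (simp add: D_def sum_divide_distrib)
    ultimately have "tail (\<lambda>i. \<alpha> i / N) \<le> 1 - S / N + D / (N * N)"
      using bonferroni_tail[of "\<lambda>i. \<alpha> i / N"] \<alpha> N by simp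
    also have "\<dots> \<le> exp (- S / N + D / (N * N))"
      using exp_ge_add_one_self[of "- S / N + D / (N * N)"] by linarith
    finally have "tail (\<lambda>i. \<alpha> i / N) ^ 2 ^ k \<le> exp (- S / N + D / (N * N)) ^ 2 ^ k"
      by (rule power_mono) (simp add: tail_def)
    also have "\<dots> = exp (N * (- S / N + D / (N * N)))"
      by (subst exp_of_nat_mult[symmetric]) (simp add: N_def)
    also have "N * (- S / N + D / (N * N)) = - S + D / N" using N by (simp add: field_simps)
    finally show ?thesis using tail_le_power_dyadic[of \<alpha> k] \<alpha> by (simp add: N_def)
  qed
  have lim0: "(\<lambda>k. c / 2 ^ k) \<longlonglongrightarrow> 0" for c :: real
    using tendsto_mult_right_zero[OF LIMSEQ_inverse_realpow_zero[of 2], of c] by (simp add: divide_inverse)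
  \<comment> \<open>The sum dominates every \<open>\<alpha> i\<close>, so one condition on
    \<open>k\<close> puts all thresholds below \<open>s0\<close>.\<close>
  have "eventually (\<lambda>k. (\<Sum>i<n. \<alpha> i) / 2 ^ k < s0) sequentially"
    using order_tendstoD(2)[OF lim0 \<open>0 < s0\<close>] .
  then have ev: "eventually (\<lambda>k. tail \<alpha> \<le> exp (- S + D / 2 ^ k)) sequentially"
  proof eventually_elim
    case (elim k)
    have "\<alpha> i / 2 ^ k \<le> s0" if "i < n" for i
    proof -
      have "\<alpha> i \<le> (\<Sum>i<n. \<alpha> i)" using that \<alpha> by (intro member_le_sum) auto
      then have "\<alpha> i / 2 ^ k \<le> (\<Sum>i<n. \<alpha> i) / 2 ^ k" by (intro divide_right_mono) auto
      then show ?thesis using elim by linarith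
    qed
    then show ?case by (rule main)
  qed
  have "(\<lambda>k. exp (- S + D / 2 ^ k)) \<longlonglongrightarrow> exp (- S + 0)"
    by (intro tendsto_intros lim0)
  then have "tail \<alpha> \<le> exp (- S + 0)" by (rule tendsto_lowerbound[OF _ ev]) simp
  then show ?thesis by (simp add: S_def)
qed

text \<open>Comparison with independent exponential variables of rates \<open>\<kappa> i\<close>,
  one coordinate at a time. The sign symmetry replaces exp by cosh, and cosh is an integral of the
  indicators of \<open>t \<le> |x k|\<close>; so only joint tails are ever evaluated.\<close>

lemma nn_integral_exp_le:
  assumes tail: "\<And>\<alpha>. (\<And>i. i < n \<Longrightarrow> 0 \<le> \<alpha> i) \<Longrightarrow> tail \<alpha> \<le> exp (- (\<Sum>i<n. \<kappa> i * \<alpha> i))"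
    and \<kappa>: "\<And>i. i < n \<Longrightarrow> 0 \<le> \<kappa> i" and \<theta>: "\<And>i. i < n \<Longrightarrow> \<bar>\<theta> i\<bar> \<le> 1 / 2"
  shows "(\<integral>\<^sup>+x. ennreal (exp (\<Sum>i<n. \<theta> i * \<kappa> i * x i)) \<partial>P) \<le> ennreal (exp (2 * (\<Sum>i<n. (\<theta> i)\<^sup>2)))"
proof -
  define E where "E k x = ennreal (exp (\<Sum>i<k. \<theta> i * \<kappa> i * x i))" for k and x :: "nat \<Rightarrow> real"
  define T where "T k \<alpha> = {x \<in> Rn n. \<forall>i\<in>{k..<n}. \<alpha> i \<le> \<bar>x i\<bar>}" for k and \<alpha> :: "nat \<Rightarrow> real"
  have T_sets [measurable]: "T k \<alpha> \<in> sets M" for k \<alpha>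
  proof -
    have "{x \<in> space M. \<forall>i\<in>{k..<n}. \<alpha> i \<le> \<bar>x i\<bar>} \<in> sets M" by measurable
    then show ?thesis by (simp add: T_def space_PiM)
  qed
  have E_meas [measurable]: "E k \<in> borel_measurable M" if "k \<le> n" for k
    unfolding E_def using that by (intro measurable_compose[OF _ measurable_ennreal] borel_measurable_exp
        borel_measurable_sum borel_measurable_times borel_measurable_const measurable_coord) auto
  \<comment> \<open>Coordinates below \<open>k\<close> carry the exponential factor, those from
    \<open>k\<close> on still a threshold. For \<open>k = 0\<close> this is the assumed tail bound,
    for \<open>k = n\<close> the claim.\<close>
  have "(\<integral>\<^sup>+x. E k x * indicator (T k \<alpha>) x \<partial>P)
      \<le> ennreal (exp (2 * (\<Sum>i<k. (\<theta> i)\<^sup>2) - (\<Sum>i\<in>{k..<n}. \<kappa> i * \<alpha> i)))"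
    if "k \<le> n" "\<And>i. i < n \<Longrightarrow> 0 \<le> \<alpha> i" for k \<alpha>
    using that
  proof (induction k arbitrary: \<alpha>)
    case 0
    have "(\<integral>\<^sup>+x. E 0 x * indicator (T 0 \<alpha>) x \<partial>P) = emeasure P (T 0 \<alpha>)" by (simp add: E_def)
    also have "\<dots> = ennreal (tail \<alpha>)" by (simp add: T_def tail_def emeasure_eq_measure Ball_def)
    finally show ?case using tail[of \<alpha>] 0 by (simp add: ennreal_leI atLeast0LessThan)
  next
    case (Suc k)
    then have k: "k < n" by simp
    note [measurable] = E_meas[OF less_imp_le[OF k]] E_meas[OF \<open>Suc k \<le> n\<close>]
    define a where "a = \<theta> k * \<kappa> k"
    define C where "C = exp (2 * (\<Sum>i<k. (\<theta> i)\<^sup>2) - (\<Sum>i\<in>{Suc k..<n}. \<kappa> i * \<alpha> i))"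
    define \<Phi> where "\<Phi> x = E k x * indicator (T (Suc k) \<alpha>) x" for x
    have \<Phi>_meas [measurable]: "\<Phi> \<in> borel_measurable M" unfolding \<Phi>_def by measurable
    have IH: "(\<integral>\<^sup>+x. \<Phi> x * indicator {x \<in> Rn n. t \<le> \<bar>x k\<bar>} x \<partial>P) \<le> ennreal (C * exp (- \<kappa> k * t))"
      if "0 \<le> t" for t
    proof -
      \<comment> \<open>Adding the condition \<open>t \<le> |x k|\<close> restores the threshold of
        coordinate \<open>k\<close>, now equal to \<open>t\<close>, so the induction hypothesis
        applies with \<open>\<alpha>(k := t)\<close>.\<close>
      have "(\<integral>\<^sup>+x. \<Phi> x * indicator {x \<in> Rn n. t \<le> \<bar>x k\<bar>} x \<partial>P) = (\<integral>\<^sup>+x. E k x * indicator (T k (\<alpha>(k := t))) x \<partial>P)"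
      proof (rule nn_integral_cong)
        fix x
        have "{k..<n} = insert k {Suc k..<n}" using k by auto
        then have "x \<in> T k (\<alpha>(k := t)) \<longleftrightarrow> x \<in> T (Suc k) \<alpha> \<and> x \<in> {x \<in> Rn n. t \<le> \<bar>x k\<bar>}"
          by (auto simp: T_def)
        then show "\<Phi> x * indicator {x \<in> Rn n. t \<le> \<bar>x k\<bar>} x = E k x * indicator (T k (\<alpha>(k := t))) x"
          by (simp add: \<Phi>_def indicator_def)
      qed
      also have "\<dots> \<le> ennreal (exp (2 * (\<Sum>i<k. (\<theta> i)\<^sup>2) - (\<Sum>i\<in>{k..<n}. \<kappa> i * (\<alpha>(k := t)) i)))"
        using Suc.prems \<open>0 \<le> t\<close> by (intro Suc.IH) auto
      also have "(\<Sum>i\<in>{k..<n}. \<kappa> i * (\<alpha>(k := t)) i) = \<kappa> k * t + (\<Sum>i\<in>{Suc k..<n}. \<kappa> i * \<alpha> i)"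
        using k by (simp add: sum.atLeast_Suc_lessThan)
      finally show ?thesis by (simp add: C_def diff_diff_eq exp_add[symmetric] algebra_simps exp_diff exp_minus field_simps)
    qed
    have even: "E k (x(k := - x k)) * indicator (T (Suc k) \<alpha>) (x(k := - x k)) = \<Phi> x" if "x \<in> Rn n" for x
    proof -
      have "E k (x(k := - x k)) = E k x" by (simp add: E_def)
      moreover have "x(k := - x k) \<in> T (Suc k) \<alpha> \<longleftrightarrow> x \<in> T (Suc k) \<alpha>"
        using that k by (auto simp: T_def PiE_iff extensional_def)
      ultimately show ?thesis by (simp add: \<Phi>_def indicator_def)
    qed
    interpret PL: pair_sigma_finite P lborel ..
    have joint: "(\<lambda>(x, t). \<Phi> x * (ennreal (\<bar>a\<bar> * sinh (\<bar>a\<bar> * t)) * indicator {0..\<bar>x k\<bar>} t)) \<in> borel_measurable (P \<Otimes>\<^sub>M lborel)"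
    proof -
      have 1: "(\<lambda>p. \<Phi> (fst p)) \<in> borel_measurable (P \<Otimes>\<^sub>M lborel)"
        by (rule measurable_compose[OF measurable_fst]) simp
      have 2: "(\<lambda>p. ennreal (\<bar>a\<bar> * sinh (\<bar>a\<bar> * snd p))) \<in> borel_measurable (P \<Otimes>\<^sub>M lborel)"
      proof -
        have "(\<lambda>t. \<bar>a\<bar> * sinh (\<bar>a\<bar> * t)) \<in> borel_measurable lborel"
        proof -
          have "continuous_on UNIV (\<lambda>t. \<bar>a\<bar> * sinh (\<bar>a\<bar> * t))" by (intro continuous_intros)
          then show ?thesis by (simp add: borel_measurable_continuous_onI)
        qed
        from measurable_compose[OF measurable_snd measurable_compose[OF this measurable_ennreal]]
        show ?thesis .
      qed
      have [measurable]: "(\<lambda>p. fst p k) \<in> borel_measurable (P \<Otimes>\<^sub>M lborel)"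
        by (rule measurable_compose[OF measurable_fst]) (simp add: k)
      have "(indicator {p \<in> space (P \<Otimes>\<^sub>M lborel). 0 \<le> snd p \<and> snd p \<le> \<bar>fst p k\<bar>} :: _ \<Rightarrow> ennreal) \<in> borel_measurable (P \<Otimes>\<^sub>M lborel)"
        by measurable
      then have 3: "(\<lambda>p. indicator {0..\<bar>fst p k\<bar>} (snd p) :: ennreal) \<in> borel_measurable (P \<Otimes>\<^sub>M lborel)"
        by (rule measurable_cong[THEN iffD1, rotated]) (simp add: indicator_def)
      show ?thesis
        unfolding split_beta' by (intro borel_measurable_times_ennreal 1 2 3)
    qed
    have slab_meas: "{x \<in> Rn n. t \<le> \<bar>x k\<bar>} \<in> sets M" for t
    proof -
      have "{x \<in> space M. t \<le> \<bar>x k\<bar>} \<in> sets M" using k by measurable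
      then show ?thesis by (simp add: space_PiM)
    qed
    define H where "H = (\<integral>\<^sup>+x. E (Suc k) x * indicator (T (Suc k) \<alpha>) x \<partial>P)"
    have H1: "H = (\<integral>\<^sup>+x. \<Phi> x * ennreal (exp (a * x k)) \<partial>P)"
      unfolding H_def
      by (intro nn_integral_cong) (simp add: \<Phi>_def E_def a_def exp_add ennreal_mult' mult.assoc mult.commute[of "indicator _ _"])
    \<comment> \<open>\<open>\<Phi>\<close> is even in coordinate \<open>k\<close>, so the exponents
      \<open>a * x k\<close> and \<open>- (a * x k)\<close> give the same integral; their average
      involves cosh.\<close>
    have H2: "H = (\<integral>\<^sup>+x. \<Phi> x * ennreal (exp (- (a * x k))) \<partial>P)"
    proof -
      have "H = (\<integral>\<^sup>+x. \<Phi> (x(k := - x k)) * ennreal (exp (a * (x(k := - x k)) k)) \<partial>P)"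
        unfolding H1 using k by (intro nn_integral_flip[symmetric, of k "\<lambda>x. \<Phi> x * ennreal (exp (a * x k))"]) measurable
      also have "\<dots> = (\<integral>\<^sup>+x. \<Phi> x * ennreal (exp (- (a * x k))) \<partial>P)"
        using even by (intro nn_integral_cong) (simp add: \<Phi>_def)
      finally show ?thesis .
    qed
    have "2 * H = (\<integral>\<^sup>+x. \<Phi> x * ennreal (exp (a * x k)) \<partial>P) + (\<integral>\<^sup>+x. \<Phi> x * ennreal (exp (- (a * x k))) \<partial>P)"
      using H1 H2 by (simp add: mult_2)
    also have "\<dots> = (\<integral>\<^sup>+x. \<Phi> x * ennreal (exp (a * x k)) + \<Phi> x * ennreal (exp (- (a * x k))) \<partial>P)"
      using k by (intro nn_integral_add[symmetric]) auto
    also have "\<dots> = (\<integral>\<^sup>+x. 2 * (\<Phi> x * ennreal (cosh (a * x k))) \<partial>P)"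
    proof (rule nn_integral_cong)
      fix x
      have "ennreal (exp (a * x k)) + ennreal (exp (- (a * x k))) = ennreal (2 * cosh (a * x k))"
        unfolding cosh_field_def by (subst ennreal_plus[symmetric]) (auto simp del: ennreal_plus)
      also have "\<dots> = 2 * ennreal (cosh (a * x k))" by (simp add: ennreal_mult)
      finally show "\<Phi> x * ennreal (exp (a * x k)) + \<Phi> x * ennreal (exp (- (a * x k))) = 2 * (\<Phi> x * ennreal (cosh (a * x k)))"
        by (simp add: distrib_left[symmetric] mult.left_commute)
    qed
    also have "\<dots> = 2 * (\<integral>\<^sup>+x. \<Phi> x * ennreal (cosh (a * x k)) \<partial>P)"
    proof (rule nn_integral_cmult)
      have "(\<lambda>x. ennreal (cosh (a * x k))) \<in> borel_measurable M"
        unfolding cosh_field_def using k by measurable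
      then show "(\<lambda>x. \<Phi> x * ennreal (cosh (a * x k))) \<in> borel_measurable P"
        using \<Phi>_meas by simp
    qed
    finally have "H = (\<integral>\<^sup>+x. \<Phi> x * ennreal (cosh (a * x k)) \<partial>P)"
      by (simp add: ennreal_mult_cancel_left)
    \<comment> \<open>After this expansion and an exchange of integrals, \<open>IH\<close> bounds
      the inner integral for each \<open>t\<close>, and \<open>nn_integral_sinh_exp_le\<close>
      evaluates the outer one.\<close>
    also have "\<dots> = (\<integral>\<^sup>+x. \<Phi> x + (\<integral>\<^sup>+t. \<Phi> x * (ennreal (\<bar>a\<bar> * sinh (\<bar>a\<bar> * t)) * indicator {0..\<bar>x k\<bar>} t) \<partial>lborel) \<partial>P)"
      by (intro nn_integral_cong, subst nn_integral_sinh, subst nn_integral_cmult) (auto simp: distrib_left)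
    also have "\<dots> = (\<integral>\<^sup>+x. \<Phi> x \<partial>P) + (\<integral>\<^sup>+x. (\<integral>\<^sup>+t. \<Phi> x * (ennreal (\<bar>a\<bar> * sinh (\<bar>a\<bar> * t)) * indicator {0..\<bar>x k\<bar>} t) \<partial>lborel) \<partial>P)"
      by (intro nn_integral_add lborel.borel_measurable_nn_integral) (use joint in auto)
    also have "(\<integral>\<^sup>+x. (\<integral>\<^sup>+t. \<Phi> x * (ennreal (\<bar>a\<bar> * sinh (\<bar>a\<bar> * t)) * indicator {0..\<bar>x k\<bar>} t) \<partial>lborel) \<partial>P)
       = (\<integral>\<^sup>+t. (\<integral>\<^sup>+x. \<Phi> x * (ennreal (\<bar>a\<bar> * sinh (\<bar>a\<bar> * t)) * indicator {0..\<bar>x k\<bar>} t) \<partial>P) \<partial>lborel)"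
      by (rule PL.Fubini'[symmetric, OF joint])
    also have "\<dots> \<le> (\<integral>\<^sup>+t. ennreal C * (ennreal (\<bar>a\<bar> * sinh (\<bar>a\<bar> * t) * exp (- \<kappa> k * t)) * indicator {0..} t) \<partial>lborel)"
    proof (rule nn_integral_mono)
      fix t :: real
      show "(\<integral>\<^sup>+x. \<Phi> x * (ennreal (\<bar>a\<bar> * sinh (\<bar>a\<bar> * t)) * indicator {0..\<bar>x k\<bar>} t) \<partial>P)
         \<le> ennreal C * (ennreal (\<bar>a\<bar> * sinh (\<bar>a\<bar> * t) * exp (- \<kappa> k * t)) * indicator {0..} t)"
      proof (cases "0 \<le> t")
        case True
        have "(\<integral>\<^sup>+x. \<Phi> x * (ennreal (\<bar>a\<bar> * sinh (\<bar>a\<bar> * t)) * indicator {0..\<bar>x k\<bar>} t) \<partial>P)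
           = (\<integral>\<^sup>+x. ennreal (\<bar>a\<bar> * sinh (\<bar>a\<bar> * t)) * (\<Phi> x * indicator {x \<in> Rn n. t \<le> \<bar>x k\<bar>} x) \<partial>P)"
        proof (rule nn_integral_cong)
          fix x assume "x \<in> space P"
          then have "(indicator {0..\<bar>x k\<bar>} t :: ennreal) = indicator {x \<in> Rn n. t \<le> \<bar>x k\<bar>} x"
            using True by (simp add: indicator_def)
          then show "\<Phi> x * (ennreal (\<bar>a\<bar> * sinh (\<bar>a\<bar> * t)) * indicator {0..\<bar>x k\<bar>} t)
             = ennreal (\<bar>a\<bar> * sinh (\<bar>a\<bar> * t)) * (\<Phi> x * indicator {x \<in> Rn n. t \<le> \<bar>x k\<bar>} x)"
            by (simp only: mult.left_commute)
        qed
        also have "\<dots> = ennreal (\<bar>a\<bar> * sinh (\<bar>a\<bar> * t)) * (\<integral>\<^sup>+x. \<Phi> x * indicator {x \<in> Rn n. t \<le> \<bar>x k\<bar>} x \<partial>P)"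
          using slab_meas by (intro nn_integral_cmult) auto
        also have "\<dots> \<le> ennreal (\<bar>a\<bar> * sinh (\<bar>a\<bar> * t)) * ennreal (C * exp (- \<kappa> k * t))"
          by (intro mult_left_mono IH True) simp
        also have "\<dots> = ennreal C * ennreal (\<bar>a\<bar> * sinh (\<bar>a\<bar> * t) * exp (- \<kappa> k * t))"
        proof -
          have "0 \<le> \<bar>a\<bar> * sinh (\<bar>a\<bar> * t)" "0 \<le> C" using True by (simp_all add: C_def)
          then have "ennreal w * ennreal (C * e) = ennreal C * ennreal (w * e)"
            if "w = \<bar>a\<bar> * sinh (\<bar>a\<bar> * t)" "0 \<le> e" for w e
            using that by (subst (1 2) ennreal_mult[symmetric]) (auto simp: mult.left_commute)
          then show ?thesis by simp
        qed
        finally show ?thesis using True by simp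
      qed simp
    qed
    also have "\<dots> = ennreal C * (\<integral>\<^sup>+t. ennreal (\<bar>a\<bar> * sinh (\<bar>a\<bar> * t) * exp (- \<kappa> k * t)) * indicator {0..} t \<partial>lborel)"
    proof (rule nn_integral_cmult)
      have "continuous_on UNIV (\<lambda>t. \<bar>a\<bar> * sinh (\<bar>a\<bar> * t) * exp (- \<kappa> k * t))"
        by (intro continuous_intros)
      then have "(\<lambda>t. \<bar>a\<bar> * sinh (\<bar>a\<bar> * t) * exp (- \<kappa> k * t)) \<in> borel_measurable borel"
        by (rule borel_measurable_continuous_onI)
      note m = measurable_compose[OF this measurable_ennreal]
      show "(\<lambda>t. ennreal (\<bar>a\<bar> * sinh (\<bar>a\<bar> * t) * exp (- \<kappa> k * t)) * indicator {0..} t) \<in> borel_measurable lborel"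
        by (rule borel_measurable_times_ennreal) (use m in simp_all)
    qed
    also have "\<dots> \<le> ennreal C * ennreal (exp (2 * (\<theta> k)\<^sup>2) - 1)"
      unfolding a_def by (intro mult_left_mono nn_integral_sinh_exp_le \<kappa> \<theta> k) simp
    also have "(\<integral>\<^sup>+x. \<Phi> x \<partial>P) \<le> ennreal C"
    proof -
      have "(\<integral>\<^sup>+x. \<Phi> x \<partial>P) = (\<integral>\<^sup>+x. \<Phi> x * indicator {x \<in> Rn n. 0 \<le> \<bar>x k\<bar>} x \<partial>P)"
        by (intro nn_integral_cong) (simp add: indicator_def)
      then show ?thesis using IH[of 0] by simp
    qed
    finally have "H \<le> ennreal C + ennreal C * ennreal (exp (2 * (\<theta> k)\<^sup>2) - 1)"
      by (simp add: add_right_mono)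
    also have "\<dots> = ennreal (C * exp (2 * (\<theta> k)\<^sup>2))"
      by (subst ennreal_mult[symmetric], simp_all add: C_def, subst ennreal_plus[symmetric]) (auto simp: algebra_simps)
    also have "C * exp (2 * (\<theta> k)\<^sup>2) = exp (2 * (\<Sum>i<Suc k. (\<theta> i)\<^sup>2) - (\<Sum>i\<in>{Suc k..<n}. \<kappa> i * \<alpha> i))"
      by (simp add: C_def exp_add[symmetric] algebra_simps)
    finally show ?case by (simp add: H_def)
  qed
  from this[of n "\<lambda>_. 0"]
  have "(\<integral>\<^sup>+x. E n x * indicator (T n (\<lambda>_. 0)) x \<partial>P) \<le> ennreal (exp (2 * (\<Sum>i<n. (\<theta> i)\<^sup>2)))" by simp
  also have "(\<integral>\<^sup>+x. E n x * indicator (T n (\<lambda>_. 0)) x \<partial>P) = (\<integral>\<^sup>+x. E n x \<partial>P)"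
    by (intro nn_integral_cong) (simp add: T_def indicator_def)
  finally show ?thesis by (simp add: E_def)
qed

end

section \<open>Mass near the coordinate hyperplanes and the isotropic constant\<close>

context unconditional_body
begin

lemma integrable_exp_linear:
  "integrable P (\<lambda>x. exp (\<Sum>i<n. a i * x i))"
proof (rule integrable_bounded)
  show "(\<lambda>x. exp (\<Sum>i<n. a i * x i)) \<in> borel_measurable M"
    by measurable
  fix x assume x: "x \<in> K"
  have "(\<Sum>i<n. a i * x i) \<le> (\<Sum>i<n. \<bar>a i\<bar> * R)"
  proof (rule sum_mono)
    fix i assume "i \<in> {..<n}"
    then have "\<bar>a i * x i\<bar> \<le> \<bar>a i\<bar> * R" using bounded_K[OF x, of i] by (simp add: abs_mult mult_left_mono)
    then show "a i * x i \<le> \<bar>a i\<bar> * R" by linarith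
  qed
  then show "\<bar>exp (\<Sum>i<n. a i * x i)\<bar> \<le> exp (\<Sum>i<n. \<bar>a i\<bar> * R)" by simp
qed

lemma integral_exp_le:
  assumes tail: "\<And>\<alpha>. (\<And>i. i < n \<Longrightarrow> 0 \<le> \<alpha> i) \<Longrightarrow> tail \<alpha> \<le> exp (- (\<Sum>i<n. \<kappa> i * \<alpha> i))"
    and \<kappa>: "\<And>i. i < n \<Longrightarrow> 0 \<le> \<kappa> i" and \<theta>: "\<And>i. i < n \<Longrightarrow> \<bar>\<theta> i\<bar> \<le> 1 / 2"
  shows "(\<integral>x. exp (\<Sum>i<n. \<theta> i * \<kappa> i * x i) \<partial>P) \<le> exp (2 * (\<Sum>i<n. (\<theta> i)\<^sup>2))"
proof -
  have "ennreal (\<integral>x. exp (\<Sum>i<n. \<theta> i * \<kappa> i * x i) \<partial>P) = (\<integral>\<^sup>+x. ennreal (exp (\<Sum>i<n. \<theta> i * \<kappa> i * x i)) \<partial>P)"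
    by (rule nn_integral_eq_integral[symmetric]) (auto intro: integrable_exp_linear)
  also have "\<dots> \<le> ennreal (exp (2 * (\<Sum>i<n. (\<theta> i)\<^sup>2)))"
    using assms by (rule nn_integral_exp_le)
  finally show ?thesis by simp
qed

text \<open>Contracting coordinate \<open>i\<close> by the factor \<open>s / t\<close> maps the slab
  of width \<open>t\<close> in \<open>K\<close> into the one of width \<open>s\<close> and
  multiplies volume by that factor. Hence the average density of |x_i| on [0, s] is nonincreasing in
  \<open>s\<close>, and a lower bound at one width passes to all smaller ones.\<close>

lemma slab_scale:
  assumes i: "i < n" and st: "0 < s" "s \<le> t"
  shows "s / t * measure P {x \<in> Rn n. \<bar>x i\<bar> < t} \<le> measure P {x \<in> Rn n. \<bar>x i\<bar> < s}"
proof -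
  define c where "c = s / t"
  have c: "0 < c" "c \<le> 1" using st by (auto simp: c_def)
  define A where "A s = K \<inter> {x \<in> Rn n. \<bar>x i\<bar> < s}" for s
  have A: "A r \<in> sets M" "emeasure P {x \<in> Rn n. \<bar>x i\<bar> < r} = emeasure M (A r)" for r
    using sets_slab[OF i, of r] by (auto simp: A_def emeasure_P)
  have "ennreal c * emeasure M (A t) = ennreal c * (\<integral>\<^sup>+x. indicator (A t) x \<partial>M)" using A by simp
  also have "\<dots> \<le> ennreal c * (\<integral>\<^sup>+x. indicator (A s) (x(i := c * x i)) \<partial>M)"
  proof (intro mult_left_mono nn_integral_mono)
    fix x
    have "x(i := c * x i) \<in> A s" if "x \<in> A t"
    proof -
      have x: "x \<in> K" "\<bar>x i\<bar> < t" using that by (auto simp: A_def)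
      have "x(i := c * x i) \<in> K" using x i c by (intro scale_K) auto
      moreover have "\<bar>c * x i\<bar> < s" using x st by (simp add: c_def abs_mult field_simps)
      ultimately show ?thesis using K_in_Rn by (simp add: A_def)
    qed
    then show "(indicator (A t) x :: ennreal) \<le> indicator (A s) (x(i := c * x i))"
      by (auto simp: indicator_def)
  qed simp
  also have "\<dots> = (\<integral>\<^sup>+x. indicator (A s) x \<partial>M)"
    using nn_integral_scale_coord[OF i, of c "indicator (A s)"] c A by simp
  also have "\<dots> = emeasure M (A s)" using A by simp
  finally have "ennreal c * ennreal (measure P {x \<in> Rn n. \<bar>x i\<bar> < t}) \<le> ennreal (measure P {x \<in> Rn n. \<bar>x i\<bar> < s})"
    by (simp add: A(2)[symmetric] emeasure_eq_measure)
  then show ?thesis using c by (simp add: ennreal_mult[symmetric] c_def)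
qed

lemma integrable_sq: "i < n \<Longrightarrow> integrable P (\<lambda>x. (x i)\<^sup>2)"
proof (rule integrable_bounded)
  assume i: "i < n"
  show "(\<lambda>x. (x i)\<^sup>2) \<in> borel_measurable M" using i by measurable
  fix x assume "x \<in> K"
  then show "\<bar>(x i)\<^sup>2\<bar> \<le> R\<^sup>2" using bounded_K[of x i] i power_mono[of "\<bar>x i\<bar>" R 2] by simp
qed

text \<open>
  By \<open>slab_scale\<close>, \<open>\<delta> / \<epsilon>\<close>, where \<open>\<delta>\<close> is the measure of the slab \<open>|x\<^sub>i| < \<epsilon>\<close>, is an admissible
  exponential rate for \<open>x\<^sub>i\<close>, so \<open>4 \<epsilon> / \<delta>\<close> bounds the standard deviation of \<open>x\<^sub>i\<close>.
\<close>

lemma slab_upper: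
  assumes i: "i < n" and L: "0 < L" "(\<integral>x. (x i)\<^sup>2 \<partial>P) = L\<^sup>2" and \<epsilon>: "0 < \<epsilon>"
  shows "measure P {x \<in> Rn n. \<bar>x i\<bar> < \<epsilon>} \<le> 4 * \<epsilon> / L"
proof -
  define \<delta> where "\<delta> = measure P {x \<in> Rn n. \<bar>x i\<bar> < \<epsilon>}"
  \<comment> \<open>The rate of coordinate \<open>i\<close>; all other rates are set to 0, which
    \<open>tail_le_exp\<close> permits.\<close>
  define k where "k = \<delta> / \<epsilon>"
  have k: "0 \<le> k" using \<epsilon> by (simp add: k_def \<delta>_def)
  define \<kappa> where "\<kappa> j = (if j = i then k else 0)" for j
  have tail: "tail \<alpha> \<le> exp (- (\<Sum>j<n. \<kappa> j * \<alpha> j))" if "\<And>j. j < n \<Longrightarrow> 0 \<le> \<alpha> j" for \<alpha>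
  proof (rule tail_le_exp[OF that \<epsilon>])
    fix j s assume "j < n" "0 < s" "s \<le> \<epsilon>"
    then show "\<kappa> j * s \<le> measure P {x \<in> Rn n. \<bar>x j\<bar> < s}"
      using slab_scale[of i s \<epsilon>] i by (auto simp: \<kappa>_def k_def \<delta>_def mult.commute)
  qed
  have mgf: "(\<integral>x. exp (\<theta> * k * x i) \<partial>P) \<le> exp (1 / 2)" if "\<bar>\<theta>\<bar> = 1 / 2" for \<theta>
  proof -
    define T where "T j = (if j = i then \<theta> else 0)" for j
    have "(\<integral>x. exp (\<Sum>j<n. T j * \<kappa> j * x j) \<partial>P) \<le> exp (2 * (\<Sum>j<n. (T j)\<^sup>2))"
      using k that by (intro integral_exp_le tail) (auto simp: \<kappa>_def T_def)
    moreover have "(\<Sum>j<n. T j * \<kappa> j * x j) = \<theta> * k * x i" for x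
    proof -
      have "(\<Sum>j<n. T j * \<kappa> j * x j) = (\<Sum>j<n. if j = i then \<theta> * k * x i else 0)"
        by (intro sum.cong) (auto simp: T_def \<kappa>_def)
      then show ?thesis using i by simp
    qed
    moreover have "(\<Sum>j<n. (T j)\<^sup>2) = \<theta>\<^sup>2"
    proof -
      have "(\<Sum>j<n. (T j)\<^sup>2) = (\<Sum>j<n. if j = i then \<theta>\<^sup>2 else 0)"
        by (intro sum.cong) (auto simp: T_def)
      then show ?thesis using i by simp
    qed
    moreover have "\<theta>\<^sup>2 = 1 / 4" using that by (metis power2_abs power_one_over four_x_squared one_power2 power_divide mult_2 numeral_Bit0 power2_eq_square mult.right_neutral)
    ultimately show ?thesis by simp
  qed
  have int: "integrable P (\<lambda>x. exp (\<theta> * k * x i))" for \<theta>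
  proof -
    have "(\<Sum>j<n. (if j = i then \<theta> * k else 0) * x j) = \<theta> * k * x i" for x :: "nat \<Rightarrow> real"
      using i by (simp add: if_distrib[of "\<lambda>c. c * _"] cong: if_cong)
    then show ?thesis using integrable_exp_linear[of "\<lambda>j. if j = i then \<theta> * k else 0"] by simp
  qed
  \<comment> \<open>The second moment is read off from the expectation of 2 cosh (k x_i / 2), which
    is at most 2 exp (1/2) <= 7/2. This gives k^2 L^2 <= 12, rounded to 16.\<close>
  have "2 + k\<^sup>2 / 8 * L\<^sup>2 = (\<integral>x. 2 + k\<^sup>2 / 8 * (x i)\<^sup>2 \<partial>P)"
    using integrable_sq[OF i] by (subst Bochner_Integration.integral_add) (auto simp: L)
  also have "\<dots> \<le> (\<integral>x. exp (1 / 2 * k * x i) + exp (- (1 / 2) * k * x i) \<partial>P)"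
  proof (rule integral_mono)
    fix x
    \<comment> \<open>A quadratic Taylor bound for the larger exponential and a linear one for the
      smaller.\<close>
    have cosh: "2 + y\<^sup>2 / 2 \<le> exp y + exp (- y)" for y :: real
    proof (cases "0 \<le> y")
      case True
      then show ?thesis
        using exp_lower_Taylor_quadratic[of y] exp_ge_add_one_self[of "- y"] by linarith
    next
      case False
      then show ?thesis
        using exp_lower_Taylor_quadratic[of "- y"] exp_ge_add_one_self[of y] unfolding power2_minus by linarith
    qed
    show "2 + k\<^sup>2 / 8 * (x i)\<^sup>2 \<le> exp (1 / 2 * k * x i) + exp (- (1 / 2) * k * x i)"
      using cosh[of "1 / 2 * k * x i"] by (simp add: power2_eq_square mult.assoc mult.left_commute)
  qed (use integrable_sq[OF i] int[of "1/2"] int[of "- (1/2)"] in auto)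
  also have "\<dots> \<le> exp (1 / 2) + exp (1 / 2)"
    using mgf[of "1/2"] mgf[of "- (1/2)"] int[of "1/2"] int[of "- (1/2)"]
    by (subst Bochner_Integration.integral_add) auto
  also have "\<dots> \<le> 7 / 2"
  proof -
    have "exp (1 / 2 :: real) \<le> 1 + 1/2 + (1/2)\<^sup>2" by (rule exp_bound) auto
    then show ?thesis by (simp add: power2_eq_square)
  qed
  finally have "k\<^sup>2 * L\<^sup>2 \<le> 16" by (simp add: mult.commute)
  then have "(k * L)\<^sup>2 \<le> 4\<^sup>2" by (simp add: power_mult_distrib)
  then have "k * L \<le> 4" by (rule power2_le_imp_le) simp
  then show ?thesis using L \<epsilon> by (simp add: k_def \<delta>_def field_simps)
qed

text \<open>By \<open>slab_upper\<close> the mass near 0 grows at most linearly, so the integrand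
  exceeds t with probability at most min (1, 2 / (L t^2)), which is integrable in t. The power -1
  would give a tail of order 1/t, for which this argument diverges.\<close>

lemma nn_integral_inverse_sqrt_le:
  assumes i: "i < n" and L: "0 < L" "(\<integral>x. (x i)\<^sup>2 \<partial>P) = L\<^sup>2"
  shows "(\<integral>\<^sup>+x. ennreal (1 / sqrt (2 * \<bar>x i\<bar>)) \<partial>P) \<le> ennreal (3 / sqrt L)"
proof -
  \<comment> \<open>The trivial bound 1 is used up to \<open>a\<close> and the quadratic decay
    beyond: a + 2 / (L a) = 3 / sqrt L.\<close>
  define a where "a = 1 / sqrt L"
  have a: "a > 0" using L by (simp add: a_def)
  have m: "(\<lambda>x. ennreal (1 / sqrt (2 * \<bar>x i\<bar>))) \<in> borel_measurable M" using i by measurable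
  have prob: "emeasure P {x \<in> space P. ennreal t < ennreal (1 / sqrt (2 * \<bar>x i\<bar>))} \<le> ennreal (min 1 (2 / L * (1 / t\<^sup>2)))"
    if t: "t > 0" for t
  proof -
    have sub: "{x \<in> space P. ennreal t < ennreal (1 / sqrt (2 * \<bar>x i\<bar>))} \<subseteq> {x \<in> Rn n. \<bar>x i\<bar> < 1 / (2 * t\<^sup>2)}"
    proof
      fix x assume "x \<in> {x \<in> space P. ennreal t < ennreal (1 / sqrt (2 * \<bar>x i\<bar>))}"
      then have x: "x \<in> Rn n" "t < 1 / sqrt (2 * \<bar>x i\<bar>)" using t by (auto simp: ennreal_less_iff)
      then have pos: "0 < sqrt (2 * \<bar>x i\<bar>)" using t by (cases "x i = 0") auto
      then have "t * sqrt (2 * \<bar>x i\<bar>) < 1" using x by (simp add: field_simps)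
      then have "(t * sqrt (2 * \<bar>x i\<bar>))\<^sup>2 < 1"
        using t pos by (simp add: power_less_one_iff abs_square_less_1)
      then have "t\<^sup>2 * (2 * \<bar>x i\<bar>) < 1" by (simp add: power_mult_distrib)
      then show "x \<in> {x \<in> Rn n. \<bar>x i\<bar> < 1 / (2 * t\<^sup>2)}" using x t by (simp add: field_simps)
    qed
    have "measure P {x \<in> Rn n. \<bar>x i\<bar> < 1 / (2 * t\<^sup>2)} \<le> 4 * (1 / (2 * t\<^sup>2)) / L"
      using t by (intro slab_upper[OF i L]) simp
    also have "\<dots> = 2 / L * (1 / t\<^sup>2)" by simp
    finally have 1: "measure P {x \<in> Rn n. \<bar>x i\<bar> < 1 / (2 * t\<^sup>2)} \<le> 2 / L * (1 / t\<^sup>2)" .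
    have 2: "measure P {x \<in> Rn n. \<bar>x i\<bar> < 1 / (2 * t\<^sup>2)} \<le> 1"
      using bounded_measure[of "{x \<in> Rn n. \<bar>x i\<bar> < 1 / (2 * t\<^sup>2)}"] by simp
    have "emeasure P {x \<in> space P. ennreal t < ennreal (1 / sqrt (2 * \<bar>x i\<bar>))} \<le> emeasure P {x \<in> Rn n. \<bar>x i\<bar> < 1 / (2 * t\<^sup>2)}"
      using sets_slab[OF i] by (intro emeasure_mono sub) simp
    also have "\<dots> \<le> ennreal (min 1 (2 / L * (1 / t\<^sup>2)))"
      using 1 2 by (simp add: emeasure_eq_measure ennreal_leI)
    finally show ?thesis .
  qed
  have "(\<integral>\<^sup>+x. ennreal (1 / sqrt (2 * \<bar>x i\<bar>)) \<partial>P) =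
     (\<integral>\<^sup>+t. emeasure P {x \<in> space P. ennreal t < ennreal (1 / sqrt (2 * \<bar>x i\<bar>))} * indicator {0..} t \<partial>lborel)"
    by (rule nn_integral_layer_cake) (unfold_locales, use m in simp)
  also have "\<dots> \<le> (\<integral>\<^sup>+t. indicator {0..a} t + ennreal (2 / L * (1 / t\<^sup>2)) * indicator {a..} t \<partial>lborel)"
  proof (rule nn_integral_mono)
    fix t :: real
    show "emeasure P {x \<in> space P. ennreal t < ennreal (1 / sqrt (2 * \<bar>x i\<bar>))} * indicator {0..} t
       \<le> indicator {0..a} t + ennreal (2 / L * (1 / t\<^sup>2)) * indicator {a..} t"
    proof (cases "t \<le> a")
      case True
      have "emeasure P {x \<in> space P. ennreal t < ennreal (1 / sqrt (2 * \<bar>x i\<bar>))} \<le> 1"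
        using emeasure_space[of P "{x \<in> space P. ennreal t < ennreal (1 / sqrt (2 * \<bar>x i\<bar>))}"] by (simp add: emeasure_P_UNIV)
      then show ?thesis using True by (cases "0 \<le> t") (auto intro: add_increasing2)
    next
      case False
      then have "emeasure P {x \<in> space P. ennreal t < ennreal (1 / sqrt (2 * \<bar>x i\<bar>))} \<le> ennreal (min 1 (2 / L * (1 / t\<^sup>2)))"
        using a by (intro prob) simp
      also have "\<dots> \<le> ennreal (2 / L * (1 / t\<^sup>2))" by (intro ennreal_leI) simp
      finally show ?thesis using False a by simp
    qed
  qed
  also have "\<dots> = ennreal a + (\<integral>\<^sup>+t. ennreal (2 / L * (1 / t\<^sup>2)) * indicator {a..} t \<partial>lborel)"
    using a by (subst nn_integral_add) auto
  also have "(\<integral>\<^sup>+t. ennreal (2 / L * (1 / t\<^sup>2)) * indicator {a..} t \<partial>lborel) = ennreal (0 - (2 / L * (- 1 / a)))"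
  proof (rule nn_integral_FTC_atLeast)
    fix t assume "a \<le> t"
    then show "((\<lambda>t. 2 / L * (- 1 / t)) has_real_derivative 2 / L * (1 / t\<^sup>2)) (at t)"
      using a L by (auto intro!: derivative_eq_intros simp: power2_eq_square)
  next
    have "((\<lambda>t. 2 / L * (- 1 / t)) \<longlongrightarrow> 2 / L * 0) at_top"
      by (intro tendsto_intros tendsto_divide_0[OF tendsto_const] filterlim_at_top_imp_at_infinity filterlim_ident)
    then show "((\<lambda>t. 2 / L * (- 1 / t)) \<longlongrightarrow> 0) at_top" by simp
  qed (use L in auto)
  also have "ennreal a + ennreal (0 - (2 / L * (- 1 / a))) = ennreal (a + 2 / L / a)"
    using a L by (subst ennreal_plus[symmetric]) auto
  also have "a + 2 / L / a = 3 / sqrt L"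
  proof -
    have "2 / (s * s) / (1 / s) = 2 / s" if "0 < s" for s :: real using that by simp
    from this[of "sqrt L"] have "2 / L / a = 2 / sqrt L" using L by (simp add: a_def)
    then show ?thesis by (simp add: a_def)
  qed
  finally show ?thesis .
qed

text \<open>
  \<open>K\<close> contains the box spanned by any of its points, so \<open>2|x\<^sub>1| \<cdots> 2|x\<^sub>n| \<le> 1\<close> on \<open>K\<close>; by
  \<open>ln y \<le> y - 1\<close> the mean of \<open>(2|x\<^sub>i|) \<^bsup>-1/2\<^esup>\<close> over \<open>i\<close> is then at least \<open>1\<close>.
\<close>

lemma isotropic_constant_le:
  assumes "0 < n" and L: "0 < L" "\<And>i. i < n \<Longrightarrow> (\<integral>x. (x i)\<^sup>2 \<partial>P) = L\<^sup>2"
  shows "L \<le> 9"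
proof -
  \<comment> \<open>The logarithms below require nonzero coordinates.\<close>
  have nz: "AE x in P. x i \<noteq> 0" if "i < n" for i
  proof (rule AE_I[where N = "{x \<in> Rn n. x i = 0}"])
    have "emeasure M (K \<inter> {x \<in> Rn n. x i = 0}) \<le> emeasure M {x \<in> Rn n. x i = 0}"
      using null_hyperplane[OF that] by (intro emeasure_mono) auto
    then show "emeasure P {x \<in> Rn n. x i = 0} = 0"
      using null_hyperplane[OF that] by (simp add: emeasure_P null_sets_def)
    show "{x \<in> Rn n. x i = 0} \<in> sets P" using null_hyperplane[OF that] by auto
  qed auto
  have "AE x in P. \<forall>i\<in>{..<n}. x i \<noteq> 0"
    by (rule AE_finite_allI) (auto intro: nz)
  then have pw: "AE x in P. real n \<le> (\<Sum>i<n. 1 / sqrt (2 * \<bar>x i\<bar>))"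
    using AE_P
  proof eventually_elim
    case (elim x)
    have "0 \<le> - (1/2) * ln (\<Prod>i<n. 2 * \<bar>x i\<bar>)"
      using prod_le_1_K[OF elim(2)] elim(1) by (intro mult_nonpos_nonpos) (auto intro!: prod_pos ln_le_zero_iff[THEN iffD2])
    also have "\<dots> = (\<Sum>i<n. ln (1 / sqrt (2 * \<bar>x i\<bar>)))"
      using elim(1) by (subst ln_prod) (auto simp: sum_distrib_left ln_div ln_sqrt intro!: sum.cong)
    also have "\<dots> \<le> (\<Sum>i<n. 1 / sqrt (2 * \<bar>x i\<bar>) - 1)"
      using elim(1) by (intro sum_mono ln_le_minus_one) auto
    finally show ?case by (simp add: sum_subtractf)
  qed
  have "ennreal (real n) = (\<integral>\<^sup>+x. ennreal (real n) \<partial>P)" by (simp add: emeasure_P_UNIV)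
  also have "\<dots> \<le> (\<integral>\<^sup>+x. (\<Sum>i<n. ennreal (1 / sqrt (2 * \<bar>x i\<bar>))) \<partial>P)"
  proof (rule nn_integral_mono_AE)
    show "AE x in P. ennreal (real n) \<le> (\<Sum>i<n. ennreal (1 / sqrt (2 * \<bar>x i\<bar>)))"
      using pw by eventually_elim (subst sum_ennreal, auto intro!: ennreal_leI)
  qed
  also have "\<dots> = (\<Sum>i<n. (\<integral>\<^sup>+x. ennreal (1 / sqrt (2 * \<bar>x i\<bar>)) \<partial>P))"
    by (rule nn_integral_sum) auto
  also have "\<dots> \<le> (\<Sum>i<n. ennreal (3 / sqrt L))"
    using L by (intro sum_mono nn_integral_inverse_sqrt_le) auto
  also have "\<dots> = ennreal (real n * (3 / sqrt L))"
    using L by (subst ennreal_mult) (auto simp: ennreal_of_nat_eq_real_of_nat)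
  finally have "real n \<le> real n * (3 / sqrt L)"
    using L by (subst (asm) ennreal_le_iff) auto
  then have "real n * 1 \<le> real n * (3 / sqrt L)" by (simp only: mult_1_right)
  then have "1 \<le> 3 / sqrt L" by (rule mult_left_le_imp_le) (simp add: \<open>0 < n\<close>)
  then have "sqrt L \<le> 3" using L by (simp add: field_simps)
  then have "(sqrt L)\<^sup>2 \<le> 3\<^sup>2" using L by (intro power_mono) auto
  then show ?thesis using L by (simp add: power2_eq_square)
qed

text \<open>Chebyshev's inequality gives mass at least 3/4 to the slab of half-width
  \<open>2 * L\<close>; \<open>slab_scale\<close> passes to smaller \<open>s\<close>, and L <= 9
  turns (3/4) / (2 L) into 1/24.\<close>

lemma slab_lower:
  assumes "i < n" and L: "0 < L" "\<And>i. i < n \<Longrightarrow> (\<integral>x. (x i)\<^sup>2 \<partial>P) = L\<^sup>2"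
    and s: "0 < s" "s \<le> 2 * L"
  shows "1 / 24 * s \<le> measure P {x \<in> Rn n. \<bar>x i\<bar> < s}"
proof -
  let ?A = "{x \<in> Rn n. \<bar>x i\<bar> < 2 * L}"
  have A: "?A \<in> sets M" by (rule sets_slab) fact
  have int: "integrable P (indicator ?A :: _ \<Rightarrow> real)"
    using A by (intro integrable_bounded[where B = 1]) (auto simp: indicator_def)
  have "1 - 1 / (4 * L\<^sup>2) * L\<^sup>2 = (\<integral>x. 1 - 1 / (4 * L\<^sup>2) * (x i)\<^sup>2 \<partial>P)"
    using integrable_sq[OF \<open>i < n\<close>] L(2)[OF \<open>i < n\<close>] by (subst Bochner_Integration.integral_diff) auto
  also have "\<dots> \<le> (\<integral>x. indicator ?A x \<partial>P)"
  proof (rule integral_mono)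
    fix x assume "x \<in> space P"
    then have x: "x \<in> Rn n" by simp
    show "1 - 1 / (4 * L\<^sup>2) * (x i)\<^sup>2 \<le> indicator ?A x"
    proof (cases "\<bar>x i\<bar> < 2 * L")
      case True
      then show ?thesis using x by (simp add: indicator_def)
    next
      case False
      then have "(2 * L)\<^sup>2 \<le> \<bar>x i\<bar>\<^sup>2" using L by (intro power_mono) auto
      then have "1 \<le> 1 / (4 * L\<^sup>2) * (x i)\<^sup>2" using L by (simp add: field_simps power_mult_distrib)
      then show ?thesis by (simp add: indicator_def)
    qed
  qed (use integrable_sq[OF \<open>i < n\<close>] int in auto)
  also have "\<dots> = measure P ?A"
  proof -
    have "?A \<inter> Rn n = ?A" by blast
    then show ?thesis by simp
  qed
  finally have A34: "3 / 4 \<le> measure P ?A" using L by simp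
  have "1 / 24 * s = s / (2 * 9) * (3 / 4)" by simp
  also have "\<dots> \<le> s / (2 * L) * measure P ?A"
    using A34 s L isotropic_constant_le[of L] \<open>i < n\<close> by (intro mult_mono divide_left_mono) auto
  also have "\<dots> \<le> measure P {x \<in> Rn n. \<bar>x i\<bar> < s}"
    using s \<open>i < n\<close> by (intro slab_scale) auto
  finally show ?thesis .
qed

text \<open>All rates are now the absolute constant 1/24, so the bound covers coefficients up to
  1/48 of each coordinate, in every dimension.\<close>

lemma integral_exp_isotropic_le:
  assumes "0 < L" "\<And>i. i < n \<Longrightarrow> (\<integral>x. (x i)\<^sup>2 \<partial>P) = L\<^sup>2"
    and \<theta>: "\<And>i. i < n \<Longrightarrow> \<bar>\<theta> i\<bar> \<le> 1 / 2"
  shows "(\<integral>x. exp (\<Sum>i<n. \<theta> i * (1 / 24) * x i) \<partial>P) \<le> exp (2 * (\<Sum>i<n. (\<theta> i)\<^sup>2))"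
proof (rule integral_exp_le)
  fix \<alpha> :: "nat \<Rightarrow> real" assume "\<And>i. i < n \<Longrightarrow> 0 \<le> \<alpha> i"
  then show "tail \<alpha> \<le> exp (- (\<Sum>i<n. 1 / 24 * \<alpha> i))"
    using assms by (intro tail_le_exp[of \<alpha> "2 * L"] slab_lower[where L = L]) auto
qed (use \<theta> in auto)

end

subsection \<open>Upper bound\<close>

lemma powr_le_exp_mult:
  fixes t q :: real
  assumes "0 \<le> t" "0 \<le> q"
  shows "t powr q \<le> exp (q * t)"
proof (cases "t = 0")
  case False
  then have "ln t \<le> t" using assms ln_le_minus_one[of t] by linarith
  then show ?thesis using False assms by (simp add: powr_def mult_left_mono)
qed simp

context unconditional_body
begin

text \<open>The candidate for the support function of Z_q(K) as an L_q norm; the identification with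
  the supremum over \<open>Z_body\<close> comes from \<open>support_fun_moment_body\<close>.\<close>

definition Zq_norm :: "real \<Rightarrow> (nat \<Rightarrow> real) \<Rightarrow> real" where
  "Zq_norm q y = (\<integral>x. \<bar>dot n x y\<bar> powr q \<partial>P) powr (1 / q)"

lemma dot_abs_le:
  assumes "x \<in> K"
  shows "\<bar>dot n x y\<bar> \<le> (\<Sum>i<n. R * \<bar>y i\<bar>)"
proof -
  have "\<bar>dot n x y\<bar> \<le> (\<Sum>i<n. \<bar>x i * y i\<bar>)" unfolding dot_def by (rule sum_abs)
  also have "\<dots> \<le> (\<Sum>i<n. R * \<bar>y i\<bar>)"
    using bounded_K[OF assms] by (intro sum_mono) (auto simp: abs_mult intro!: mult_right_mono)
  finally show ?thesis .
qed

lemma integrable_dot_powr: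
  assumes "0 \<le> p" shows "integrable P (\<lambda>x. \<bar>dot n x y\<bar> powr p)"
proof (rule integrable_bounded)
  show "(\<lambda>x. \<bar>dot n x y\<bar> powr p) \<in> borel_measurable M" by measurable
  fix x assume "x \<in> K"
  then have "\<bar>dot n x y\<bar> powr p \<le> (\<Sum>i<n. R * \<bar>y i\<bar>) powr p"
    using assms by (intro powr_mono2 dot_abs_le) auto
  then show "\<bar>\<bar>dot n x y\<bar> powr p\<bar> \<le> (\<Sum>i<n. R * \<bar>y i\<bar>) powr p" by simp
qed

lemma Zq_norm_measurable [measurable]: "Zq_norm q \<in> borel_measurable M"
proof -
  have joint: "(\<lambda>(y, x). \<bar>dot n x y\<bar> powr q) \<in> borel_measurable (M \<Otimes>\<^sub>M P)"
  proof -
    have "(\<lambda>p. dot n (snd p) (fst p)) \<in> borel_measurable (M \<Otimes>\<^sub>M P)"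
    proof (rule measurable_dot)
      fix i assume i: "i < n"
      show "(\<lambda>p. snd p i) \<in> borel_measurable (M \<Otimes>\<^sub>M P)"
        by (rule measurable_compose[OF measurable_snd]) (simp add: i)
      show "(\<lambda>p. fst p i) \<in> borel_measurable (M \<Otimes>\<^sub>M P)"
        by (rule measurable_compose[OF measurable_fst]) (simp add: i)
    qed
    then show ?thesis unfolding split_beta' by measurable
  qed
  have "(\<lambda>y. \<integral>x. \<bar>dot n x y\<bar> powr q \<partial>P) \<in> borel_measurable M"
    using borel_measurable_lebesgue_integral[OF joint] by simp
  then show ?thesis unfolding Zq_norm_def by measurable
qed

lemma Zq_norm_nonneg: "0 \<le> Zq_norm q y"
  by (simp add: Zq_norm_def)

text \<open>The q-th moment is dominated by the exponential moments of both signs at a tilt chosen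
  so that these cost only a factor of order e^q, which the q-th root turns into a constant.\<close>

lemma Zq_norm_le:
  assumes L: "0 < L" "\<And>i. i < n \<Longrightarrow> (\<integral>x. (x i)\<^sup>2 \<partial>P) = L\<^sup>2"
    and q: "2 \<le> q" "q \<le> real n" and m: "0 < m" "\<And>i. i < n \<Longrightarrow> \<bar>y i\<bar> \<le> m"
  shows "Zq_norm q y \<le> 48 * exp 1 * sqrt (q * real n) * m"
proof -
  have n: "0 < real n" using q by simp
  \<comment> \<open>Chosen so that 2 n \<open>\<theta>\<^sup>2\<close> = q/2;
    \<open>q \<le> n\<close> makes it admissible for
    \<open>integral_exp_isotropic_le\<close>.\<close>
  define \<theta> where "\<theta> = sqrt (q / real n) / 2"
  have \<theta>: "0 < \<theta>" "\<theta> \<le> 1 / 2" "real n * \<theta>\<^sup>2 = q / 4"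
    using q n by (auto simp: \<theta>_def power_divide)
  define s where "s = \<theta> / (24 * m)"
  have s: "0 < s" using \<theta> m by (simp add: s_def)
  have mgf: "(\<integral>x. exp (\<sigma> * (s * dot n x y)) \<partial>P) \<le> exp (q / 2)"
    and int: "integrable P (\<lambda>x. exp (\<sigma> * (s * dot n x y)))" if "\<bar>\<sigma>\<bar> = 1" for \<sigma>
  proof -
    define T where "T i = \<sigma> * \<theta> * (y i / m)" for i
    have T: "\<bar>T i\<bar> \<le> \<theta>" if "i < n" for i
    proof -
      have "\<bar>T i\<bar> = \<theta> * (\<bar>y i\<bar> / m)" using \<open>\<bar>\<sigma>\<bar> = 1\<close> \<theta> m by (simp add: T_def abs_mult)
      also have "\<dots> \<le> \<theta> * 1" using \<theta> m that by (intro mult_left_mono) auto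
      finally show ?thesis by simp
    qed
    have eq: "(\<Sum>i<n. T i * (1 / 24) * x i) = \<sigma> * (s * dot n x y)" for x
      by (simp add: T_def s_def dot_def sum_distrib_left sum_divide_distrib ac_simps)
    have "(\<integral>x. exp (\<Sum>i<n. T i * (1 / 24) * x i) \<partial>P) \<le> exp (2 * (\<Sum>i<n. (T i)\<^sup>2))"
      using T \<theta> by (intro integral_exp_isotropic_le[OF L]) force+
    also have "(\<Sum>i<n. (T i)\<^sup>2) \<le> (\<Sum>i<n. \<theta>\<^sup>2)"
      using T by (intro sum_mono) (metis abs_ge_zero lessThan_iff power2_abs power_mono)
    also have "\<dots> = q / 4" using \<theta> by simp
    finally show "(\<integral>x. exp (\<sigma> * (s * dot n x y)) \<partial>P) \<le> exp (q / 2)" unfolding eq by simp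
    show "integrable P (\<lambda>x. exp (\<sigma> * (s * dot n x y)))"
      using integrable_exp_linear[of "\<lambda>i. T i * (1 / 24)"] unfolding eq .
  qed
  \<comment> \<open>With t = |<x, y>| / A, the inequality t^q <= exp (q t) has exactly the exponent
    s |<x, y>| controlled by \<open>mgf\<close>.\<close>
  define A where "A = q / s"
  have A: "0 < A" using q s by (simp add: A_def)
  have "(\<integral>x. \<bar>dot n x y\<bar> powr q \<partial>P) \<le> (\<integral>x. A powr q * (exp (1 * (s * dot n x y)) + exp (- 1 * (s * dot n x y))) \<partial>P)"
  proof (rule integral_mono)
    fix x
    define t where "t = \<bar>dot n x y\<bar> / A"
    have t: "0 \<le> t" "\<bar>dot n x y\<bar> = A * t" "q * t = \<bar>s * dot n x y\<bar>"
      using A q s by (auto simp: t_def A_def abs_mult)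
    have "\<bar>dot n x y\<bar> powr q = A powr q * t powr q" using t A by (simp add: powr_mult)
    also have "\<dots> \<le> A powr q * exp \<bar>s * dot n x y\<bar>"
      using powr_le_exp_mult[of t q] t q by (intro mult_left_mono) auto
    also have "\<dots> \<le> A powr q * (exp (1 * (s * dot n x y)) + exp (- 1 * (s * dot n x y)))"
      by (intro mult_left_mono) (auto simp: abs_real_def)
    finally show "\<bar>dot n x y\<bar> powr q \<le> \<dots>" .
  qed (use q int[of 1] int[of "-1"] in \<open>auto intro!: integrable_dot_powr\<close>)
  also have "\<dots> = A powr q * ((\<integral>x. exp (1 * (s * dot n x y)) \<partial>P) + (\<integral>x. exp (- 1 * (s * dot n x y)) \<partial>P))"
    using int[of 1] int[of "-1"] by simp
  also have "\<dots> \<le> A powr q * (exp (q / 2) + exp (q / 2))"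
    using mgf[of 1] mgf[of "-1"] by (intro mult_left_mono add_mono) auto
  \<comment> \<open>Here \<open>q \<ge> 2\<close> is used: the factor 2 from the two signs is
    absorbed by exp (q/2).\<close>
  also have "exp (q / 2) + exp (q / 2) \<le> exp q"
  proof -
    have "2 \<le> exp (q / 2)" using exp_ge_add_one_self[of "q / 2"] q by linarith
    then have "2 * exp (q / 2) \<le> exp (q / 2) * exp (q / 2)" by (intro mult_right_mono) auto
    then show ?thesis by (simp add: exp_add[symmetric])
  qed
  also have "A powr q * exp q = (A * exp 1) powr q"
    using A by (simp only: powr_mult less_imp_le exp_ge_zero) (simp add: powr_def)
  finally have "(\<integral>x. \<bar>dot n x y\<bar> powr q \<partial>P) powr (1 / q) \<le> ((A * exp 1) powr q) powr (1 / q)"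
    using q by (intro powr_mono2) (auto simp: mult_left_mono)
  also have "\<dots> = A * exp 1" using A q by (simp add: powr_powr)
  also have "A = 48 * sqrt (q * real n) * m"
  proof -
    have "sqrt (q * real n) * sqrt (q / real n) = q"
      using q n by (simp add: real_sqrt_mult[symmetric])
    then have "q / sqrt (q / real n) = sqrt (q * real n)" using q n by (simp add: field_simps)
    moreover have "A = 48 * (q / sqrt (q / real n)) * m" using m by (simp add: A_def s_def \<theta>_def)
    ultimately show ?thesis by simp
  qed
  finally show ?thesis by (simp add: Zq_norm_def mult_ac)
qed

lemma integrable_Zq_norm:
  assumes L: "0 < L" "\<And>i. i < n \<Longrightarrow> (\<integral>x. (x i)\<^sup>2 \<partial>P) = L\<^sup>2" and q: "2 \<le> q" "q \<le> real n"
  shows "integrable P (Zq_norm q)"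
proof (rule integrable_bounded)
  fix y assume "y \<in> K"
  then have "Zq_norm q y \<le> 48 * exp 1 * sqrt (q * real n) * R"
    using R_ge bounded_K by (intro Zq_norm_le[OF L q]) auto
  then show "\<bar>Zq_norm q y\<bar> \<le> 48 * exp 1 * sqrt (q * real n) * R"
    by (simp add: Zq_norm_nonneg)
qed measurable

text \<open>
  The maximum of the \<open>|y\<^sub>i|\<close> is replaced by the smoother bound
  \<open>48 (ln n + n\<^bsup>-1\<^esup> \<Sum>\<^sub>i exp (|y\<^sub>i| / 48))\<close>.
\<close>

lemma integral_Zq_norm_le:
  assumes L: "0 < L" "\<And>i. i < n \<Longrightarrow> (\<integral>x. (x i)\<^sup>2 \<partial>P) = L\<^sup>2" and q: "2 \<le> q" "q \<le> real n"
  shows "(\<integral>y. Zq_norm q y \<partial>P) \<le> 48 * exp 1 * (48 * 9) * sqrt (q * real n) * ln (real n)"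
proof -
  have n: "2 \<le> real n" using q by linarith
  define C where "C = 48 * exp 1 * sqrt (q * real n)"
  have C: "0 \<le> C" using q by (simp add: C_def)
  \<comment> \<open>The scale 48 is the largest tilt 1/2 times the rate 1/24, so each exponential
    below has expectation at most exp (1/2).\<close>
  define m where "m y = 48 * (ln (real n) + (\<Sum>i<n. exp (y i / 48) + exp (- y i / 48)) / real n)" for y :: "nat \<Rightarrow> real"
  have mgf: "(\<integral>y. exp (\<sigma> * y i / 48) \<partial>P) \<le> exp (1 / 2)" and int: "integrable P (\<lambda>y. exp (\<sigma> * y i / 48))"
    if "i < n" "\<bar>\<sigma>\<bar> = 1" for i \<sigma>
  proof -
    define T where "T j = (if j = i then \<sigma> / 2 else 0)" for j
    have eq: "(\<Sum>j<n. T j * (1 / 24) * y j) = \<sigma> * y i / 48" for y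
    proof -
      have "(\<Sum>j<n. T j * (1 / 24) * y j) = (\<Sum>j<n. if j = i then \<sigma> * y i / 48 else 0)"
        by (intro sum.cong) (auto simp: T_def)
      then show ?thesis using \<open>i < n\<close> by simp
    qed
    have "\<sigma>\<^sup>2 = 1" using that(2) by (metis one_power2 power2_abs)
    have "(\<Sum>j<n. (T j)\<^sup>2) = (\<Sum>j<n. if j = i then (\<sigma> / 2)\<^sup>2 else 0)"
      by (intro sum.cong) (auto simp: T_def)
    also have "\<dots> = 1 / 4" using \<open>i < n\<close> \<open>\<sigma>\<^sup>2 = 1\<close> by (simp add: power_divide)
    finally have sq: "(\<Sum>j<n. (T j)\<^sup>2) = 1 / 4" .
    have "(\<integral>y. exp (\<Sum>j<n. T j * (1 / 24) * y j) \<partial>P) \<le> exp (2 * (\<Sum>j<n. (T j)\<^sup>2))"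
      using that by (intro integral_exp_isotropic_le[OF L]) (auto simp: T_def)
    then show "(\<integral>y. exp (\<sigma> * y i / 48) \<partial>P) \<le> exp (1 / 2)" unfolding eq sq by simp
    show "integrable P (\<lambda>y. exp (\<sigma> * y i / 48))"
      using integrable_exp_linear[of "\<lambda>j. T j * (1 / 24)"] unfolding eq .
  qed
  note int' = int[of _ 1, simplified] int[of _ "-1", simplified]
  have m_int: "integrable P m"
    unfolding m_def using int' by (intro integrable_mult_right Bochner_Integration.integrable_add integrable_divide Bochner_Integration.integrable_sum) auto
  have m_ge: "\<bar>y i\<bar> \<le> m y" if "i < n" for y i
  proof -
    define t where "t = \<bar>y i\<bar> / 48"
    \<comment> \<open>Subtracting ln n before bounding by exp is what divides the sum of
      exponentials by n.\<close>
    have "t - ln (real n) \<le> exp (t - ln (real n))" using exp_ge_add_one_self[of "t - ln (real n)"] by linarith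
    also have "\<dots> = exp t / real n" using n by (simp add: exp_diff)
    also have "\<dots> \<le> (\<Sum>i<n. exp (y i / 48) + exp (- y i / 48)) / real n"
    proof (rule divide_right_mono)
      have "exp t \<le> exp (y i / 48) + exp (- y i / 48)" by (auto simp: t_def abs_real_def)
      also have "\<dots> \<le> (\<Sum>i<n. exp (y i / 48) + exp (- y i / 48))"
        using that by (intro member_le_sum) auto
      finally show "exp t \<le> (\<Sum>i<n. exp (y i / 48) + exp (- y i / 48))" .
    qed simp
    finally show ?thesis by (simp add: m_def t_def)
  qed
  have m_pos: "0 < m y" for y
    unfolding m_def using n by (intro mult_pos_pos add_pos_nonneg divide_nonneg_nonneg sum_nonneg) auto
  have "(\<integral>y. m y \<partial>P) = 48 * (ln (real n) + (\<Sum>i<n. (\<integral>y. exp (y i / 48) \<partial>P) + (\<integral>y. exp (- y i / 48) \<partial>P)) / real n)"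
  proof -
    have "(\<integral>y. (\<Sum>i<n. exp (y i / 48) + exp (- y i / 48)) / real n \<partial>P) = (\<Sum>i<n. (\<integral>y. exp (y i / 48) \<partial>P) + (\<integral>y. exp (- y i / 48) \<partial>P)) / real n"
      using int' by simp
    moreover have "integrable P (\<lambda>y. (\<Sum>i<n. exp (y i / 48) + exp (- y i / 48)) / real n)"
      using int' by (intro integrable_divide Bochner_Integration.integrable_sum Bochner_Integration.integrable_add) auto
    moreover have "(\<integral>y. m y \<partial>P) = 48 * (\<integral>y. ln (real n) + (\<Sum>i<n. exp (y i / 48) + exp (- y i / 48)) / real n \<partial>P)"
      unfolding m_def by (rule integral_mult_right_zero)
    ultimately show ?thesis by (subst (asm) Bochner_Integration.integral_add) auto
  qed
  also have "\<dots> \<le> 48 * (ln (real n) + 4)"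
  proof -
    have "exp (1 / 2 :: real) \<le> 2"
    proof -
      have "exp (1 / 2 :: real) \<le> 1 + 1/2 + (1/2)\<^sup>2" by (rule exp_bound) auto
      then show ?thesis by (simp add: power2_eq_square)
    qed
    then have "(\<integral>y. exp (y i / 48) \<partial>P) + (\<integral>y. exp (- y i / 48) \<partial>P) \<le> 4" if "i < n" for i
      using mgf[of i 1] mgf[of i "-1"] that by simp
    then have "(\<Sum>i<n. (\<integral>y. exp (y i / 48) \<partial>P) + (\<integral>y. exp (- y i / 48) \<partial>P)) \<le> (\<Sum>i<n. 4)"
      by (intro sum_mono) auto
    then show ?thesis using n by (simp add: divide_le_eq)
  qed
  also have "\<dots> \<le> 48 * 9 * ln (real n)"
  proof -
    \<comment> \<open>The additive 4 is at most 8 ln n because n >= 2; this is the origin of the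
      factor 9 here.\<close>
    have "1 / 2 \<le> ln (2 :: real)" using ln2_ge_two_thirds by simp
    also have "\<dots> \<le> ln (real n)" using n by simp
    finally show ?thesis by simp
  qed
  finally have m_mean: "(\<integral>y. m y \<partial>P) \<le> 48 * 9 * ln (real n)" .
  have "(\<integral>y. Zq_norm q y \<partial>P) \<le> (\<integral>y. C * m y \<partial>P)"
    using m_int m_pos m_ge unfolding C_def
    by (intro integral_mono integrable_Zq_norm[OF L q] Zq_norm_le[OF L q] integrable_mult_right) auto
  also have "\<dots> = C * (\<integral>y. m y \<partial>P)" by simp
  also have "\<dots> \<le> C * (48 * 9 * ln (real n))" using m_mean C by (rule mult_left_mono)
  finally show ?thesis by (simp add: C_def mult_ac)
qed

end

subsection \<open>Lower bound\<close>

lemma nn_integral_exp_abs_le: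
  fixes s :: real
  assumes s: "0 < s"
  shows "(\<integral>\<^sup>+t. ennreal (exp (- s * \<bar>t\<bar>)) \<partial>lborel) \<le> ennreal (2 / s)"
proof -
  have "(\<lambda>t. exp (- s * t)) \<in> borel_measurable borel"
    by (intro borel_measurable_continuous_onI continuous_intros)
  from measurable_compose[OF this measurable_ennreal]
  have f_meas: "(\<lambda>t. ennreal (exp (- s * t)) * indicator {0..} t) \<in> borel_measurable borel"
    by (rule borel_measurable_times_ennreal) simp
  have half: "(\<integral>\<^sup>+t. ennreal (exp (- s * t)) * indicator {0..} t \<partial>lborel) = ennreal (1 / s)"
  proof -
    have "(\<integral>\<^sup>+t. ennreal (exp (- s * t)) * indicator {0..} t \<partial>lborel) = ennreal (0 - (- exp (- s * 0) / s))"
    proof (rule nn_integral_FTC_atLeast)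
      fix t :: real
      show "((\<lambda>t. - exp (- s * t) / s) has_real_derivative exp (- s * t)) (at t)"
        using s by (auto intro!: derivative_eq_intros)
    next
      have "filterlim (\<lambda>t. s * t) at_top at_top"
        by (rule filterlim_tendsto_pos_mult_at_top[OF tendsto_const s filterlim_ident])
      then have "filterlim (\<lambda>t. - s * t) at_bot at_top" by (simp add: filterlim_uminus_at_bot)
      from filterlim_compose[OF exp_at_bot this]
      have "((\<lambda>t. - exp (- s * t) / s) \<longlongrightarrow> - 0 / s) at_top" by (intro tendsto_intros) (use s in auto)
      then show "((\<lambda>t. - exp (- s * t) / s) \<longlongrightarrow> 0) at_top" by simp
    qed auto
    then show ?thesis by simp
  qed
  have "(\<integral>\<^sup>+t. ennreal (exp (- s * \<bar>t\<bar>)) \<partial>lborel) \<le>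
     (\<integral>\<^sup>+t. ennreal (exp (- s * t)) * indicator {0..} t + ennreal (exp (- s * (0 + - 1 * t))) * indicator {0..} (0 + - 1 * t) \<partial>lborel)"
    by (intro nn_integral_mono) (auto simp: indicator_def)
  also have "\<dots> = (\<integral>\<^sup>+t. ennreal (exp (- s * t)) * indicator {0..} t \<partial>lborel) + (\<integral>\<^sup>+t. ennreal (exp (- s * (0 + - 1 * t))) * indicator {0..} (0 + - 1 * t) \<partial>lborel)"
    by (rule nn_integral_add) (use f_meas measurable_compose[OF _ f_meas, of "\<lambda>t. 0 + - 1 * t" borel] in simp_all)
  also have "(\<integral>\<^sup>+t. ennreal (exp (- s * (0 + - 1 * t))) * indicator {0..} (0 + - 1 * t) \<partial>lborel) = (\<integral>\<^sup>+t. ennreal (exp (- s * t)) * indicator {0..} t \<partial>lborel)"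
    using nn_integral_real_affine[OF f_meas, of "-1" 0] by simp
  also have "(\<integral>\<^sup>+t. ennreal (exp (- s * t)) * indicator {0..} t \<partial>lborel) + (\<integral>\<^sup>+t. ennreal (exp (- s * t)) * indicator {0..} t \<partial>lborel) = ennreal (2 / s)"
    unfolding half using s by (subst ennreal_plus[symmetric]) auto
  finally show ?thesis .
qed

context unconditional_body
begin

definition abs_mean :: "nat \<Rightarrow> real" where
  "abs_mean i = (\<integral>x. \<bar>x i\<bar> \<partial>P)"

lemma integrable_coord: "i < n \<Longrightarrow> integrable P (\<lambda>x. x i)" "i < n \<Longrightarrow> integrable P (\<lambda>x. \<bar>x i\<bar>)"
  using bounded_K by (auto intro!: integrable_bounded[where B = R])

lemma integral_coord: "i < n \<Longrightarrow> (\<integral>x. x i \<partial>P) = 0"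
  using integral_flip[of i "\<lambda>x. x i"] by simp

text \<open>
  Since the uniform density on \<open>K\<close> is at most \<open>1\<close>, \<open>E exp (-2e \<Sum>\<^sub>i |x\<^sub>i|) \<le> e\<^bsup>-n\<^esup>\<close>; now use Jensen's inequality.
\<close>

lemma sum_abs_mean_ge: "real n / (2 * exp 1) \<le> (\<Sum>i<n. abs_mean i)"
proof -
  \<comment> \<open>The integral of exp (-s |t|) over the line is 2/s, so this choice makes each of
    the n factors 1/e.\<close>
  define s :: real where "s = 2 * exp 1"
  have s: "0 < s" by (simp add: s_def)
  define N where "N x = (\<Sum>i<n. \<bar>x i\<bar>)" for x :: "nat \<Rightarrow> real"
  define \<mu> where "\<mu> = (\<Sum>i<n. abs_mean i)"
  have N_meas [measurable]: "N \<in> borel_measurable M" unfolding N_def by measurable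
  have N_int: "integrable P N" unfolding N_def by (intro Bochner_Integration.integrable_sum integrable_coord) auto
  have N_mean: "(\<integral>x. N x \<partial>P) = \<mu>"
    unfolding N_def \<mu>_def abs_mean_def by (intro Bochner_Integration.integral_sum integrable_coord) auto
  have exp_int: "integrable P (\<lambda>x. exp (- s * N x))"
  proof (rule integrable_bounded)
    show "(\<lambda>x. exp (- s * N x)) \<in> borel_measurable M" by measurable
    show "\<bar>exp (- s * N x)\<bar> \<le> 1" for x using s by (simp add: N_def sum_nonneg)
  qed
  \<comment> \<open>Jensen's inequality through the tangent line of the exponential at the mean
    \<open>\<mu>\<close>.\<close>
  have "exp (- s * \<mu>) = (\<integral>x. exp (- s * \<mu>) * (1 - s * (N x - \<mu>)) \<partial>P)"
    using N_int N_mean by simp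
  also have "\<dots> \<le> (\<integral>x. exp (- s * N x) \<partial>P)"
  proof (rule integral_mono[OF _ exp_int])
    show "integrable P (\<lambda>x. exp (- s * \<mu>) * (1 - s * (N x - \<mu>)))"
      using N_int by (intro integrable_mult_right Bochner_Integration.integrable_diff) auto
    fix x
    have "1 - s * (N x - \<mu>) \<le> exp (- (s * (N x - \<mu>)))"
      using exp_ge_add_one_self[of "- (s * (N x - \<mu>))"] by simp
    then have "exp (- s * \<mu>) * (1 - s * (N x - \<mu>)) \<le> exp (- s * \<mu>) * exp (- (s * (N x - \<mu>)))"
      by (intro mult_left_mono) auto
    also have "\<dots> = exp (- s * N x)" by (simp add: exp_add[symmetric] algebra_simps)
    finally show "exp (- s * \<mu>) * (1 - s * (N x - \<mu>)) \<le> exp (- s * N x)" .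
  qed
  finally have 1: "exp (- s * \<mu>) \<le> (\<integral>x. exp (- s * N x) \<partial>P)" .
  have "ennreal (\<integral>x. exp (- s * N x) \<partial>P) = (\<integral>\<^sup>+x. ennreal (exp (- s * N x)) \<partial>P)"
    by (rule nn_integral_eq_integral[symmetric, OF exp_int]) simp
  also have "\<dots> = (\<integral>\<^sup>+x. indicator K x * ennreal (exp (- s * N x)) \<partial>M)"
    by (rule nn_integral_P) measurable
  also have "\<dots> \<le> (\<integral>\<^sup>+x. (\<Prod>i<n. ennreal (exp (- s * \<bar>x i\<bar>))) \<partial>M)"
  proof (rule nn_integral_mono)
    fix x
    have "(\<Prod>i<n. ennreal (exp (- s * \<bar>x i\<bar>))) = ennreal (exp (- s * N x))"
      by (subst prod_ennreal) (auto simp: N_def exp_sum[symmetric] sum_distrib_left)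
    then show "indicator K x * ennreal (exp (- s * N x)) \<le> (\<Prod>i<n. ennreal (exp (- s * \<bar>x i\<bar>)))"
      by (simp add: indicator_def)
  qed
  also have "\<dots> = (\<Prod>i<n. (\<integral>\<^sup>+t. ennreal (exp (- s * \<bar>t\<bar>)) \<partial>lborel))"
    by (rule lborel_prod.product_nn_integral_prod) auto
  also have "\<dots> \<le> (\<Prod>i<n. ennreal (2 / s))"
    by (intro prod_mono_ennreal nn_integral_exp_abs_le s)
  also have "\<dots> = ennreal (exp (- real n))"
  proof -
    have "2 / s = exp (- 1)" by (simp add: s_def exp_minus inverse_eq_divide)
    then have "(2 / s) ^ n = exp (- real n)" by (simp add: exp_of_nat_mult[symmetric])
    then show ?thesis using s by (simp add: ennreal_power)
  qed
  finally have "(\<integral>x. exp (- s * N x) \<partial>P) \<le> exp (- real n)" by (simp only: ennreal_le_iff exp_ge_zero)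
  with 1 have "exp (- s * \<mu>) \<le> exp (- real n)" by (rule order.trans)
  then have "real n \<le> s * \<mu>" by simp
  then show ?thesis using s by (simp add: s_def \<mu>_def divide_le_eq mult.commute)
qed

text \<open>Averaging the bound of \<open>Zq_norm_ge\<close> over \<open>y\<close> replaces |y_i| by
  its mean, so squares of the means appear; Cauchy-Schwarz reduces them to the sum already
  bounded.\<close>

lemma sum_abs_mean_sq_ge:
  assumes "0 < n"
  shows "real n / (4 * (exp 1)\<^sup>2) \<le> (\<Sum>i<n. (abs_mean i)\<^sup>2)"
proof -
  have "(real n / (2 * exp 1))\<^sup>2 \<le> (\<Sum>i<n. abs_mean i)\<^sup>2"
    by (intro power_mono sum_abs_mean_ge) simp
  also have "\<dots> \<le> real n * (\<Sum>i<n. (abs_mean i)\<^sup>2)"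
    using Cauchy_Schwarz_ineq_sum[of "\<lambda>_. 1" abs_mean "{..<n}"] by simp
  finally have "real n * (real n / (4 * (exp 1)\<^sup>2)) \<le> real n * (\<Sum>i<n. (abs_mean i)\<^sup>2)"
    by (simp add: power_divide power_mult_distrib power2_eq_square)
  then show ?thesis by (rule mult_left_le_imp_le) (simp add: assms)
qed

text \<open>The coordinate signs behave like independent symmetric signs. Reflecting coordinate
  \<open>k\<close> shows that the term with \<open>sgn (x k)\<close> integrates to 0, so each factor
  contributes only \<open>a k\<close>.\<close>

lemma integral_sgn_prod:
  fixes \<Psi> :: "(nat \<Rightarrow> real) \<Rightarrow> real"
  assumes "finite J" "J \<subseteq> {..<n}" and \<Psi>: "\<Psi> \<in> borel_measurable M" "\<And>x. x \<in> K \<Longrightarrow> \<bar>\<Psi> x\<bar> \<le> B"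
    and inv: "\<And>k x. k \<in> J \<Longrightarrow> \<Psi> (x(k := - x k)) = \<Psi> x"
  shows "(\<integral>x. \<Psi> x * (\<Prod>i\<in>J. a i + b i * sgn (x i)) \<partial>P) = (\<Prod>i\<in>J. a i) * (\<integral>x. \<Psi> x \<partial>P)"
  using assms(1,2) inv
proof (induction J rule: finite_induct)
  case (insert k J)
  define \<Phi> where "\<Phi> x = \<Psi> x * (\<Prod>i\<in>J. a i + b i * sgn (x i))" for x
  have k: "k < n" "J \<subseteq> {..<n}" using insert by auto
  have prod_meas: "(\<lambda>x. \<Prod>i\<in>J. a i + b i * sgn (x i)) \<in> borel_measurable M"
    using k by (intro borel_measurable_prod borel_measurable_add borel_measurable_times borel_measurable_const borel_measurable_sgn measurable_coord) auto
  have \<Phi>_meas: "\<Phi> \<in> borel_measurable M"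
    unfolding \<Phi>_def using \<Psi>(1) prod_meas by (rule borel_measurable_times)
  have \<Phi>_bd: "\<bar>\<Phi> x\<bar> \<le> B * (\<Prod>i\<in>J. \<bar>a i\<bar> + \<bar>b i\<bar>)" if "x \<in> K" for x
  proof -
    have "\<bar>\<Phi> x\<bar> = \<bar>\<Psi> x\<bar> * (\<Prod>i\<in>J. \<bar>a i + b i * sgn (x i)\<bar>)" by (simp add: \<Phi>_def abs_mult abs_prod)
    also have "\<dots> \<le> B * (\<Prod>i\<in>J. \<bar>a i\<bar> + \<bar>b i\<bar>)"
    proof (intro mult_mono \<Psi>(2) that prod_mono)
      show "0 \<le> B" using \<Psi>(2)[OF that] by linarith
      fix i
      have "\<bar>a i + b i * sgn (x i)\<bar> \<le> \<bar>a i\<bar> + \<bar>b i\<bar> * \<bar>sgn (x i)\<bar>"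
        by (metis abs_mult abs_triangle_ineq)
      also have "\<dots> \<le> \<bar>a i\<bar> + \<bar>b i\<bar>" by (simp add: abs_sgn_eq)
      finally show "0 \<le> \<bar>a i + b i * sgn (x i)\<bar> \<and> \<bar>a i + b i * sgn (x i)\<bar> \<le> \<bar>a i\<bar> + \<bar>b i\<bar>" by simp
    qed (auto intro!: prod_nonneg)
    finally show ?thesis .
  qed
  have \<Phi>_sgn_meas: "(\<lambda>x. \<Phi> x * sgn (x k)) \<in> borel_measurable M"
    by (rule borel_measurable_times[OF \<Phi>_meas measurable_compose[OF measurable_coord[OF k(1)] borel_measurable_sgn]])
  have \<Phi>_int: "integrable P \<Phi>" by (rule integrable_bounded[OF \<Phi>_meas \<Phi>_bd])
  have sgn_int: "integrable P (\<lambda>x. \<Phi> x * sgn (x k))"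
  proof (rule integrable_bounded)
    show "(\<lambda>x. \<Phi> x * sgn (x k)) \<in> borel_measurable M" by (rule \<Phi>_sgn_meas)
    fix x assume "x \<in> K"
    have "\<bar>\<Phi> x * sgn (x k)\<bar> \<le> \<bar>\<Phi> x\<bar>" by (simp add: abs_mult abs_sgn_eq)
    also note \<Phi>_bd[OF \<open>x \<in> K\<close>]
    finally show "\<bar>\<Phi> x * sgn (x k)\<bar> \<le> B * (\<Prod>i\<in>J. \<bar>a i\<bar> + \<bar>b i\<bar>)" .
  qed
  have "(\<integral>x. \<Phi> x * sgn (x k) \<partial>P) = (\<integral>x. \<Phi> (x(k := - x k)) * sgn ((x(k := - x k)) k) \<partial>P)"
    by (rule integral_flip[OF k(1) \<Phi>_sgn_meas, symmetric])
  also have "\<dots> = (\<integral>x. - (\<Phi> x * sgn (x k)) \<partial>P)"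
  proof -
    have "\<Phi> (x(k := - x k)) = \<Phi> x" for x
    proof -
      have "(\<Prod>i\<in>J. a i + b i * sgn ((x(k := - x k)) i)) = (\<Prod>i\<in>J. a i + b i * sgn (x i))"
        using insert.hyps by (intro prod.cong) auto
      then show ?thesis unfolding \<Phi>_def by (simp only: insert.prems(2)[OF insertI1])
    qed
    then show ?thesis by (simp add: sgn_minus)
  qed
  finally have sgn0: "(\<integral>x. \<Phi> x * sgn (x k) \<partial>P) = 0" by simp
  have "(\<integral>x. \<Psi> x * (\<Prod>i\<in>insert k J. a i + b i * sgn (x i)) \<partial>P) = (\<integral>x. a k * \<Phi> x + b k * (\<Phi> x * sgn (x k)) \<partial>P)"
    using insert.hyps by (intro Bochner_Integration.integral_cong) (auto simp: \<Phi>_def algebra_simps)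
  also have "\<dots> = a k * (\<integral>x. \<Phi> x \<partial>P) + b k * (\<integral>x. \<Phi> x * sgn (x k) \<partial>P)"
    using \<Phi>_int sgn_int by simp
  also have "\<dots> = (\<Prod>i\<in>insert k J. a i) * (\<integral>x. \<Psi> x \<partial>P)"
    using insert unfolding sgn0 by (simp add: \<Phi>_def)
  finally show ?case .
qed simp

text \<open>
  Test the functional \<open>\<langle>\<cdot>, y\<rangle>\<close> against the weight \<open>w = \<Prod>\<^sub>i (1 + \<delta> sgn y\<^sub>i sgn x\<^sub>i)\<close> with
  \<open>\<delta>\<^sup>2 = q / n\<close>: then \<open>E w = 1\<close>, \<open>E w\<^sup>2 \<le> e\<^sup>q\<close> and \<open>E w \<langle>x, y\<rangle> = \<delta> \<Sum>\<^sub>i |y\<^sub>i| E|x\<^sub>i|\<close>.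
\<close>

lemma Zq_norm_ge:
  assumes q: "2 \<le> q" "q \<le> real n"
  shows "sqrt (q / real n) * (\<Sum>i<n. \<bar>y i\<bar> * abs_mean i) \<le> 2 * exp 1 * Zq_norm q y"
proof -
  have n: "0 < real n" using q by simp
  define \<delta> where "\<delta> = sqrt (q / real n)"
  \<comment> \<open>\<open>\<delta> \<le> 1\<close>, from \<open>q \<le> n\<close>, keeps every
    factor of \<open>w\<close> nonnegative.\<close>
  have \<delta>: "0 \<le> \<delta>" "\<delta> \<le> 1" "\<delta>\<^sup>2 = q / real n" using q n by (auto simp: \<delta>_def)
  define b where "b i = \<delta> * sgn (y i)" for i
  define w where "w x = (\<Prod>i<n. 1 + b i * sgn (x i))" for x :: "nat \<Rightarrow> real"
  have b: "\<bar>b i * sgn t\<bar> \<le> 1" for i t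
    using \<delta> by (simp add: b_def abs_mult abs_sgn_eq)
  have w_meas [measurable]: "w \<in> borel_measurable M"
    unfolding w_def by (intro borel_measurable_prod borel_measurable_add borel_measurable_times borel_measurable_const borel_measurable_sgn measurable_coord) auto
  have w_bd: "0 \<le> w x" "w x \<le> 2 ^ n" for x
  proof -
    have f: "0 \<le> 1 + b i * sgn (x i)" "1 + b i * sgn (x i) \<le> 2" for i using b[of i "x i"] by linarith+
    show "0 \<le> w x" unfolding w_def by (intro prod_nonneg f)
    have "w x \<le> (\<Prod>i<n. 2)" unfolding w_def by (intro prod_mono conjI f)
    then show "w x \<le> 2 ^ n" by simp
  qed
  have w_int: "integrable P w" using w_bd by (intro integrable_bounded[where B = "2 ^ n"]) auto
  have w2_int: "integrable P (\<lambda>x. (w x)\<^sup>2)"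
    using w_bd by (intro integrable_bounded[where B = "(2 ^ n)\<^sup>2"]) (auto intro!: power_mono)
  have w_mean: "(\<integral>x. w x \<partial>P) = 1"
    using integral_sgn_prod[of "{..<n}" "\<lambda>_. 1" 1 "\<lambda>_. 1" b] by (simp add: w_def)
  have w2: "(\<integral>x. (w x)\<^sup>2 \<partial>P) \<le> exp q"
  proof -
    have "(\<integral>x. (w x)\<^sup>2 \<partial>P) \<le> (\<integral>x. 1 * (\<Prod>i<n. (1 + \<delta>\<^sup>2) + 2 * b i * sgn (x i)) \<partial>P)"
    proof (rule integral_mono[OF w2_int])
      \<comment> \<open>Squaring a factor leaves it affine in the sign, up to an inequality at
        \<open>sgn = 0\<close>, so \<open>integral_sgn_prod\<close> applies and gives (1 + q/n)^n <=
        e^q.\<close>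
      have *: "(1 + b i * sgn t)\<^sup>2 \<le> (1 + \<delta>\<^sup>2) + 2 * b i * sgn t" for i t
      proof -
        have "(b i * sgn t)\<^sup>2 \<le> \<delta>\<^sup>2"
          unfolding power2_abs[of "b i * sgn t", symmetric] using \<delta>
          by (intro power_mono) (auto simp: b_def abs_mult abs_sgn_eq)
        then show ?thesis by (simp add: power2_sum)
      qed
      show "(w x)\<^sup>2 \<le> 1 * (\<Prod>i<n. (1 + \<delta>\<^sup>2) + 2 * b i * sgn (x i))" for x
        unfolding w_def prod_power_distrib mult_1 by (intro prod_mono) (use * in auto)
      show "integrable P (\<lambda>x. 1 * (\<Prod>i<n. (1 + \<delta>\<^sup>2) + 2 * b i * sgn (x i)))"
      proof (rule integrable_bounded)
        show "(\<lambda>x. 1 * (\<Prod>i<n. (1 + \<delta>\<^sup>2) + 2 * b i * sgn (x i))) \<in> borel_measurable M"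
          by (intro borel_measurable_prod borel_measurable_add borel_measurable_times borel_measurable_const borel_measurable_sgn measurable_coord) auto
        fix x :: "nat \<Rightarrow> real"
        have "\<bar>(1 + \<delta>\<^sup>2) + 2 * b i * sgn (x i)\<bar> \<le> 3 + \<delta>\<^sup>2" for i
          using b[of i "x i"] zero_le_power2[of \<delta>] unfolding abs_le_iff mult.assoc by linarith
        then show "\<bar>1 * (\<Prod>i<n. (1 + \<delta>\<^sup>2) + 2 * b i * sgn (x i))\<bar> \<le> (\<Prod>i<n. 3 + \<delta>\<^sup>2)"
          unfolding mult_1 abs_prod by (intro prod_mono) auto
      qed
    qed
    also have "\<dots> = (\<Prod>i<n. 1 + \<delta>\<^sup>2) * (\<integral>x. 1 \<partial>P)"
      by (rule integral_sgn_prod[where B = 1]) auto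
    also have "\<dots> = (1 + \<delta>\<^sup>2) ^ n" by simp
    also have "\<dots> \<le> exp (\<delta>\<^sup>2) ^ n"
      using exp_ge_add_one_self[of "\<delta>\<^sup>2"] by (intro power_mono) auto
    also have "\<dots> = exp q" using \<delta> n by (simp add: exp_of_nat_mult[symmetric])
    finally show ?thesis .
  qed
  have w_coord: "(\<integral>x. w x * x j \<partial>P) = b j * abs_mean j" and w_coord_int: "integrable P (\<lambda>x. w x * x j)" if j: "j < n" for j
  proof -
    show "integrable P (\<lambda>x. w x * x j)"
      using w_bd j bounded_K by (intro integrable_bounded[where B = "2 ^ n * R"]) (auto simp: abs_mult intro!: mult_mono)
    \<comment> \<open>Factor \<open>j\<close> of the weight times \<open>x j\<close>; it is
      unaffected by the reflections of the other coordinates, whose factors therefore integrate to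
      1.\<close>
    define \<Psi> where "\<Psi> x = x j + b j * \<bar>x j\<bar>" for x :: "nat \<Rightarrow> real"
    have "(\<integral>x. w x * x j \<partial>P) = (\<integral>x. \<Psi> x * (\<Prod>i\<in>{..<n} - {j}. 1 + b i * sgn (x i)) \<partial>P)"
    proof (rule Bochner_Integration.integral_cong[OF refl])
      fix x
      have "w x = (1 + b j * sgn (x j)) * (\<Prod>i\<in>{..<n} - {j}. 1 + b i * sgn (x i))"
        unfolding w_def using j by (simp add: prod.remove)
      moreover have "(1 + b j * sgn (x j)) * x j = \<Psi> x"
        by (simp add: \<Psi>_def abs_sgn algebra_simps)
      ultimately show "w x * x j = \<Psi> x * (\<Prod>i\<in>{..<n} - {j}. 1 + b i * sgn (x i))"
        by (simp add: mult_ac)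
    qed
    also have "\<dots> = (\<Prod>i\<in>{..<n} - {j}. 1) * (\<integral>x. \<Psi> x \<partial>P)"
    proof (rule integral_sgn_prod)
      show "\<Psi> \<in> borel_measurable M" unfolding \<Psi>_def using j by measurable
      fix x assume "x \<in> K"
      then have "\<bar>x j\<bar> \<le> R" using bounded_K j by simp
      then have "\<bar>b j * \<bar>x j\<bar>\<bar> \<le> \<bar>b j\<bar> * R" by (simp add: abs_mult mult_left_mono)
      then show "\<bar>\<Psi> x\<bar> \<le> R + \<bar>b j\<bar> * R" using \<open>\<bar>x j\<bar> \<le> R\<close> unfolding \<Psi>_def by linarith
    qed (auto simp: \<Psi>_def)
    also have "\<dots> = b j * abs_mean j"
      using integrable_coord[OF j] integral_coord[OF j] by (simp add: \<Psi>_def abs_mean_def)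
    finally show "(\<integral>x. w x * x j \<partial>P) = b j * abs_mean j" .
  qed
  define S where "S = (\<Sum>i<n. \<bar>y i\<bar> * abs_mean i)"
  have S: "(\<integral>x. w x * dot n x y \<partial>P) = \<delta> * S"
  proof -
    have "(\<integral>x. w x * dot n x y \<partial>P) = (\<integral>x. (\<Sum>i<n. y i * (w x * x i)) \<partial>P)"
      by (simp add: dot_def sum_distrib_left mult_ac)
    also have "\<dots> = (\<Sum>i<n. y i * (b i * abs_mean i))"
      using w_coord w_coord_int by (subst Bochner_Integration.integral_sum) auto
    also have "\<dots> = \<delta> * S"
      by (simp add: S_def sum_distrib_left b_def abs_sgn mult_ac)
    finally show ?thesis .
  qed
  have dot_int: "integrable P (\<lambda>x. w x * dot n x y)"
  proof (rule integrable_bounded)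
    fix x assume "x \<in> K"
    then show "\<bar>w x * dot n x y\<bar> \<le> 2 ^ n * (\<Sum>i<n. R * \<bar>y i\<bar>)"
      unfolding abs_mult using w_bd[of x] by (intro mult_mono dot_abs_le) auto
  qed measurable
  \<comment> \<open>A strict upper bound \<open>H\<close> of the norm is positive even if the norm
    is 0; \<open>dense_ge\<close> lets \<open>H\<close> decrease to it.\<close>
  have "\<delta> * S \<le> 2 * exp 1 * H" if H: "Zq_norm q y < H" for H
  proof -
    have H0: "0 < H" using H Zq_norm_nonneg[of q y] by linarith
    \<comment> \<open>The scale e H gives E u^q <= e^(-q) for u = |<x, y>| / l. The weight T = e^q
      then balances both terms of the estimate: E w^2 / T and T E u^q are at most 1.\<close>
    define l where "l = exp 1 * H"
    have l: "0 < l" using H0 by (simp add: l_def)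
    define T where "T = exp q"
    define X where "X x = \<bar>dot n x y\<bar>" for x
    have Xq: "(\<integral>x. X x powr q \<partial>P) \<le> H powr q"
    proof -
      have "(\<integral>x. X x powr q \<partial>P) = Zq_norm q y powr q"
        using q by (simp add: Zq_norm_def powr_powr X_def)
      also have "\<dots> \<le> H powr q" using H q Zq_norm_nonneg by (intro powr_mono2) auto
      finally show ?thesis .
    qed
    have "\<delta> * S = (\<integral>x. w x * dot n x y \<partial>P)" by (rule S[symmetric])
    also have "\<dots> \<le> (\<integral>x. l * w x + l / 2 * ((w x)\<^sup>2 / T + T / l powr q * X x powr q) \<partial>P)"
    proof (rule integral_mono[OF dot_int])
      show "integrable P (\<lambda>x. l * w x + l / 2 * ((w x)\<^sup>2 / T + T / l powr q * X x powr q))"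
        unfolding X_def using q
        by (intro Bochner_Integration.integrable_add integrable_mult_right integrable_divide integrable_dot_powr w_int w2_int) auto
      fix x
      define u where "u = X x / l"
      have u: "0 \<le> u" "X x = l * u" using l by (auto simp: u_def X_def)
      \<comment> \<open>Below 1 the bound E w = 1 suffices; above 1, \<open>q \<ge> 2\<close> allows
        the power q/2, the one that pairs with the second moment of \<open>w\<close>.\<close>
      have "u \<le> 1 + u powr (q / 2)"
      proof (cases "u \<le> 1")
        case True then show ?thesis by (simp add: add_increasing2)
      next
        case False
        then have "u powr 1 \<le> u powr (q / 2)" using q by (intro powr_mono) auto
        then show ?thesis using False by simp
      qed
      then have "w x * u \<le> w x + w x * u powr (q / 2)"
        using mult_left_mono[OF _ w_bd(1), of u "1 + u powr (q / 2)" x] by (simp add: distrib_left)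
      also have "w x * u powr (q / 2) \<le> 1 / 2 * ((w x)\<^sup>2 / T + T * u powr q)"
      proof -
        have "0 \<le> (w x / sqrt T - sqrt T * u powr (q / 2))\<^sup>2" by simp
        also have "\<dots> = (w x)\<^sup>2 / T + T * u powr q - 2 * (w x * u powr (q / 2))"
        proof -
          have T: "0 < sqrt T" "(sqrt T)\<^sup>2 = T" by (auto simp: T_def)
          have "(u powr (q / 2))\<^sup>2 = u powr q" by (simp add: power2_eq_square powr_add[symmetric])
          then show ?thesis using T by (simp add: power2_diff power_divide power_mult_distrib)
        qed
        finally show ?thesis by simp
      qed
      finally have *: "w x * u \<le> w x + 1 / 2 * ((w x)\<^sup>2 / T + T * u powr q)" by simp
      have "w x * dot n x y \<le> w x * X x" using w_bd by (intro mult_left_mono) (auto simp: X_def)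
      also have "\<dots> = l * (w x * u)" by (simp add: u)
      also have "\<dots> \<le> l * (w x + 1 / 2 * ((w x)\<^sup>2 / T + T * u powr q))"
        using * l by (intro mult_left_mono) auto
      also have "u powr q = X x powr q / l powr q" using l by (simp add: u_def powr_divide X_def)
      finally show "w x * dot n x y \<le> l * w x + l / 2 * ((w x)\<^sup>2 / T + T / l powr q * X x powr q)"
        by (simp add: algebra_simps)
    qed
    also have "\<dots> = l + l / 2 * ((\<integral>x. (w x)\<^sup>2 \<partial>P) / T + T / l powr q * (\<integral>x. X x powr q \<partial>P))"
      using w_int w2_int q w_mean unfolding X_def by (simp add: integrable_dot_powr)
    also have "\<dots> \<le> l + l / 2 * (1 + 1)"
    proof -
      have 1: "(\<integral>x. (w x)\<^sup>2 \<partial>P) / T \<le> 1" using w2 by (simp add: T_def)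
      have "T / l powr q * (\<integral>x. X x powr q \<partial>P) \<le> T / l powr q * H powr q"
        using Xq by (intro mult_left_mono) (auto simp: T_def)
      also have "T / l powr q * H powr q = 1"
        using H0 by (simp add: l_def T_def powr_mult exp_powr_real)
      finally show ?thesis using 1 l by (intro add_left_mono mult_left_mono add_mono) simp_all
    qed
    also have "\<dots> = 2 * exp 1 * H" by (simp add: l_def)
    finally show ?thesis .
  qed
  then have "\<delta> * S / (2 * exp 1) \<le> H" if "Zq_norm q y < H" for H
    using that by (simp add: divide_le_eq mult_ac)
  then have "\<delta> * S / (2 * exp 1) \<le> Zq_norm q y" by (rule dense_ge)
  then show ?thesis by (simp add: divide_le_eq \<delta>_def S_def mult_ac)
qed

text \<open>The factor 1/(2e) comes from \<open>Zq_norm_ge\<close> and 1/(4 e^2) from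
  \<open>sum_abs_mean_sq_ge\<close>; sqrt (q/n) n is sqrt (q n).\<close>

lemma integral_Zq_norm_ge:
  assumes L: "0 < L" "\<And>i. i < n \<Longrightarrow> (\<integral>x. (x i)\<^sup>2 \<partial>P) = L\<^sup>2" and q: "2 \<le> q" "q \<le> real n"
  shows "1 / (8 * (exp 1) ^ 3) * sqrt (q * real n) \<le> (\<integral>y. Zq_norm q y \<partial>P)"
proof -
  have n: "0 < real n" using q by simp
  have "sqrt (q * real n) = sqrt (q / real n) * real n"
    using n real_div_sqrt[of "real n"] by (simp add: real_sqrt_mult real_sqrt_divide flip: times_divide_eq_right)
  then have "1 / (8 * (exp 1) ^ 3) * sqrt (q * real n) = sqrt (q / real n) * (real n / (4 * (exp 1)\<^sup>2)) / (2 * exp 1)"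
    by (simp add: power2_eq_square power3_eq_cube)
  also have "\<dots> \<le> sqrt (q / real n) * (\<Sum>i<n. (abs_mean i)\<^sup>2) / (2 * exp 1)"
    using n q by (intro divide_right_mono mult_left_mono sum_abs_mean_sq_ge) auto
  also have "\<dots> = (\<integral>y. sqrt (q / real n) * (\<Sum>i<n. \<bar>y i\<bar> * abs_mean i) / (2 * exp 1) \<partial>P)"
    using integrable_coord by (simp add: power2_eq_square abs_mean_def[symmetric])
  also have "\<dots> \<le> (\<integral>y. Zq_norm q y \<partial>P)"
  proof (rule integral_mono[OF _ integrable_Zq_norm[OF L q]])
    show "integrable P (\<lambda>y. sqrt (q / real n) * (\<Sum>i<n. \<bar>y i\<bar> * abs_mean i) / (2 * exp 1))"
      using integrable_coord by (intro integrable_divide integrable_mult_right integrable_mult_left Bochner_Integration.integrable_sum) auto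
    show "sqrt (q / real n) * (\<Sum>i<n. \<bar>y i\<bar> * abs_mean i) / (2 * exp 1) \<le> Zq_norm q y" for y
      using Zq_norm_ge[OF q, of y] by (simp add: divide_le_eq mult_ac)
  qed
  finally show ?thesis .
qed

end

section \<open>The support function of the centroid body\<close>

text \<open>
  By Hoelder's inequality the gradient of \<open>h\<close> at \<open>y\<close> lies in the body and attains the supremum.
\<close>

lemma support_fun_moment_body:
  fixes h :: "(nat \<Rightarrow> real) \<Rightarrow> real"
  assumes "finite_measure \<nu>" and sets_\<nu>: "sets \<nu> = sets (Rn_leb n)"
    and bd: "AE x in \<nu>. \<forall>i<n. \<bar>x i\<bar> \<le> R" and q: "1 < q" and y: "y \<in> Rn n"
    and h: "\<And>y. h y = (\<integral>x. \<bar>dot n x y\<bar> powr q \<partial>\<nu>) powr (1 / q)"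
  shows "support_fun n {z \<in> Rn n. \<forall>y\<in>Rn n. dot n z y \<le> h y} y = h y"
proof -
  interpret finite_measure \<nu> by fact
  let ?Z = "{z \<in> Rn n. \<forall>y\<in>Rn n. dot n z y \<le> h y}"
  have meas: "measurable \<nu> N = measurable (Rn_leb n) N" for N :: "real measure"
    by (rule measurable_cong_sets) (simp_all add: sets_\<nu>)
  have h_nonneg: "0 \<le> h v" for v by (simp add: h)
  have dot_bd: "AE x in \<nu>. \<bar>dot n x v\<bar> \<le> (\<Sum>i<n. R * \<bar>v i\<bar>)" for v
    using bd
  proof eventually_elim
    case (elim x)
    have "\<bar>dot n x v\<bar> \<le> (\<Sum>i<n. \<bar>x i * v i\<bar>)" unfolding dot_def by (rule sum_abs)
    also have "\<dots> \<le> (\<Sum>i<n. R * \<bar>v i\<bar>)"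
      using elim by (intro sum_mono) (auto simp: abs_mult intro!: mult_right_mono)
    finally show ?case .
  qed
  have dot_meas: "(\<lambda>x. dot n x v) \<in> borel_measurable \<nu>" for v unfolding meas by measurable
  have powr_meas: "(\<lambda>x. \<bar>dot n x v\<bar> powr p) \<in> borel_measurable \<nu>" for v p using dot_meas[of v] by measurable
  have powr_bd: "AE x in \<nu>. \<bar>dot n x v\<bar> powr p \<le> (\<Sum>i<n. R * \<bar>v i\<bar>) powr p" if "0 \<le> p" for v p
    using dot_bd[of v] by eventually_elim (use that in \<open>auto intro!: powr_mono2\<close>)
  have powr_int: "integrable \<nu> (\<lambda>x. \<bar>dot n x v\<bar> powr p)" if "0 \<le> p" for v p
    using powr_bd[OF that, of v] powr_meas by (intro integrable_const_bound[where B = "(\<Sum>i<n. R * \<bar>v i\<bar>) powr p"]) auto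
  have hq: "(\<integral>x. \<bar>dot n x v\<bar> powr q \<partial>\<nu>) = h v powr q" for v
    using q by (simp add: h powr_powr)
  have zero: "(\<lambda>i\<in>{..<n}. 0) \<in> ?Z" by (auto simp: dot_def h_nonneg)
  have "\<exists>z\<in>?Z. dot n z y = h y"
  proof (cases "h y = 0")
    case True
    then show ?thesis using zero by (intro bexI[OF _ zero]) (simp add: dot_def)
  next
    case False
    define H where "H = h y"
    have H: "0 < H" using False h_nonneg[of y] by (simp add: H_def)
    \<comment> \<open>The extremal function of Hoelder's inequality for \<open>y\<close>; the vector
      \<open>z\<close> of its moments is the gradient of \<open>h\<close> at
      \<open>y\<close>.\<close>
    define w where "w x = (\<bar>dot n x y\<bar> / H) powr (q - 1) * sgn (dot n x y)" for x
    define B where "B = ((\<Sum>i<n. R * \<bar>y i\<bar>) / H) powr (q - 1)"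
    have w_meas: "w \<in> borel_measurable \<nu>"
      unfolding w_def using dot_meas[of y] measurable_compose[OF dot_meas[of y] borel_measurable_sgn] by measurable
    have w_bd: "AE x in \<nu>. \<bar>w x\<bar> \<le> B"
      using dot_bd[of y]
    proof eventually_elim
      case (elim x)
      have "\<bar>w x\<bar> \<le> (\<bar>dot n x y\<bar> / H) powr (q - 1)" by (simp add: w_def abs_mult abs_sgn_eq)
      also have "\<dots> \<le> B" unfolding B_def using elim H q by (intro powr_mono2 divide_right_mono) auto
      finally show ?case .
    qed
    have w_int: "integrable \<nu> (\<lambda>x. w x * x i)" if "i < n" for i
    proof (rule integrable_const_bound)
      have "(\<lambda>x. x i) \<in> borel_measurable \<nu>" unfolding meas using that by (rule measurable_coord)
      with w_meas show "(\<lambda>x. w x * x i) \<in> borel_measurable \<nu>" by (rule borel_measurable_times)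
      show "AE x in \<nu>. norm (w x * x i) \<le> B * R"
        using w_bd bd by eventually_elim (use that in \<open>auto simp: abs_mult intro!: mult_mono order.trans[OF abs_ge_zero]\<close>)
    qed
    define z where "z = (\<lambda>i\<in>{..<n}. \<integral>x. w x * x i \<partial>\<nu>)"
    have dot_z: "dot n z v = (\<integral>x. w x * dot n x v \<partial>\<nu>)" and dot_z_int: "integrable \<nu> (\<lambda>x. w x * dot n x v)" for v
    proof -
      have eq: "w x * dot n x v = (\<Sum>i<n. (w x * x i) * v i)" for x
        by (simp add: dot_def sum_distrib_left mult_ac)
      show "integrable \<nu> (\<lambda>x. w x * dot n x v)"
        unfolding eq using w_int by (intro Bochner_Integration.integrable_sum integrable_mult_left) auto
      show "dot n z v = (\<integral>x. w x * dot n x v \<partial>\<nu>)"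
        unfolding eq using w_int by (subst Bochner_Integration.integral_sum) (auto simp: dot_def z_def)
    qed
    have "dot n z v \<le> h v" for v
    proof (rule dense_ge)
      \<comment> \<open>A strict upper bound of \<open>h v\<close> is positive, so \<open>v\<close>
        can be normalised even where \<open>h v = 0\<close>.\<close>
      fix G assume G: "h v < G"
      then have G0: "0 < G" using h_nonneg[of v] by linarith
      define p where "p = q / (q - 1)"
      have p: "1 < p" "1 / p + 1 / q = 1" "(q - 1) * p = q" using q by (auto simp: p_def field_simps)
      have "dot n z v \<le> (\<integral>x. G * (1 / (p * H powr q) * \<bar>dot n x y\<bar> powr q + 1 / (q * G powr q) * \<bar>dot n x v\<bar> powr q) \<partial>\<nu>)"
        unfolding dot_z
      proof (rule integral_mono[OF dot_z_int])
        show "integrable \<nu> (\<lambda>x. G * (1 / (p * H powr q) * \<bar>dot n x y\<bar> powr q + 1 / (q * G powr q) * \<bar>dot n x v\<bar> powr q))"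
          using q by (intro integrable_mult_right Bochner_Integration.integrable_add powr_int) auto
        fix x
        define a where "a = (\<bar>dot n x y\<bar> / H) powr (q - 1)"
        define b where "b = \<bar>dot n x v\<bar> / G"
        have "w x * dot n x v \<le> \<bar>w x\<bar> * \<bar>dot n x v\<bar>" by (metis abs_ge_self abs_mult)
        also have "\<dots> \<le> a * \<bar>dot n x v\<bar>"
          by (intro mult_right_mono) (auto simp: w_def a_def abs_mult abs_sgn_eq)
        also have "\<dots> = G * (a * b)" using G0 by (simp add: b_def)
        \<comment> \<open>Both factors are normalised, so Young's inequality integrates to at most
          1/p + 1/q = 1.\<close>
        also have "a * b \<le> a powr p / p + b powr q / q"
          using p q G0 by (intro Youngs_inequality) (auto simp: a_def b_def)
        also have "a powr p = \<bar>dot n x y\<bar> powr q / H powr q"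
          using H p by (simp add: a_def powr_powr powr_divide)
        also have "b powr q = \<bar>dot n x v\<bar> powr q / G powr q"
          using G0 by (simp add: b_def powr_divide)
        finally show "w x * dot n x v \<le> G * (1 / (p * H powr q) * \<bar>dot n x y\<bar> powr q + 1 / (q * G powr q) * \<bar>dot n x v\<bar> powr q)"
          using G0 by (simp add: mult_left_mono mult_ac)
      qed
      also have "\<dots> = G * (1 / (p * H powr q) * H powr q + 1 / (q * G powr q) * h v powr q)"
        using q by (simp add: powr_int hq H_def)
      also have "\<dots> \<le> G * (1 / p + 1 / q)"
      proof -
        have "h v powr q \<le> G powr q" using G h_nonneg[of v] q by (intro powr_mono2) auto
        then have "1 / (q * G powr q) * h v powr q \<le> 1 / (q * G powr q) * G powr q"
          using q by (intro mult_left_mono) auto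
        then show ?thesis using G0 H by (intro mult_left_mono add_mono) auto
      qed
      finally show "dot n z v \<le> G" using p by simp
    qed
    then have "z \<in> ?Z" by (auto simp: z_def)
    moreover have "dot n z y = h y"
    proof -
      have "w x * dot n x y = \<bar>dot n x y\<bar> powr q / H powr (q - 1)" for x
      proof -
        have "w x * dot n x y = \<bar>dot n x y\<bar> powr (q - 1) * \<bar>dot n x y\<bar> / H powr (q - 1)"
          using H by (simp add: w_def powr_divide abs_sgn mult_ac)
        also have "\<bar>dot n x y\<bar> powr (q - 1) * \<bar>dot n x y\<bar> = \<bar>dot n x y\<bar> powr q"
          using q by (cases "dot n x y = 0") (auto simp: powr_diff)
        finally show ?thesis .
      qed
      then have "dot n z y = H powr q / H powr (q - 1)"
        unfolding dot_z by (simp add: hq H_def)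
      also have "\<dots> = H" using H by (simp add: powr_diff)
      finally show ?thesis by (simp add: H_def)
    qed
    ultimately show ?thesis by blast
  qed
  then obtain z where z: "z \<in> ?Z" "dot n z y = h y" by blast
  have le: "dot n z y \<le> h y" if "z \<in> ?Z" for z using that y by blast
  show ?thesis
    unfolding support_fun_def
  proof (rule antisym)
    show "(SUP z\<in>?Z. dot n z y) \<le> h y" using zero le by (intro cSUP_least) blast+
    have "bdd_above ((\<lambda>z. dot n z y) ` ?Z)" by (rule bdd_aboveI2[where M = "h y"]) (rule le)
    from cSUP_upper[OF z(1) this] show "h y \<le> (SUP z\<in>?Z. dot n z y)" using z(2) by simp
  qed
qed

section \<open>Reduction to coordinate reflections\<close>

lemma compactin_Rn_bounded:
  assumes "compactin (Rn_top n) K"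
  obtains R where "1 \<le> R" "\<And>x i. x \<in> K \<Longrightarrow> i < n \<Longrightarrow> \<bar>x i\<bar> \<le> R"
proof -
  have "\<exists>r. \<forall>x\<in>K. \<bar>x i\<bar> \<le> r" if "i < n" for i
  proof -
    have "compactin euclideanreal ((\<lambda>x. x i) ` K)"
      using assms continuous_map_product_projection[of i "{..<n}" "\<lambda>_. euclideanreal"] that
      by (intro image_compactin) auto
    then have "bounded ((\<lambda>x. x i) ` K)" by (simp add: compactin_euclidean_iff compact_imp_bounded)
    then show ?thesis by (auto simp: bounded_iff)
  qed
  then obtain r where r: "\<And>i x. i < n \<Longrightarrow> x \<in> K \<Longrightarrow> \<bar>x i\<bar> \<le> r i" by metis
  define R where "R = 1 + (\<Sum>i<n. \<bar>r i\<bar>)"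
  show ?thesis
  proof
    show "1 \<le> R" by (simp add: R_def sum_nonneg)
    fix x i assume "x \<in> K" "i < n"
    then have "\<bar>x i\<bar> \<le> \<bar>r i\<bar>" using r[of i x] by linarith
    also have "\<dots> \<le> (\<Sum>i<n. \<bar>r i\<bar>)" using \<open>i < n\<close> by (intro member_le_sum) auto
    finally show "\<bar>x i\<bar> \<le> R" by (simp add: R_def)
  qed
qed

text \<open>This turns the assumed invariance under hyperplane reflections into invariance under
  sign changes of the coordinates.\<close>

lemma comb_flip:
  assumes u: "orthonormal_basis n u" and z: "z \<in> Rn n" and j: "j < n"
  shows "comb n u (z(j := - z j)) = reflect n (u j) (comb n u z)"
proof
  fix i
  have "dot n (comb n u z) (u j) = z j"
    using coords_comb[OF u z] j by (metis coords_def lessThan_iff restrict_apply)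
  moreover have "(\<Sum>k<n. (z(j := - z j)) k * u k i) = (\<Sum>k<n. z k * u k i) - 2 * z j * u j i"
  proof -
    have "(\<Sum>k<n. (z(j := - z j)) k * u k i) = (\<Sum>k<n. z k * u k i - (if k = j then 2 * z j * u j i else 0))"
      by (intro sum.cong) auto
    then show ?thesis using j by (simp add: sum_subtractf)
  qed
  ultimately show "comb n u (z(j := - z j)) i = reflect n (u j) (comb n u z) i"
    by (simp add: comb_def reflect_def)
qed

lemma comb_convex_combination:
  "comb n u (\<lambda>i\<in>{..<n}. (1 - t) * x i + t * y i) = (\<lambda>i\<in>{..<n}. (1 - t) * comb n u x i + t * comb n u y i)"
  by (simp add: comb_def fun_eq_iff sum_distrib_left distrib_right mult.assoc sum.distrib)

text \<open>The body, its uniform law, its second moments and its L_q norms are all carried over to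
  the orthonormal coordinates, where the locale applies.\<close>

lemma I1_Z_polar_bounds:
  assumes K: "convex_body n K" "isotropic n K" "unconditional n K" and q: "2 \<le> q" "q \<le> real n"
  shows "1 / (8 * (exp 1) ^ 3) * sqrt (q * real n) \<le> I1_Z_polar n q K"
    and "I1_Z_polar n q K \<le> 48 * exp 1 * (48 * 9) * sqrt (q * real n) * ln (real n)"
proof -
  let ?M = "Rn_leb n"
  obtain u where u: "orthonormal_basis n u" and refl_K: "\<And>j. j < n \<Longrightarrow> reflect n (u j) ` K = K"
    using K(3) by (auto simp: unconditional_def)
  have conv: "convex_Rn n K" using K(1) by (simp add: convex_body_def)
  then have K_Rn: "x \<in> K \<Longrightarrow> x \<in> Rn n" for x by (auto simp: convex_Rn_def)
  obtain R where R: "1 \<le> R" "\<And>x i. x \<in> K \<Longrightarrow> i < n \<Longrightarrow> \<bar>x i\<bar> \<le> R"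
    using K(1) compactin_Rn_bounded[of n K] by (auto simp: convex_body_def)
  have vol: "measure ?M K = 1" using K(2) by (simp add: isotropic_def)
  \<comment> \<open>\<open>measure\<close> is 0 on nonmeasurable sets, so volume 1 already contains
    measurability; similarly below it excludes infinite \<open>emeasure\<close>.\<close>
  have K_sets [measurable]: "K \<in> sets ?M"
    using vol measure_notin_sets[of K ?M] by force
  have K_emeasure: "emeasure ?M K = 1"
    using vol by (metis emeasure_eq_ennreal_measure ennreal_1 measure_zero_top zero_neq_one)
  obtain L where L: "0 < L" "\<And>\<theta>. \<theta> \<in> Rn n \<Longrightarrow> dot n \<theta> \<theta> = 1 \<Longrightarrow> (LINT x:K|?M. (dot n x \<theta>)\<^sup>2) = L\<^sup>2"
    using K(2) by (auto simp: isotropic_def)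
  define \<nu> where "\<nu> = density ?M (indicator K)"
  have sets_\<nu> [measurable_cong, simp]: "sets \<nu> = sets ?M" by (simp add: \<nu>_def)
  have LINT_\<nu>: "(LINT x:K|?M. f x) = (\<integral>x. f x \<partial>\<nu>)" if "f \<in> borel_measurable ?M" for f :: "_ \<Rightarrow> real"
  proof -
    have "\<nu> = density ?M (\<lambda>x. ennreal (indicator K x))"
      unfolding \<nu>_def by (rule density_cong) (auto simp: indicator_def)
    then show ?thesis
      using that by (simp add: set_lebesgue_integral_def integral_density)
  qed
  have fin_\<nu>: "finite_measure \<nu>"
    by standard (simp add: \<nu>_def emeasure_density K_emeasure)
  have AE_\<nu>: "AE x in \<nu>. x \<in> K"
  proof -
    have "(AE x in \<nu>. x \<in> K) \<longleftrightarrow> (AE x in ?M. 0 < (indicator K x :: ennreal) \<longrightarrow> x \<in> K)"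
      unfolding \<nu>_def by (rule AE_density) simp
    then show ?thesis by (simp add: indicator_def)
  qed
  define h where "h y = (\<integral>x. \<bar>dot n x y\<bar> powr q \<partial>\<nu>) powr (1 / q)" for y
  have Z: "Z_body n q K = {z \<in> Rn n. \<forall>y\<in>Rn n. dot n z y \<le> h y}"
    by (simp add: Z_body_def h_def LINT_\<nu>)
  have supp: "support_fun n (Z_body n q K) y = h y" if "y \<in> Rn n" for y
    unfolding Z
  proof (rule support_fun_moment_body[OF fin_\<nu> sets_\<nu> _ _ that h_def])
    show "AE x in \<nu>. \<forall>i<n. \<bar>x i\<bar> \<le> R" using AE_\<nu> by eventually_elim (simp add: R)
  qed (use q in simp)

  \<comment> \<open>The body in the coordinates of \<open>u\<close>, written as a preimage under
    \<open>comb\<close> so that measurability is immediate.\<close>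
  define K' where "K' = {z \<in> Rn n. comb n u z \<in> K}"
  have K'_eq: "K' = comb n u -` K \<inter> space ?M" by (auto simp: K'_def space_PiM)
  have coords_iff: "coords n u x \<in> K' \<longleftrightarrow> x \<in> K" if "x \<in> Rn n" for x
    using comb_coords[OF u that] by (simp add: K'_def)
  interpret B: unconditional_body n K' "max 1 (\<Sum>j<n. \<Sum>i<n. R * \<bar>u j i\<bar>)"
  proof
    show K'_sets: "K' \<in> sets ?M" unfolding K'_eq by measurable
    show "convex_Rn n K'"
      using conv by (auto simp: convex_Rn_def K'_def comb_convex_combination)
    show "x(i := - x i) \<in> K'" if x: "x \<in> K'" and i: "i < n" for x i
    proof -
      have "comb n u (x(i := - x i)) = reflect n (u i) (comb n u x)"
        using x i by (intro comb_flip[OF u]) (auto simp: K'_def)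
      also have "\<dots> \<in> K" using x refl_K[OF i] by (auto simp: K'_def)
      moreover have "x(i := - x i) \<in> Rn n" using x i by (auto simp: K'_def PiE_def extensional_def)
      ultimately show ?thesis by (simp add: K'_def)
    qed
    show "\<bar>z j\<bar> \<le> max 1 (\<Sum>j<n. \<Sum>i<n. R * \<bar>u j i\<bar>)" if z: "z \<in> K'" and j: "j < n" for z j
    proof -
      let ?x = "comb n u z"
      have x: "?x \<in> K" "z \<in> Rn n" using z by (auto simp: K'_def)
      have "z j = dot n ?x (u j)" using coords_comb[OF u x(2)] j by (metis coords_def lessThan_iff restrict_apply)
      also have "\<bar>\<dots>\<bar> \<le> (\<Sum>i<n. \<bar>?x i * u j i\<bar>)" unfolding dot_def by (rule sum_abs)
      also have "\<dots> \<le> (\<Sum>i<n. R * \<bar>u j i\<bar>)"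
        using R(2)[OF x(1)] by (intro sum_mono) (auto simp: abs_mult intro!: mult_right_mono)
      also have "\<dots> \<le> (\<Sum>j<n. \<Sum>i<n. R * \<bar>u j i\<bar>)"
        using j R(1) by (intro member_le_sum[of j _ "\<lambda>j. \<Sum>i<n. R * \<bar>u j i\<bar>"]) (auto intro!: sum_nonneg)
      finally show ?thesis by simp
    qed
    have "coords n u -` K' \<inter> Rn n = K" using coords_iff K_Rn by auto
    then show "emeasure ?M K' = 1" using emeasure_vimage_coords[OF u K'_sets] K_emeasure by simp
  qed simp
  have coords_\<nu> [measurable]: "coords n u \<in> measurable \<nu> ?M"
    unfolding measurable_cong_sets[OF sets_\<nu> refl] by measurable
  \<comment> \<open>The uniform law on \<open>K\<close> is carried to the uniform law on
    \<open>K'\<close>, because orthonormal coordinates preserve Lebesgue measure.\<close>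
  have push: "distr \<nu> ?M (coords n u) = B.P"
  proof (rule measure_eqI)
    fix A assume "A \<in> sets (distr \<nu> ?M (coords n u))"
    then have A [measurable]: "A \<in> sets ?M" by simp
    have *: "coords n u -` A \<inter> Rn n \<in> sets ?M"
      using measurable_sets[OF measurable_coords_comb(1) A] by (simp add: space_PiM)
    have "emeasure (distr \<nu> ?M (coords n u)) A = emeasure \<nu> (coords n u -` A \<inter> Rn n)"
      by (subst emeasure_distr) (auto simp: \<nu>_def space_PiM)
    also have "\<dots> = emeasure ?M (K \<inter> (coords n u -` A \<inter> Rn n))"
      using * by (simp add: \<nu>_def emeasure_density indicator_inter_arith[symmetric])
    also have "K \<inter> (coords n u -` A \<inter> Rn n) = coords n u -` (K' \<inter> A) \<inter> Rn n"
      using coords_iff by auto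
    also have "emeasure ?M \<dots> = emeasure ?M (K' \<inter> A)"
      using B.sets_K by (intro emeasure_vimage_coords u) auto
    also have "\<dots> = emeasure B.P A" using A by (rule B.emeasure_P[symmetric])
    finally show "emeasure (distr \<nu> ?M (coords n u)) A = emeasure B.P A" .
  qed simp
  have transfer: "(\<integral>z. f z \<partial>B.P) = (\<integral>x. f (coords n u x) \<partial>\<nu>)" if "f \<in> borel_measurable ?M" for f :: "_ \<Rightarrow> real"
    unfolding push[symmetric] by (rule integral_distr) (use that in auto)
  have L': "(\<integral>z. (z i)\<^sup>2 \<partial>B.P) = L\<^sup>2" if i: "i < n" for i
  proof -
    have "(\<integral>z. (z i)\<^sup>2 \<partial>B.P) = (\<integral>x. (dot n x (u i))\<^sup>2 \<partial>\<nu>)"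
      using i by (subst transfer) (auto simp: coords_def)
    also have "\<dots> = (LINT x:K|?M. (dot n x (u i))\<^sup>2)" by (rule LINT_\<nu>[symmetric]) measurable
    also have "\<dots> = L\<^sup>2" using u i by (intro L) (auto simp: orthonormal_basis_def)
    finally show ?thesis .
  qed
  have h_eq: "h y = B.Zq_norm q (coords n u y)" for y
  proof -
    have "(\<integral>z. \<bar>dot n z (coords n u y)\<bar> powr q \<partial>B.P) = (\<integral>x. \<bar>dot n (coords n u x) (coords n u y)\<bar> powr q \<partial>\<nu>)"
      by (rule transfer) measurable
    then show ?thesis by (simp add: h_def B.Zq_norm_def dot_coords[OF u])
  qed
  have "I1_Z_polar n q K = (LINT y:K|?M. B.Zq_norm q (coords n u y))"
    unfolding I1_Z_polar_def using supp K_Rn by (intro set_lebesgue_integral_cong) (auto simp: h_eq)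
  also have "\<dots> = (\<integral>y. B.Zq_norm q (coords n u y) \<partial>\<nu>)"
    by (intro LINT_\<nu> measurable_compose[OF measurable_coords_comb(1) B.Zq_norm_measurable])
  also have "\<dots> = (\<integral>z. B.Zq_norm q z \<partial>B.P)" by (rule transfer[symmetric]) measurable
  finally have I1: "I1_Z_polar n q K = (\<integral>z. B.Zq_norm q z \<partial>B.P)" .
  show "1 / (8 * (exp 1) ^ 3) * sqrt (q * real n) \<le> I1_Z_polar n q K"
    unfolding I1 by (rule B.integral_Zq_norm_ge[OF L(1) L' q])
  show "I1_Z_polar n q K \<le> 48 * exp 1 * (48 * 9) * sqrt (q * real n) * ln (real n)"
    unfolding I1 by (rule B.integral_Zq_norm_le[OF L(1) L' q])
qed

theorem mainTheorem7:
  "\<exists>c1>0. \<exists>c2>0. \<forall>(n::nat) (K :: (nat \<Rightarrow> real) set) (q::real).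
     convex_body n K \<longrightarrow> isotropic n K \<longrightarrow> unconditional n K \<longrightarrow>
     2 \<le> q \<longrightarrow> q \<le> real n \<longrightarrow>
       c1 * sqrt (q * real n) \<le> I1_Z_polar n q K \<and>
       I1_Z_polar n q K \<le> c2 * sqrt (q * real n) * ln (real n)"
proof (intro exI conjI allI impI)
  show "(0::real) < 1 / (8 * (exp 1) ^ 3)" "(0::real) < 48 * exp 1 * (48 * 9)" by simp_all
qed (use I1_Z_polar_bounds in auto)

end
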